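(* Let $f$ be a rational map of degree at least $2$ and let $\mu$ be an ergodic $f$-invariant probability measure on the Julia set $J(f)$ whose Lyapunov exponent $\chi_\mu(f)$ is strictly positive. Then for every Hölder continuous potential $\varphi: J(f)\to\mathbb{R}$ and each $t\ge 0$ we have $$P(f,\varphi - t\ln|f'|) > \int\varphi\,d\mu - t\,\chi_\mu(f).$$
   Context: Derivatives are taken with respect to the spherical metric on the Riemann sphere. For an $f$-invariant Borel probability measure $\nu$ on $J(f)$, $h_\nu(f)$ is its measure-theoretic entropy and $\chi_\nu(f) := \int\ln|f'|\,d\nu$ its Lyapunov exponent. For $\varphi$ Hölder continuous and $t\ge 0$, the pressure is defined through the variational principle: $$P(f,\varphi - t\ln|f'|) = \sup\left\{h_\nu(f) + \int\varphi\,d\nu - t\chi_\nu(f) : \nu \text{ an } f\text{-invariant probability measure on } J(f)\right\}.$$ *)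

theory Defs
  imports
    "HOL-Probability.Probability"
    "HOL-Computational_Algebra.Polynomial"
begin

section \<open>The Riemann sphere with the spherical metric\<close>

datatype riemann_sphere = Point complex | Infty

text \<open>
  Stereographic projection onto the unit sphere of \<open>\<complex> \<times> \<real>\<close>.  The spherical distance is the
  angle between the images, i.e. the geodesic distance of the Riemannian metric
  \<open>2 |dz| / (1 + |z|\<^sup>2)\<close>.
\<close>

fun stereo :: "riemann_sphere \<Rightarrow> complex \<times> real" where
  "stereo (Point z) =
     ((2 / (1 + (cmod z)\<^sup>2)) *\<^sub>R z, ((cmod z)\<^sup>2 - 1) / ((cmod z)\<^sup>2 + 1))"
| "stereo Infty = (0, 1)"

declare stereo.simps [simp del]

lemma one_plus_sq_pos: "0 < 1 + (cmod z)\<^sup>2"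
  by (simp add: add_pos_nonneg)

lemma one_plus_sq_nz: "1 + (cmod z)\<^sup>2 \<noteq> 0"
  using one_plus_sq_pos[of z] by linarith

lemma inner_stereo_Point:
  "stereo (Point z) \<bullet> stereo (Point w) =
     1 - 2 * (cmod (z - w))\<^sup>2 / ((1 + (cmod z)\<^sup>2) * (1 + (cmod w)\<^sup>2))"
proof -
  have e: "(cmod (z - w))\<^sup>2 = (cmod z)\<^sup>2 + (cmod w)\<^sup>2 - 2 * (z \<bullet> w)"
    by (simp add: power2_norm_eq_inner inner_diff_left inner_diff_right inner_commute)
  have "stereo (Point z) \<bullet> stereo (Point w) =
     2 / (1 + (cmod z)\<^sup>2) * (2 / (1 + (cmod w)\<^sup>2) * (z \<bullet> w)) +
     ((cmod z)\<^sup>2 - 1) / (1 + (cmod z)\<^sup>2) * (((cmod w)\<^sup>2 - 1) / (1 + (cmod w)\<^sup>2))"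
    by (simp add: stereo.simps add.commute)
  also have "\<dots> = 1 - 2 * (cmod (z - w))\<^sup>2 / ((1 + (cmod z)\<^sup>2) * (1 + (cmod w)\<^sup>2))"
    unfolding e using one_plus_sq_nz[of z] one_plus_sq_nz[of w]
    by (simp add: divide_simps) (simp add: algebra_simps)
  finally show ?thesis .
qed

lemma norm_stereo [simp]: "norm (stereo a) = 1"
proof (cases a)
  case (Point z)
  have "stereo (Point z) \<bullet> stereo (Point z) = 1"
    unfolding inner_stereo_Point by simp
  then show ?thesis
    unfolding Point norm_eq_sqrt_inner by simp
qed (simp add: stereo.simps norm_Pair)

lemma inner_stereo_self [simp]: "stereo a \<bullet> stereo a = 1"
  by (simp flip: power2_norm_eq_inner)

definition unstereo :: "complex \<times> real \<Rightarrow> complex" where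
  "unstereo v = (1 / (1 - snd v)) *\<^sub>R fst v"

lemma snd_stereo_Point: "1 - snd (stereo (Point z)) = 2 / (1 + (cmod z)\<^sup>2)"
  using one_plus_sq_nz[of z] by (simp add: stereo.simps field_simps)

lemma unstereo_stereo: "unstereo (stereo (Point z)) = z"
proof -
  define r where "r = 1 + (cmod z)\<^sup>2"
  have "r \<noteq> 0" unfolding r_def by (rule one_plus_sq_nz)
  then show ?thesis
    unfolding unstereo_def snd_stereo_Point by (simp add: stereo.simps flip: r_def)
qed

lemma stereo_Point_neq_Infty: "stereo (Point z) \<noteq> stereo Infty"
proof
  assume "stereo (Point z) = stereo Infty"
  then have "2 / (1 + (cmod z)\<^sup>2) = 1 - snd (stereo Infty)"
    using snd_stereo_Point[of z] by simp
  then show False using one_plus_sq_nz[of z] by (simp add: stereo.simps)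
qed

lemma stereo_eq_iff: "stereo a = stereo b \<longleftrightarrow> a = b"
  by (cases a; cases b) (metis unstereo_stereo stereo_Point_neq_Infty)+

lemma inner_unit_bounds:
  fixes x y :: "'a :: real_inner"
  assumes "norm x = 1" "norm y = 1"
  shows "-1 \<le> x \<bullet> y" "x \<bullet> y \<le> 1"
  using Cauchy_Schwarz_ineq2[of x y] assms by auto

lemma arccos_inner_triangle:
  fixes x y z :: "'a :: real_inner"
  assumes n: "norm x = 1" "norm y = 1" "norm z = 1"
  shows "arccos (x \<bullet> z) \<le> arccos (x \<bullet> y) + arccos (y \<bullet> z)"
proof (cases "arccos (x \<bullet> y) + arccos (y \<bullet> z) \<le> pi")
  case False
  then show ?thesis
    using arccos_ubound[of "x \<bullet> z"] inner_unit_bounds[of x z] n by linarith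
next
  case True
  define u where "u = x - (x \<bullet> y) *\<^sub>R y"
  define v where "v = z - (y \<bullet> z) *\<^sub>R y"
  have yy: "y \<bullet> y = 1" "x \<bullet> x = 1" "z \<bullet> z = 1"
    using n by (simp_all flip: power2_norm_eq_inner)
  have uv: "u \<bullet> v = x \<bullet> z - (x \<bullet> y) * (y \<bullet> z)"
    unfolding u_def v_def
    by (simp add: inner_diff_left inner_diff_right yy inner_commute algebra_simps)
  have "u \<bullet> u = 1 - (x \<bullet> y)\<^sup>2" "v \<bullet> v = 1 - (y \<bullet> z)\<^sup>2"
    unfolding u_def v_def
    by (simp_all add: inner_diff_left inner_diff_right yy inner_commute algebra_simps power2_eq_square)
  then have nu: "norm u = sqrt (1 - (x \<bullet> y)\<^sup>2)" "norm v = sqrt (1 - (y \<bullet> z)\<^sup>2)"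
    by (simp_all add: norm_eq_sqrt_inner)
  have b: "-1 \<le> x \<bullet> y" "x \<bullet> y \<le> 1" "-1 \<le> y \<bullet> z" "y \<bullet> z \<le> 1" "-1 \<le> x \<bullet> z" "x \<bullet> z \<le> 1"
    using inner_unit_bounds n by blast+
  have "cos (arccos (x \<bullet> y) + arccos (y \<bullet> z)) = (x \<bullet> y) * (y \<bullet> z) - norm u * norm v"
    using b by (simp add: cos_add sin_arccos_abs sin_arccos nu)
  also have "\<dots> \<le> x \<bullet> z"
    using Cauchy_Schwarz_ineq2[of u v] uv by linarith
  finally have "arccos (x \<bullet> z) \<le> arccos (cos (arccos (x \<bullet> y) + arccos (y \<bullet> z)))"
    using b by (intro arccos_le_arccos) auto
  also have "\<dots> = arccos (x \<bullet> y) + arccos (y \<bullet> z)"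
    using True b by (intro arccos_cos) (auto intro!: add_nonneg_nonneg arccos_lbound)
  finally show ?thesis .
qed

instantiation riemann_sphere :: metric_space
begin

definition dist_riemann_sphere :: "riemann_sphere \<Rightarrow> riemann_sphere \<Rightarrow> real" where
  "dist_riemann_sphere a b = arccos (stereo a \<bullet> stereo b)"

definition uniformity_riemann_sphere :: "(riemann_sphere \<times> riemann_sphere) filter" where
  "uniformity_riemann_sphere = (INF e\<in>{0<..}. principal {(x, y). dist x y < e})"

definition open_riemann_sphere :: "riemann_sphere set \<Rightarrow> bool" where
  "open_riemann_sphere U =
     (\<forall>x\<in>U. \<forall>\<^sub>F (x', y) in uniformity. x' = x \<longrightarrow> y \<in> U)"

instance
proof
  fix a b c :: riemann_sphere
  have bd: "-1 \<le> stereo a \<bullet> stereo b" "stereo a \<bullet> stereo b \<le> 1"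
    using inner_unit_bounds[of "stereo a" "stereo b"] by auto
  show "dist a b = 0 \<longleftrightarrow> a = b"
  proof
    assume "dist a b = 0"
    then have "stereo a \<bullet> stereo b = 1"
      using cos_arccos[OF bd] by (simp add: dist_riemann_sphere_def)
    then have "(norm (stereo a - stereo b))\<^sup>2 = 0"
      unfolding power2_norm_eq_inner
      by (simp add: inner_diff_left inner_diff_right inner_commute)
    then show "a = b" by (simp add: stereo_eq_iff)
  qed (simp add: dist_riemann_sphere_def)
  show "dist a b \<le> dist a c + dist b c"
    unfolding dist_riemann_sphere_def
    using arccos_inner_triangle[of "stereo a" "stereo c" "stereo b"]
    by (simp add: inner_commute)
qed (simp_all add: uniformity_riemann_sphere_def open_riemann_sphere_def)

end

lemma dist_Point:
  "dist (Point z) (Point w) =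
     2 * arcsin (cmod (z - w) / (sqrt (1 + (cmod z)\<^sup>2) * sqrt (1 + (cmod w)\<^sup>2)))"
proof -
  define c where "c = cmod (z - w) / (sqrt (1 + (cmod z)\<^sup>2) * sqrt (1 + (cmod w)\<^sup>2))"
  have c0: "0 \<le> c" by (simp add: c_def)
  have c2: "c\<^sup>2 = (cmod (z - w))\<^sup>2 / ((1 + (cmod z)\<^sup>2) * (1 + (cmod w)\<^sup>2))"
    using one_plus_sq_pos[of z] one_plus_sq_pos[of w]
    by (simp add: c_def power_divide power_mult_distrib)
  have i: "stereo (Point z) \<bullet> stereo (Point w) = 1 - 2 * c\<^sup>2"
    unfolding inner_stereo_Point c2 by simp
  have "c\<^sup>2 \<le> 1"
    using inner_unit_bounds[of "stereo (Point z)" "stereo (Point w)"] i by simp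
  then have c1: "c \<le> 1" by (intro power2_le_imp_le[of c 1]) simp_all
  have "sin (arcsin c) = c"
    using c0 c1 by (intro sin_arcsin) linarith+
  then have "1 - 2 * c\<^sup>2 = cos (2 * arcsin c)"
    by (simp only: cos_double_sin)
  moreover have "arccos (cos (2 * arcsin c)) = 2 * arcsin c"
  proof (rule arccos_cos)
    show "0 \<le> 2 * arcsin c" using c0 c1 arcsin_le_arcsin[of 0 c] by simp
    show "2 * arcsin c \<le> pi" using c0 c1 arcsin_bounded[of c] by simp
  qed
  ultimately show ?thesis
    unfolding dist_riemann_sphere_def i c_def[symmetric] by simp
qed

section \<open>Rational maps, spherical derivative, Julia set\<close>

text \<open>Evaluation of \<open>p / q\<close> on the sphere; meaningful for coprime \<open>p\<close> and \<open>q \<noteq> 0\<close>.\<close>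

fun rational_eval :: "complex poly \<Rightarrow> complex poly \<Rightarrow> riemann_sphere \<Rightarrow> riemann_sphere" where
  "rational_eval p q (Point z) =
     (if poly q z = 0 then Infty else Point (poly p z / poly q z))"
| "rational_eval p q Infty =
     (if degree p > degree q then Infty else Point (coeff p (degree q) / lead_coeff q))"

definition rational_map_of_degree :: "(riemann_sphere \<Rightarrow> riemann_sphere) \<Rightarrow> nat \<Rightarrow> bool" where
  "rational_map_of_degree f d \<longleftrightarrow>
     (\<exists>p q. coprime p q \<and> q \<noteq> 0 \<and> f = rational_eval p q \<and> d = max (degree p) (degree q))"

text \<open>
  \<open>|f'|\<close> with respect to the spherical metric: the local dilatation.  Unlike the chart formula
  (derived in \<open>spherical_deriv_Point\<close> below) this also covers \<open>Infty\<close> and poles.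
\<close>

definition spherical_deriv :: "(riemann_sphere \<Rightarrow> riemann_sphere) \<Rightarrow> riemann_sphere \<Rightarrow> real" where
  "spherical_deriv f z = Lim (at z) (\<lambda>w. dist (f w) (f z) / dist w z)"

definition normal_family_on ::
  "riemann_sphere set \<Rightarrow> (riemann_sphere \<Rightarrow> riemann_sphere) set \<Rightarrow> bool" where
  "normal_family_on U F \<longleftrightarrow>
     (\<forall>s :: nat \<Rightarrow> riemann_sphere \<Rightarrow> riemann_sphere. range s \<subseteq> F \<longrightarrow>
        (\<exists>r g. strict_mono r \<and>
           (\<forall>K. compact K \<and> K \<subseteq> U \<longrightarrow> uniform_limit K (s \<circ> r) g sequentially)))"

definition fatou_set :: "(riemann_sphere \<Rightarrow> riemann_sphere) \<Rightarrow> riemann_sphere set" where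
  "fatou_set f = {z. \<exists>U. open U \<and> z \<in> U \<and> normal_family_on U (range (\<lambda>n. f ^^ n))}"

definition julia_set :: "(riemann_sphere \<Rightarrow> riemann_sphere) \<Rightarrow> riemann_sphere set" where
  "julia_set f = - fatou_set f"

section \<open>Invariant measures, entropy, Lyapunov exponent, pressure\<close>

definition invariant_prob ::
  "(riemann_sphere \<Rightarrow> riemann_sphere) \<Rightarrow> riemann_sphere measure \<Rightarrow> bool" where
  "invariant_prob f \<nu> \<longleftrightarrow>
     prob_space \<nu> \<and> sets \<nu> = sets (restrict_space borel (julia_set f)) \<and>
     f \<in> measurable \<nu> \<nu> \<and> distr \<nu> \<nu> f = \<nu>"

definition ergodic_prob ::
  "(riemann_sphere \<Rightarrow> riemann_sphere) \<Rightarrow> riemann_sphere measure \<Rightarrow> bool" where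
  "ergodic_prob f \<nu> \<longleftrightarrow> invariant_prob f \<nu> \<and>
     (\<forall>A\<in>sets \<nu>. f -` A \<inter> space \<nu> = A \<longrightarrow> measure \<nu> A = 0 \<or> measure \<nu> A = 1)"

definition finite_measurable_partition :: "'a measure \<Rightarrow> 'a set set \<Rightarrow> bool" where
  "finite_measurable_partition \<nu> \<xi> \<longleftrightarrow>
     finite \<xi> \<and> \<xi> \<subseteq> sets \<nu> \<and> partition_on (space \<nu>) \<xi>"

definition partition_entropy :: "'a measure \<Rightarrow> 'a set set \<Rightarrow> real" where
  "partition_entropy \<nu> \<xi> = - (\<Sum>A\<in>\<xi>. measure \<nu> A * ln (measure \<nu> A))"

text \<open>The join of the pullbacks of \<open>\<xi>\<close> under \<open>f ^^ i\<close> for \<open>i < n\<close>.\<close>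

definition iterated_join :: "'a measure \<Rightarrow> ('a \<Rightarrow> 'a) \<Rightarrow> 'a set set \<Rightarrow> nat \<Rightarrow> 'a set set" where
  "iterated_join \<nu> f \<xi> n =
     {{x \<in> space \<nu>. \<forall>i<n. (f ^^ i) x \<in> a i} | a. \<forall>i<n. a i \<in> \<xi>} - {{}}"

definition entropy_wrt :: "'a measure \<Rightarrow> ('a \<Rightarrow> 'a) \<Rightarrow> 'a set set \<Rightarrow> real" where
  "entropy_wrt \<nu> f \<xi> = lim (\<lambda>n. partition_entropy \<nu> (iterated_join \<nu> f \<xi> n) / real n)"

definition measure_entropy :: "'a measure \<Rightarrow> ('a \<Rightarrow> 'a) \<Rightarrow> ereal" where
  "measure_entropy \<nu> f =
     (SUP \<xi> \<in> {\<xi>. finite_measurable_partition \<nu> \<xi>}. ereal (entropy_wrt \<nu> f \<xi>))"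

text \<open>
  The library's \<open>ln 0 = 0\<close> would give the wrong value at critical points, and the Bochner integral
  of a non-integrable function is \<open>0\<close>; hence extended-real logarithm and integral.  The latter is
  only used where the positive part has finite integral.
\<close>

definition eln :: "real \<Rightarrow> ereal" where
  "eln x = (if x \<le> 0 then -\<infinity> else ereal (ln x))"

definition ereal_integral :: "'a measure \<Rightarrow> ('a \<Rightarrow> ereal) \<Rightarrow> ereal" where
  "ereal_integral \<nu> g =
     enn2ereal (\<integral>\<^sup>+ x. e2ennreal (max 0 (g x)) \<partial>\<nu>) - enn2ereal (\<integral>\<^sup>+ x. e2ennreal (max 0 (- g x)) \<partial>\<nu>)"

definition lyapunov_exponent ::
  "(riemann_sphere \<Rightarrow> riemann_sphere) \<Rightarrow> riemann_sphere measure \<Rightarrow> ereal" where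
  "lyapunov_exponent f \<nu> = ereal_integral \<nu> (\<lambda>z. eln (spherical_deriv f z))"

definition holder_continuous_on :: "'a :: metric_space set \<Rightarrow> ('a \<Rightarrow> real) \<Rightarrow> bool" where
  "holder_continuous_on S \<phi> \<longleftrightarrow>
     (\<exists>\<alpha> C. 0 < \<alpha> \<and> \<alpha> \<le> 1 \<and> (\<forall>x\<in>S. \<forall>y\<in>S. \<bar>\<phi> x - \<phi> y\<bar> \<le> C * dist x y powr \<alpha>))"

text \<open>\<open>pressure f \<phi> t\<close> is \<open>P(f, \<phi> - t ln|f'|)\<close>; since the
  exponent is \<open>< \<infinity>\<close>, no \<open>\<infinity> - \<infinity>\<close> arises for \<open>t \<ge> 0\<close>.\<close>

definition pressure ::
  "(riemann_sphere \<Rightarrow> riemann_sphere) \<Rightarrow> (riemann_sphere \<Rightarrow> real) \<Rightarrow> real \<Rightarrow> ereal" where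
  "pressure f \<phi> t =
     (SUP \<nu> \<in> {\<nu>. invariant_prob f \<nu>}.
        measure_entropy \<nu> f + ereal (\<integral>z. \<phi> z \<partial>\<nu>) - ereal t * lyapunov_exponent f \<nu>)"

section \<open>The spherical derivative in the affine chart\<close>

lemma chord_le_dist: "dist (stereo a) (stereo b) \<le> dist a b"
proof -
  define t where "t = dist a b"
  have bd: "-1 \<le> stereo a \<bullet> stereo b" "stereo a \<bullet> stereo b \<le> 1"
    using inner_unit_bounds[of "stereo a" "stereo b"] by auto
  have "cos t = stereo a \<bullet> stereo b"
    using bd by (simp add: t_def dist_riemann_sphere_def)
  moreover have "(dist (stereo a) (stereo b))\<^sup>2 = 2 - 2 * (stereo a \<bullet> stereo b)"
    unfolding dist_norm power2_norm_eq_inner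
    by (simp add: inner_diff_left inner_diff_right inner_commute)
  moreover have "cos t = 1 - 2 * (sin (t / 2))\<^sup>2"
    using cos_double_sin[of "t / 2"] by simp
  ultimately have "(dist (stereo a) (stereo b))\<^sup>2 = (2 * sin (t / 2))\<^sup>2"
    by (simp add: power_mult_distrib)
  moreover have "(2 * sin (t / 2))\<^sup>2 \<le> t\<^sup>2"
    using abs_sin_le_one abs_sin_x_le_abs_x[of "t / 2"] by (intro abs_le_square_iff[THEN iffD1]) simp
  ultimately have "(dist (stereo a) (stereo b))\<^sup>2 \<le> (dist a b)\<^sup>2"
    by (simp add: t_def)
  then show ?thesis
    by (rule power2_le_imp_le) (rule zero_le_dist)
qed

lemma continuous_stereo: "isCont stereo a"
  unfolding continuous_at_eps_delta
  using chord_le_dist by (metis le_less_trans)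

lemma dist_Point_rate:
  "\<exists>F. isCont F a \<and> F a = 2 / (1 + (cmod a)\<^sup>2) \<and>
       (\<forall>v. dist (Point v) (Point a) = F v * cmod (v - a))"
proof -
  define S where "S = (\<lambda>c :: real. if c = 0 then 1 else arcsin c / c)"
  define q where "q = (\<lambda>v. sqrt (1 + (cmod v)\<^sup>2) * sqrt (1 + (cmod a)\<^sup>2))"
  define F where "F = (\<lambda>v. 2 * S (cmod (v - a) / q v) / q v)"
  have qpos: "q v > 0" for v
    using one_plus_sq_pos[of a] one_plus_sq_pos[of v] by (simp add: q_def)
  have "(arcsin has_real_derivative 1) (at 0)"
    using DERIV_arcsin[of 0] by simp
  then have "((\<lambda>c. arcsin c / c) \<longlongrightarrow> 1) (at 0)"
    by (simp add: DERIV_def)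
  then have "(S \<longlongrightarrow> 1) (at 0)"
    by (rule Lim_transform_eventually) (auto simp: S_def eventually_at_filter)
  then have S: "isCont S 0"
    by (simp add: isCont_def S_def)
  have q: "isCont q a"
    unfolding q_def by (intro continuous_intros)
  have qa: "q a = 1 + (cmod a)\<^sup>2"
    using one_plus_sq_pos[of a] by (simp add: q_def)
  have "isCont (\<lambda>v. cmod (v - a) / q v) a"
    using qpos[of a] by (intro continuous_intros q) auto
  then have "isCont (\<lambda>v. S (cmod (v - a) / q v)) a"
    by (rule isCont_o2) (use S in simp)
  then have "isCont F a"
    unfolding F_def using qpos[of a] by (intro continuous_intros q) auto
  moreover have "F a = 2 / (1 + (cmod a)\<^sup>2)"
    by (simp add: F_def S_def qa)
  moreover have "dist (Point v) (Point a) = F v * cmod (v - a)" for v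
    unfolding dist_Point using qpos[of v] by (simp add: F_def S_def q_def)
  ultimately show ?thesis by blast
qed

lemma filterlim_Point: "filterlim Point (at (Point a)) (at a)"
proof -
  obtain F where F: "isCont F a" "\<And>v. dist (Point v) (Point a) = F v * cmod (v - a)"
    using dist_Point_rate[of a] by blast
  have "isCont (\<lambda>v. F v * cmod (v - a)) a"
    by (intro continuous_intros F)
  then have "((\<lambda>v. dist (Point v) (Point a)) \<longlongrightarrow> 0) (at a)"
    unfolding F(2) isCont_def by simp
  then have "(Point \<longlongrightarrow> Point a) (at a)"
    using tendsto_dist_iff by blast
  moreover have "\<forall>\<^sub>F v in at a. Point v \<in> UNIV \<and> Point v \<noteq> Point a"
    unfolding eventually_at_filter by simp
  ultimately show ?thesis
    unfolding filterlim_at by (rule conjI[rotated])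
qed

lemma spherical_deriv_Point:
  assumes g: "(g has_field_derivative D) (at z)"
    and f: "\<forall>\<^sub>F w in nhds z. f (Point w) = Point (g w)"
  shows "spherical_deriv f (Point z) = cmod D * (1 + (cmod z)\<^sup>2) / (1 + (cmod (g z))\<^sup>2)"
    (is "_ = ?L")
proof -
  obtain F where F: "isCont F z" "F z = 2 / (1 + (cmod z)\<^sup>2)"
      "\<And>v. dist (Point v) (Point z) = F v * cmod (v - z)"
    using dist_Point_rate[of z] by blast
  obtain G where G: "isCont G (g z)" "G (g z) = 2 / (1 + (cmod (g z))\<^sup>2)"
      "\<And>v. dist (Point v) (Point (g z)) = G v * cmod (v - g z)"
    using dist_Point_rate[of "g z"] by blast
  have fz: "f (Point z) = Point (g z)"
    by (rule eventually_nhds_x_imp_x[OF f])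
  have "((\<lambda>w. G (g w) / F w * cmod ((g w - g z) / (w - z))) \<longlongrightarrow> G (g z) / F z * cmod D) (at z)"
  proof (intro tendsto_intros)
    have "isCont (\<lambda>w. G (g w)) z"
      using DERIV_isCont[OF g] G(1) by (rule isCont_o2)
    then show "((\<lambda>w. G (g w)) \<longlongrightarrow> G (g z)) (at z)" by (simp add: isCont_def)
    show "(F \<longlongrightarrow> F z) (at z)" using F(1) by (simp add: isCont_def)
    show "F z \<noteq> 0" using one_plus_sq_nz[of z] by (simp add: F(2))
    show "((\<lambda>w. (g w - g z) / (w - z)) \<longlongrightarrow> D) (at z)"
      using g by (simp add: has_field_derivative_iff)
  qed
  moreover have "G (g z) / F z * cmod D = ?L"
    using one_plus_sq_nz[of z] one_plus_sq_nz[of "g z"]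
    by (simp add: F(2) G(2) divide_simps) (simp add: algebra_simps)
  ultimately have "((\<lambda>w. G (g w) / F w * cmod ((g w - g z) / (w - z))) \<longlongrightarrow> ?L) (at z)"
    by simp
  moreover have "\<forall>\<^sub>F w in at z. G (g w) / F w * cmod ((g w - g z) / (w - z)) =
      dist (f (Point w)) (f (Point z)) / dist (Point w) (Point z)"
    using f unfolding eventually_at_filter
    by eventually_elim (simp only: fz F(3) G(3) norm_divide times_divide_times_eq, intro impI refl)
  ultimately have R: "((\<lambda>w. dist (f (Point w)) (f (Point z)) / dist (Point w) (Point z)) \<longlongrightarrow> ?L) (at z)"
    by (rule Lim_transform_eventually)
  define h where "h = (\<lambda>a. unstereo (stereo a))"
  have hP: "h (Point w) = w" for w
    unfolding h_def by (rule unstereo_stereo)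
  have Ph: "Point (h a) = a" if "a \<noteq> Infty" for a
    using that hP by (cases a) simp_all
  have s1: "1 - snd (stereo (Point z)) \<noteq> 0"
    unfolding snd_stereo_Point using one_plus_sq_nz[of z] by simp
  have "isCont h (Point z)"
    unfolding h_def unstereo_def
    by (intro continuous_intros continuous_stereo s1)
  then have lim: "(h \<longlongrightarrow> z) (at (Point z))"
    unfolding isCont_def hP .
  have "\<forall>\<^sub>F a in at (Point z). a \<in> - {Infty}"
    by (rule eventually_at_in_open') (auto intro: open_Compl)
  then have fin: "\<forall>\<^sub>F a in at (Point z). a \<noteq> Infty"
    by simp
  have neq: "\<forall>\<^sub>F a in at (Point z). a \<noteq> Point z"
    by (rule eventually_neq_at_within)
  have "\<forall>\<^sub>F a in at (Point z). h a \<in> UNIV \<and> h a \<noteq> z"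
    using fin neq by eventually_elim (use Ph in force)
  with lim have "filterlim h (at z) (at (Point z))"
    unfolding filterlim_at by (rule conjI[rotated])
  from filterlim_compose[OF R this]
  have "((\<lambda>a. dist (f a) (f (Point z)) / dist a (Point z)) \<longlongrightarrow> ?L) (at (Point z))"
  proof (rule Lim_transform_eventually)
    show "\<forall>\<^sub>F a in at (Point z). dist (f (Point (h a))) (f (Point z)) / dist (Point (h a)) (Point z) =
        dist (f a) (f (Point z)) / dist a (Point z)"
      using fin by eventually_elim (simp only: Ph not_False_eq_True)
  qed
  moreover have "at (Point z) \<noteq> bot"
  proof
    assume b: "at (Point z) = bot"
    have "filtermap Point (at z) = bot"
      using filterlim_Point[of z] unfolding filterlim_def b by (rule bot.extremum_uniqueI)
    then show False
      by (simp add: filtermap_bot_iff)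
  qed
  ultimately show ?thesis
    unfolding spherical_deriv_def by (intro tendsto_Lim)
qed

end

theory Submission
  imports
    Defs
    "HOL-Complex_Analysis.Complex_Analysis"
    "HOL-Computational_Algebra.Fundamental_Theorem_Algebra"
    "HOL-Real_Asymp.Real_Asymp"
begin

text \<open>
  Write \<open>P0\<close> for the right-hand side.  Take a \<open>\<mu>\<close>-generic point \<open>x\<close>: a set of times of positive upper
  density is hyperbolic for \<open>x\<close>, so that the orbit can be followed backwards from \<open>f\<^sup>n x\<close> on discs of
  definite size with bounded distortion, and the Birkhoff sums of \<open>\<phi> - t ln |f'| - P0\<close> along \<open>x\<close> are
  \<open>\<ge> -o(n)\<close>.  Hence there is a hyperbolic time \<open>n\<close> preceded by arbitrarily many hyperbolic times \<open>i\<close>,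
  with all \<open>f\<^sup>i x\<close> and \<open>f\<^sup>n x\<close> near one point \<open>b\<close>, for which the Birkhoff sum from \<open>i\<close> to \<open>n\<close> is at
  least \<open>(n - i) P0 - 1\<close>.

  The branches of the inverse of \<open>f ^^ (n - i)\<close> from \<open>f\<^sup>n x\<close> to \<open>f\<^sup>i x\<close> are restricted to a disc around one of
  three preimages of \<open>b\<close> under some \<open>f ^^ a\<close> and followed by a branch of the inverse of \<open>f ^^ a\<close> leading back
  to that preimage.  For each \<open>i\<close>, at most one of the three is excluded because the critical value \<open>b\<close> lies
  in the domain of this branch, and at most one because \<open>f\<^bsup>i-a\<^esup> x\<close> is close to it.  This gives finitely many contractions
  of one disc that generate a free iterated function system.  The Bernoulli measure on words of equal length and
  equal total return time projects to an invariant measure whose free energy exceeds \<open>P0\<close>, because the number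
  of branches beats the bounded errors.
\<close>

section \<open>Upper density and hyperbolic times\<close>

text \<open>Since \<open>\<mu>\<close> may have zero entropy, strictness has to come from the number
  of returns \<open>i\<close> outweighing one constant of error, and this constant must be known
  before \<open>n\<close> is chosen. Distortion and Hoelder errors sum to geometric series in the
  distance to the hyperbolic time, and the detour by the inverse of \<open>f ^^ a\<close> costs at
  most a multiple of \<open>a\<close>, which is fixed before \<open>n\<close>. The detour makes the
  system free: plain returns to a disc at \<open>b\<close> may pass through that disc at
  intermediate times, so different words could lead to the same point. With the detour, the orbit
  followed by a branch is near some \<open>(f ^^ (i - a)) x\<close> at the times that matter, and
  this point is kept away from the target. The price is that the target may be ramified over
  \<open>b\<close>; its inverse branch is then an \<open>m\<close>-th root, available only on images
  that omit \<open>b\<close>. The logarithm of the derivative is unbounded below. It is truncated at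
  a level not above any derivative along the chosen orbit piece; for \<open>t \<ge> 0\<close>
  truncation can only lower the free energy, so a bound for the truncated potential
  suffices.\<close>

definition pos_upper_density :: "nat set \<Rightarrow> bool" where
  "pos_upper_density R \<longleftrightarrow> (\<exists>\<theta>>0. \<exists>\<^sub>\<infinity>n. \<theta> * real n \<le> real (card (R \<inter> {..<n})))"

text \<open>If infinitely many initial segments contain at least the fraction \<theta> of the union,
  one of the two sets has at least \<theta>/2 in infinitely many of them. This splitting, which
  lower density does not have, justifies every later passage to a subset by pigeonhole.\<close>

lemma pos_upper_density_Un:
  assumes "pos_upper_density (R \<union> S)"
  shows "pos_upper_density R \<or> pos_upper_density S"
proof -
  obtain \<theta> where \<theta>: "\<theta> > 0" "\<exists>\<^sub>\<infinity>n. \<theta> * real n \<le> real (card ((R \<union> S) \<inter> {..<n}))"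
    using assms unfolding pos_upper_density_def by blast
  have "\<exists>\<^sub>\<infinity>n. \<theta>/2 * real n \<le> real (card (R \<inter> {..<n})) \<or> \<theta>/2 * real n \<le> real (card (S \<inter> {..<n}))"
    using \<theta>(2)
  proof (rule INFM_mono)
    fix n assume "\<theta> * real n \<le> real (card ((R \<union> S) \<inter> {..<n}))"
    also have "real (card ((R \<union> S) \<inter> {..<n})) \<le> real (card (R \<inter> {..<n})) + real (card (S \<inter> {..<n}))"
      using card_Un_le[of "R \<inter> {..<n}" "S \<inter> {..<n}"]
      by (simp add: Int_Un_distrib2 flip: of_nat_add)
    finally show "\<theta>/2 * real n \<le> real (card (R \<inter> {..<n})) \<or> \<theta>/2 * real n \<le> real (card (S \<inter> {..<n}))"
      by (auto simp: field_simps)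
  qed
  then show ?thesis
    unfolding pos_upper_density_def INFM_disj_distrib using \<theta>(1) half_gt_zero by blast
qed

lemma not_pos_upper_density_finite:
  assumes "finite R"
  shows "\<not> pos_upper_density R"
proof
  assume "pos_upper_density R"
  then obtain \<theta> where \<theta>: "\<theta> > 0" "\<exists>\<^sub>\<infinity>n. \<theta> * real n \<le> real (card (R \<inter> {..<n}))"
    unfolding pos_upper_density_def by blast
  obtain N where N: "real N > real (card R) / \<theta>"
    using reals_Archimedean2 by blast
  obtain n where n: "n \<ge> N" "\<theta> * real n \<le> real (card (R \<inter> {..<n}))"
    using \<theta>(2) unfolding INFM_nat_le by blast
  have "card (R \<inter> {..<n}) \<le> card R"
    using assms by (intro card_mono) auto
  then have "\<theta> * real N \<le> real (card R)"
    using n \<theta>(1) by (smt (verit) mult_left_mono of_nat_le_iff)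
  then show False
    using N \<theta>(1) by (simp add: field_simps)
qed

lemma pos_upper_density_UN:
  assumes "finite I" "pos_upper_density (\<Union>i\<in>I. R i)"
  shows "\<exists>i\<in>I. pos_upper_density (R i)"
  using assms
proof (induction I rule: finite_induct)
  case empty
  then show ?case using not_pos_upper_density_finite[of "{}"] by simp
next
  case (insert x F)
  then show ?case using pos_upper_density_Un[of "R x" "\<Union>i\<in>F. R i"] by auto
qed

lemma pos_upper_density_tail:
  assumes "pos_upper_density R"
  shows "pos_upper_density (R \<inter> {a..})"
proof -
  have "R = (R \<inter> {..<a}) \<union> (R \<inter> {a..})" by auto
  then show ?thesis
    using pos_upper_density_Un[of "R \<inter> {..<a}" "R \<inter> {a..}"] assms
      not_pos_upper_density_finite[of "R \<inter> {..<a}"] by auto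
qed

lemma pos_upper_density_sparse_subset:
  assumes "pos_upper_density R" "Q > 0"
  obtains R' where "R' \<subseteq> R" "pos_upper_density R'"
    "\<And>i j. i \<in> R' \<Longrightarrow> j \<in> R' \<Longrightarrow> i < j \<Longrightarrow> i + Q \<le> j"
proof -
  \<comment> \<open>Distinct members of one residue class modulo \<open>Q\<close> are at least
    \<open>Q\<close> apart.\<close>
  have "R = (\<Union>e\<in>{..<Q}. {m\<in>R. m mod Q = e})"
    using assms(2) by auto
  then obtain e where e: "pos_upper_density {m\<in>R. m mod Q = e}"
    using pos_upper_density_UN[of "{..<Q}" "\<lambda>e. {m\<in>R. m mod Q = e}"] assms(1) by auto
  show ?thesis
  proof (rule that[OF _ e])
    fix i j assume "i \<in> {m\<in>R. m mod Q = e}" "j \<in> {m\<in>R. m mod Q = e}" "i < j"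
    then have "Q dvd (j - i)" "i < j"
      by (auto simp: mod_eq_dvd_iff_nat)
    then show "i + Q \<le> j"
      using dvd_imp_le[of Q "j - i"] by auto
  qed auto
qed

text \<open>If every member of \<open>R\<close> had fewer than \<open>M\<close> such predecessors,
  one of the \<open>M\<close> members preceding \<open>t j\<close> would have a value above
  \<open>s (t j) + C\<close>. Along \<open>R\<close> the values would then drop by \<open>C\<close>
  for every \<open>M\<close> members, and positive density turns this into linear decay, which the
  sublinear lower bounds forbid.\<close>

lemma many_low_predecessors:
  fixes s :: "nat \<Rightarrow> real"
  assumes R: "pos_upper_density R" and C: "C > 0"
    and s: "\<And>e. e > 0 \<Longrightarrow> \<exists>K. \<forall>n. s n \<ge> - e * real n - K"
  shows "\<exists>j\<in>R. card {i\<in>R. i < j \<and> s i \<le> s j + C} \<ge> M"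
proof (rule ccontr)
  assume "\<not> ?thesis"
  then have few: "card {i\<in>R. i < j \<and> s i \<le> s j + C} < M" if "j \<in> R" for j
    using that by force
  have inf: "infinite R"
    using R not_pos_upper_density_finite by blast
  then have M: "M > 0" using few by (metis finite.emptyI ex_in_conv gr_zeroI not_less_zero)
  define t where "t = enumerate R"
  have tR: "t j \<in> R" for j
    unfolding t_def using inf by (rule enumerate_in_set)
  have tmono: "strict_mono t"
    unfolding t_def using inf by (rule strict_mono_enumerate)
  have ex: "\<exists>i\<in>{l..<j}. s (t i) > s (t j) + C" if "l + M \<le> j" for l j
  proof (rule ccontr)
    assume "\<not> ?thesis"
    then have "t ` {l..<j} \<subseteq> {i\<in>R. i < t j \<and> s i \<le> s (t j) + C}"
      using tR tmono by (auto simp: strict_mono_less not_less)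
    then have "card (t ` {l..<j}) \<le> card {i\<in>R. i < t j \<and> s i \<le> s (t j) + C}"
      by (intro card_mono) auto
    moreover have "card (t ` {l..<j}) = j - l"
      using strict_mono_imp_inj_on[OF tmono] by (subst card_image) (auto intro: inj_on_subset)
    ultimately show False using few[OF tR[of j]] that by simp
  qed
  define top where "top = Max ((\<lambda>i. s (t i)) ` {..<M})"
  have base: "s (t j) \<le> top" for j
  proof (induction j rule: less_induct)
    case (less j)
    show ?case
    proof (cases "j < M")
      case True
      then show ?thesis unfolding top_def by (intro Max_ge) auto
    next
      case False
      then obtain i where "i < j" "s (t i) > s (t j) + C" using ex[of 0 j] by auto
      then show ?thesis using less[of i] C by simp
    qed
  qed
  have step: "s (t j) \<le> top - real k * C" if "k * M \<le> j" for k j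
    using that
  proof (induction k arbitrary: j)
    case 0
    then show ?case using base by simp
  next
    case (Suc k)
    then obtain i where i: "i \<in> {k*M..<j}" "s (t i) > s (t j) + C"
      using ex[of "k*M" j] by (auto simp: add.commute)
    then show ?case using Suc.IH[of i] by (auto simp: algebra_simps)
  qed
  obtain \<theta> where \<theta>: "\<theta> > 0" "\<exists>\<^sub>\<infinity>n. \<theta> * real n \<le> real (card (R \<inter> {..<n}))"
    using R unfolding pos_upper_density_def by blast
  \<comment> \<open>Half the decay rate: the at least \<open>\<theta> * n\<close> members below
    \<open>n\<close> cost about \<open>C * \<theta> * n / M\<close>, which is
    \<open>2 * e * n\<close>.\<close>
  define e where "e = C * \<theta> / (2 * M)"
  have e: "e > 0" using C \<theta> M by (simp add: e_def)
  obtain K where K: "\<And>n. s n \<ge> - e * real n - K" using s[OF e] by blast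
  obtain N where N: "real N > (\<bar>K\<bar> + \<bar>top\<bar> + 2 * C) / e" using reals_Archimedean2 by blast
  have "real N > 0" by (rule le_less_trans[OF _ N]) (use e C in auto)
  then have N0: "N > 0" by simp
  obtain n where n: "n \<ge> N" "\<theta> * real n \<le> real (card (R \<inter> {..<n}))"
    using \<theta>(2) unfolding INFM_nat_le by blast
  define m where "m = card (R \<inter> {..<n})"
  have "0 < \<theta> * real n" using n N0 \<theta>(1) by simp
  then have m0: "m > 0" using n(2) unfolding m_def by (metis of_nat_0_less_iff order_less_le_trans)
  have tm: "t (m - 1) < n"
  proof (rule ccontr)
    assume a: "\<not> t (m - 1) < n"
    have "R \<inter> {..<n} \<subseteq> t ` {..<m-1}"
    proof
      fix x assume x: "x \<in> R \<inter> {..<n}"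
      then obtain i where i: "t i = x" unfolding t_def using enumerate_Ex[OF inf, of x] by blast
      then have "t i < t (m-1)" using x a by auto
      then show "x \<in> t ` {..<m-1}" using i tmono by (auto simp: strict_mono_less)
    qed
    then have "m \<le> card (t ` {..<m-1})" unfolding m_def by (intro card_mono) auto
    also have "\<dots> \<le> m - 1" using card_image_le[of "{..<m-1}" t] by simp
    finally show False using m0 by simp
  qed
  define k where "k = (m - 1) div M"
  have "s (t (m-1)) \<le> top - real k * C" by (rule step) (simp add: k_def)
  moreover have "real k \<ge> real m / M - 2"
  proof -
    have "M * k + (m-1) mod M = m - 1" unfolding k_def by (rule mult_div_mod_eq)
    moreover have "(m-1) mod M < M" using M by simp
    ultimately have "m \<le> M * k + M" using m0 by linarith
    then have "m \<le> M * (k + 2)" by (simp add: algebra_simps)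
    then have "real m \<le> real M * (real k + 2)" by (metis of_nat_le_iff of_nat_mult of_nat_add of_nat_numeral)
    then show ?thesis using M by (simp add: field_simps)
  qed
  ultimately have "s (t (m-1)) \<le> top - (real m / M - 2) * C"
    using C by (smt (verit) mult_right_mono)
  moreover have "s (t (m-1)) \<ge> - e * real n - K"
  proof -
    have "e * real (t (m-1)) \<le> e * real n" using tm e by (intro mult_left_mono) auto
    then show ?thesis using K[of "t (m-1)"] by linarith
  qed
  moreover have "real m / M * C \<ge> 2 * e * real n"
    using n(2) M C unfolding m_def[symmetric] e_def by (simp add: field_simps)
  ultimately have "e * real n \<le> top + 2 * C + K" by (simp add: algebra_simps)
  moreover have "e * real n \<ge> e * real N" using e n(1) by simp
  moreover have "e * real N > \<bar>K\<bar> + \<bar>top\<bar> + 2 * C" using N e by (simp add: field_simps)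
  ultimately show False by simp
qed

text \<open>The sequence \<open>b\<close> can exceed its earlier maximum only at a record, and then
  by at most \<open>V\<close>, while \<open>b n \<ge> c * n - K\<close>; so there are about
  \<open>c * n / V\<close> records up to \<open>n\<close>. At a record \<open>m\<close> every final
  segment of the first \<open>m\<close> terms has average at least \<open>c\<close>, which is the
  form in which hyperbolic times are found.\<close>

lemma pliss_records:
  fixes v :: "nat \<Rightarrow> real"
  assumes V: "V > 0" "\<And>j. v j \<le> V" and c: "c > 0"
    and low: "\<And>n. (\<Sum>j<n. v j) \<ge> 2 * c * real n - K"
  shows "pos_upper_density {m. \<forall>i<m. (\<Sum>j<i. v j) - c * real i \<le> (\<Sum>j<m. v j) - c * real m}"
proof -
  define b where "b = (\<lambda>m. (\<Sum>j<m. v j) - c * real m)"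
  define R where "R = {m. \<forall>i<m. b i \<le> b m}"
  have bS: "b (Suc m) \<le> b m + V" for m
    using V(2)[of m] c by (simp add: b_def algebra_simps)
  have key: "b i \<le> V * real (card (R \<inter> {..<Suc n}))" if "i \<le> n" for i n
    using that
  proof (induction n arbitrary: i)
    case 0
    then show ?case using V by (simp add: b_def)
  next
    case (Suc n)
    have mono: "real (card (R \<inter> {..<Suc n})) \<le> real (card (R \<inter> {..<Suc (Suc n)}))"
      by (intro of_nat_mono card_mono) auto
    have old: "b i \<le> V * real (card (R \<inter> {..<Suc (Suc n)}))" if "i \<le> n" for i
      using Suc.IH[OF that] mono V by (smt (verit) mult_left_mono)
    have new: "b (Suc n) \<le> V * real (card (R \<inter> {..<Suc (Suc n)}))"
    proof (cases "Suc n \<in> R")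
      case False
      then obtain i where "i < Suc n" "b (Suc n) \<le> b i" unfolding R_def by force
      then show ?thesis using old[of i] by simp
    next
      case True
      then have "R \<inter> {..<Suc (Suc n)} = insert (Suc n) (R \<inter> {..<Suc n})"
        by (auto simp: lessThan_Suc)
      then have "card (R \<inter> {..<Suc (Suc n)}) = Suc (card (R \<inter> {..<Suc n}))"
        by simp
      then show ?thesis using bS[of n] Suc.IH[of n] by (simp add: algebra_simps)
    qed
    show ?case using Suc.prems old new by (cases "i = Suc n") auto
  qed
  obtain N where N: "real N > 2 * (\<bar>K\<bar> + c) / c" using reals_Archimedean2 by blast
  have "\<exists>n\<ge>m. c / (2 * V) * real n \<le> real (card (R \<inter> {..<n}))" for m
  proof -
    define n where "n = Suc (m + N)"
    have "b (m + N) \<ge> c * real (m + N) - K"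
      using low[of "m+N"] by (simp add: b_def algebra_simps)
    moreover have "b (m + N) \<le> V * real (card (R \<inter> {..<n}))"
      unfolding n_def by (rule key) simp
    moreover have "c * real (m + N) - K \<ge> c / 2 * real n"
    proof -
      have X: "c * real N > 2 * (\<bar>K\<bar> + c)" using N c by (simp add: field_simps)
      have "0 \<le> c * real m" using c by simp
      moreover have "c * real N / 2 \<ge> K + c" using X abs_ge_self[of K] by (simp add: field_simps)
      moreover have "K + c / 2 + (X + Y) / 2 \<le> X + Y" if "0 \<le> Y" "K + c \<le> X / 2" for X Y
        using that c by (simp add: field_simps)
      ultimately have "K + c / 2 + (c * real N + c * real m) / 2 \<le> c * real N + c * real m"
        by blast
      then show ?thesis unfolding n_def by (simp add: field_simps)
    qed
    ultimately have "c / 2 * real n \<le> V * real (card (R \<inter> {..<n}))" by linarith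
    then have "c / (2 * V) * real n \<le> real (card (R \<inter> {..<n}))"
      using V by (simp add: field_simps)
    then show ?thesis by (intro exI[of _ n]) (simp add: n_def)
  qed
  then have "\<exists>\<^sub>\<infinity>n. c / (2 * V) * real n \<le> real (card (R \<inter> {..<n}))"
    unfolding INFM_nat_le by blast
  moreover have "c / (2 * V) > 0" using c V by simp
  ultimately have "pos_upper_density R"
    unfolding pos_upper_density_def by blast
  then show ?thesis unfolding R_def b_def .
qed

section \<open>An ergodic theorem\<close>

definition birkhoff_sum :: "('a \<Rightarrow> 'a) \<Rightarrow> ('a \<Rightarrow> real) \<Rightarrow> nat \<Rightarrow> 'a \<Rightarrow> real" where
  "birkhoff_sum f u n x = (\<Sum>k<n. u ((f ^^ k) x))"

lemma birkhoff_sum_0 [simp]: "birkhoff_sum f u 0 x = 0"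
  by (simp add: birkhoff_sum_def)

lemma birkhoff_sum_Suc: "birkhoff_sum f u (Suc n) x = u x + birkhoff_sum f u n (f x)"
  unfolding birkhoff_sum_def sum.lessThan_Suc_shift by (simp add: funpow_swap1)

lemma birkhoff_sum_add:
  "birkhoff_sum f u (m + n) x = birkhoff_sum f u m x + birkhoff_sum f u n ((f ^^ m) x)"
proof (induction m arbitrary: x)
  case (Suc m)
  show ?case by (simp add: birkhoff_sum_Suc Suc funpow_swap1)
qed simp

lemma funpow_measurable:
  assumes "f \<in> measurable M M"
  shows "f ^^ n \<in> measurable M M"
proof (induction n)
  case 0
  then show ?case by (simp add: id_def)
next
  case (Suc n)
  then show ?case using assms by (auto intro: measurable_comp)
qed

lemma birkhoff_sum_measurable:
  assumes "f \<in> measurable M M" "u \<in> borel_measurable M"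
  shows "birkhoff_sum f u n \<in> borel_measurable M"
  unfolding birkhoff_sum_def
  by (intro borel_measurable_sum measurable_compose[OF funpow_measurable[OF assms(1)] assms(2)])

lemma integrable_invariant:
  fixes u :: "'a \<Rightarrow> real"
  assumes f: "f \<in> measurable M M" "distr M M f = M" and u: "integrable M u"
  shows "integrable M (\<lambda>x. u (f x))" "(\<integral>x. u (f x) \<partial>M) = (\<integral>x. u x \<partial>M)"
proof -
  have "integrable (distr M M f) u" using f u by simp
  then show "integrable M (\<lambda>x. u (f x))" using f by (subst (asm) integrable_distr_eq) (use u in auto)
  have "(\<integral>x. u x \<partial>distr M M f) = (\<integral>x. u (f x) \<partial>M)"
    using f u by (intro integral_distr) auto
  then show "(\<integral>x. u (f x) \<partial>M) = (\<integral>x. u x \<partial>M)" using f by simp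
qed

lemma integrable_birkhoff_sum:
  assumes f: "f \<in> measurable M M" "distr M M f = M" and u: "integrable M u"
  shows "integrable M (birkhoff_sum f u n)"
proof (induction n)
  case (Suc n)
  have "birkhoff_sum f u (Suc n) = (\<lambda>x. u x + birkhoff_sum f u n (f x))"
    by (auto simp: birkhoff_sum_Suc)
  then show ?case using u integrable_invariant(1)[OF f Suc] by simp
qed (simp add: fun_eq_iff cong: integrable_cong)

text \<open>Garsia's argument, with minima in place of maxima. Where the running minimum
  \<open>m n\<close> is negative it is attained by a sum with \<open>Suc l\<close> terms, so
  \<open>u x = m n x - birkhoff_sum f u l (f x) \<le> m n x - m n (f x)\<close>. The right side has
  integral 0 by invariance.\<close>

lemma maximal_ergodic:
  fixes u :: "'a \<Rightarrow> real"
  assumes f: "f \<in> measurable M M" "distr M M f = M" and u: "integrable M u"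
  shows "(\<integral>x. indicator {x\<in>space M. \<exists>n. birkhoff_sum f u n x < 0} x * u x \<partial>M) \<le> 0"
proof -
  have um [measurable]: "u \<in> borel_measurable M" using u by auto
  have Sm [measurable]: "birkhoff_sum f u n \<in> borel_measurable M" for n
    using birkhoff_sum_measurable[OF f(1) um] .
  \<comment> \<open>The minimum includes the empty sum, so \<open>m n\<close> is nonpositive
    everywhere and its strict negativity exhibits a sum with at least one term.\<close>
  define m where "m = rec_nat (\<lambda>x. 0) (\<lambda>n g x. min (g x) (birkhoff_sum f u (Suc n) x))"
  have m0: "m 0 x = 0" and mS: "m (Suc n) x = min (m n x) (birkhoff_sum f u (Suc n) x)" for n x
    by (simp_all add: m_def)
  have mle: "m n x \<le> birkhoff_sum f u k x" if "k \<le> n" for n k x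
    using that
  proof (induction n)
    case (Suc n)
    then show ?case by (cases "k = Suc n") (auto simp: mS min_le_iff_disj)
  qed (simp add: m0)
  have mex: "\<exists>k\<le>n. m n x = birkhoff_sum f u k x" for n x
  proof (induction n)
    case (Suc n)
    then obtain k where k: "k \<le> n" "m n x = birkhoff_sum f u k x" by blast
    show ?case
    proof (cases "m n x \<le> birkhoff_sum f u (Suc n) x")
      case True
      then show ?thesis using k by (auto simp: mS intro!: exI[of _ k])
    next
      case False
      then show ?thesis by (auto simp: mS intro!: exI[of _ "Suc n"])
    qed
  qed (simp add: m0)
  have mint: "integrable M (m n)" for n
  proof (induction n)
    case (Suc n)
    have "m (Suc n) = (\<lambda>x. min (m n x) (birkhoff_sum f u (Suc n) x))" by (auto simp: mS)
    then show ?case using Suc integrable_birkhoff_sum[OF f u] by simp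
  qed (simp add: m_def)
  have mm [measurable]: "m n \<in> borel_measurable M" for n using mint by auto
  define E where "E = (\<lambda>n. {x\<in>space M. m n x < 0})"
  have Em [measurable]: "E n \<in> sets M" for n unfolding E_def by measurable
  have En: "(\<integral>x. indicator (E n) x * u x \<partial>M) \<le> 0" for n
  proof -
    have ineq: "indicator (E n) x * u x \<le> m n x - m n (f x)" if x: "x \<in> space M" for x
    proof (cases "m n x < 0")
      case True
      obtain k where k: "k \<le> n" "m n x = birkhoff_sum f u k x" using mex by blast
      then obtain l where l: "k = Suc l" using True by (cases k) auto
      have "m n (f x) \<le> birkhoff_sum f u l (f x)" using k l by (intro mle) simp
      then show ?thesis using True k l x by (simp add: birkhoff_sum_Suc E_def)
    next
      case False
      have "m n y \<le> 0" for y using mle[of 0 n y] by simp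
      then show ?thesis using False x by (simp add: E_def) (meson order_trans not_less)
    qed
    have "(\<integral>x. indicator (E n) x * u x \<partial>M) \<le> (\<integral>x. m n x - m n (f x) \<partial>M)"
      using ineq u mint integrable_invariant(1)[OF f mint]
      by (intro integral_mono) (auto intro!: integrable_real_mult_indicator simp: mult.commute)
    also have "\<dots> = 0"
      using integrable_invariant[OF f mint] mint by simp
    finally show ?thesis .
  qed
  have UE: "{x\<in>space M. \<exists>n. birkhoff_sum f u n x < 0} = (\<Union>n. E n)"
  proof -
    have "(\<exists>n. birkhoff_sum f u n x < 0) \<longleftrightarrow> (\<exists>n. m n x < 0)" for x
      using mle[of _ _ x] mex[of _ x] by (metis order_refl order_le_less_trans)
    then show ?thesis unfolding E_def by auto
  qed
  have "(\<lambda>n. \<integral>x. indicator (E n) x * u x \<partial>M) \<longlonglongrightarrow> (\<integral>x. indicator (\<Union>n. E n) x * u x \<partial>M)"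
  proof (rule integral_dominated_convergence[where w = "\<lambda>x. \<bar>u x\<bar>"])
    have inc: "incseq E"
      unfolding incseq_Suc_iff E_def by (auto simp: mS)
    show "AE x in M. (\<lambda>n. indicator (E n) x * u x) \<longlonglongrightarrow> indicator (\<Union>n. E n) x * u x"
      by (intro AE_I2 tendsto_mult tendsto_const LIMSEQ_indicator_incseq inc)
  qed (use u in \<open>auto simp: indicator_def\<close>)
  then show ?thesis unfolding UE by (rule LIMSEQ_le_const2) (use En in auto)
qed

text \<open>The set where the sums are unbounded below is invariant, because passing from
  \<open>x\<close> to \<open>f x\<close> changes the sums by the fixed number \<open>u x\<close>. If
  it had measure 1, the maximal inequality would give a nonpositive integral.\<close>

lemma ergodic_birkhoff_bounded_below:
  fixes u :: "riemann_sphere \<Rightarrow> real"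
  assumes erg: "ergodic_prob f \<mu>" and u: "integrable \<mu> u" and pos: "(\<integral>x. u x \<partial>\<mu>) > 0"
  shows "AE x in \<mu>. \<exists>K. \<forall>n. birkhoff_sum f u n x \<ge> - K"
proof -
  have f: "f \<in> measurable \<mu> \<mu>" "distr \<mu> \<mu> f = \<mu>" and P: "prob_space \<mu>"
    using erg unfolding ergodic_prob_def invariant_prob_def by auto
  interpret prob_space \<mu> by fact
  have um [measurable]: "u \<in> borel_measurable \<mu>" using u by auto
  have Sm [measurable]: "birkhoff_sum f u n \<in> borel_measurable \<mu>" for n
    using birkhoff_sum_measurable[OF f(1) um] .
  define A where "A = {x\<in>space \<mu>. \<forall>K::nat. \<exists>n. birkhoff_sum f u n x < - real K}"
  have Am: "A \<in> sets \<mu>" unfolding A_def by measurable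
  have A_alt: "(\<forall>K::nat. \<exists>n. birkhoff_sum f u n x < - real K) \<longleftrightarrow> (\<forall>K. \<exists>n. birkhoff_sum f u n x < - K)" for x
    by (meson reals_Archimedean2 order_less_trans neg_less_iff_less)
  have inv: "f -` A \<inter> space \<mu> = A"
  proof -
    have "(\<forall>K. \<exists>n. birkhoff_sum f u n (f x) < - K) \<longleftrightarrow> (\<forall>K. \<exists>n. birkhoff_sum f u n x < - K)" (is "?l = ?r") for x
    proof
      assume l: ?l
      show ?r
      proof
        fix K
        obtain n where "birkhoff_sum f u n (f x) < - (K + u x)" using l by blast
        then show "\<exists>n. birkhoff_sum f u n x < - K"
          by (intro exI[of _ "Suc n"]) (simp add: birkhoff_sum_Suc)
      qed
    next
      assume r: ?r
      show ?l
      proof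
        fix K
        \<comment> \<open>The maximum with 0 excludes \<open>n = 0\<close>, whose sum is 0, so the
          first term can be split off.\<close>
        obtain n where n: "birkhoff_sum f u n x < - (max 0 (K - u x))" using r by blast
        then obtain l where "n = Suc l" by (cases n) auto
        then show "\<exists>n. birkhoff_sum f u n (f x) < - K"
          using n by (intro exI[of _ l]) (simp add: birkhoff_sum_Suc)
      qed
    qed
    then show ?thesis
      using measurable_space[OF f(1)] unfolding A_def A_alt by auto
  qed
  have "measure \<mu> A = 0 \<or> measure \<mu> A = 1"
    using erg Am inv unfolding ergodic_prob_def by blast
  moreover have "measure \<mu> A \<noteq> 1"
  proof
    assume "measure \<mu> A = 1"
    then have AE: "AE x in \<mu>. x \<in> A" using Am by (simp add: AE_in_set_eq_1)
    have "(\<integral>x. u x \<partial>\<mu>) = (\<integral>x. indicator {x\<in>space \<mu>. \<exists>n. birkhoff_sum f u n x < 0} x * u x \<partial>\<mu>)"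
    proof (rule integral_cong_AE)
      show "AE x in \<mu>. u x = indicator {x\<in>space \<mu>. \<exists>n. birkhoff_sum f u n x < 0} x * u x"
        using AE
      proof eventually_elim
        case (elim x)
        then have "\<exists>n. birkhoff_sum f u n x < - real 0" "x \<in> space \<mu>" unfolding A_def by blast+
        then show ?case by (auto simp: indicator_def)
      qed
    qed measurable
    then show False using maximal_ergodic[OF f u] pos by simp
  qed
  ultimately have "AE x in \<mu>. x \<notin> A"
    using Am by (simp add: AE_iff_measurable[OF Am] prob_eq_0)
  then show ?thesis
    using AE_space
  proof eventually_elim
    case (elim x)
    then show ?case unfolding A_def A_alt by (auto simp: not_less)
  qed
qed

lemma ergodic_birkhoff_lower:
  fixes u :: "riemann_sphere \<Rightarrow> real"
  assumes erg: "ergodic_prob f \<mu>" and u: "integrable \<mu> u" and a: "a < (\<integral>x. u x \<partial>\<mu>)"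
  shows "AE x in \<mu>. \<exists>K. \<forall>n. birkhoff_sum f u n x \<ge> a * real n - K"
proof -
  interpret prob_space \<mu> using erg unfolding ergodic_prob_def invariant_prob_def by auto
  have "AE x in \<mu>. \<exists>K. \<forall>n. birkhoff_sum f (\<lambda>x. u x - a) n x \<ge> - K"
    by (rule ergodic_birkhoff_bounded_below[OF erg]) (use u a in \<open>auto simp: prob_space\<close>)
  then show ?thesis
    by eventually_elim (auto simp: birkhoff_sum_def sum_subtractf algebra_simps intro!: exI)
qed

section \<open>Subadditive sequences and entropy\<close>

text \<open>Fekete's lemma. Convergence matters because \<open>entropy_wrt\<close> is a
  \<open>lim\<close>, from which nothing can be derived before the limit is known to exist.\<close>

lemma fekete_convergent:
  fixes a :: "nat \<Rightarrow> real"
  assumes nn: "\<And>n. a n \<ge> 0" and sub: "\<And>m n. a (m + n) \<le> a m + a n"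
  shows "convergent (\<lambda>n. a n / real n)"
proof -
  define L where "L = (INF n\<in>{1..}. a n / real n)"
  have bdd: "bdd_below ((\<lambda>n. a n / real n) ` {1..})"
    by (rule bdd_belowI[of _ 0]) (use nn in auto)
  have lower: "L \<le> a n / real n" if "n \<ge> 1" for n
    unfolding L_def using that by (intro cINF_lower bdd) auto
  have mult: "a (q * m + r) \<le> real q * a m + a r" for q m r
  proof (induction q)
    case (Suc q)
    have "a (Suc q * m + r) \<le> a m + a (q * m + r)"
      using sub[of m "q * m + r"] by (simp add: algebra_simps)
    then show ?case using Suc by (simp add: algebra_simps)
  qed simp
  have "(\<lambda>n. a n / real n) \<longlonglongrightarrow> L"
  proof (rule LIMSEQ_I)
    fix e :: real assume e: "e > 0"
    have "\<exists>m\<in>{1..}. a m / real m < L + e / 2"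
      using cINF_less_iff[OF _ bdd, of "L + e / 2"] e unfolding L_def[symmetric] by auto
    then obtain m where m: "m \<ge> 1" "a m / real m < L + e / 2" by auto
    define B where "B = (\<Sum>r<m. a r)"
    have B: "a r \<le> B" if "r < m" for r
      unfolding B_def using that nn by (intro member_le_sum) auto
    obtain n0 where n0: "real n0 > 2 * B / e" using reals_Archimedean2 by blast
    have "norm (a n / real n - L) < e" if n: "n \<ge> max 1 n0" for n
    proof -
      define q r where "q = n div m" and "r = n mod m"
      have qr: "n = q * m + r" "r < m" using m by (simp_all add: q_def r_def)
      have n1: "real n > 0" using n by simp
      have "a m \<le> (L + e/2) * real m" using m by (simp add: field_simps)
      then have "real q * a m \<le> real q * ((L + e / 2) * real m)" by (intro mult_left_mono) auto
      also have "\<dots> = (L + e/2) * real (q * m)" by simp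
      also have "\<dots> \<le> (L + e/2) * real n"
      proof (rule mult_left_mono)
        have "0 \<le> a m / real m" using nn by simp
        then show "0 \<le> L + e / 2" using m(2) by linarith
      qed (use qr in simp)
      finally have "real q * a m \<le> (L + e/2) * real n" .
      then have "a n \<le> (L + e/2) * real n + B"
        using mult[of q m r] B[OF qr(2)] qr(1) by simp
      moreover have "B < e / 2 * real n"
      proof -
        have "2 * B / e < real n" using n0 n by linarith
        then show ?thesis using e by (simp add: field_simps)
      qed
      ultimately have "a n < (L + e) * real n" by (simp add: algebra_simps)
      then have "a n / real n < L + e" using n1 by (simp add: field_simps)
      moreover have "L \<le> a n / real n" using n by (intro lower) simp
      ultimately show ?thesis by simp
    qed
    then show "\<exists>no. \<forall>n\<ge>no. norm (a n / real n - L) < e" by blast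
  qed
  then show ?thesis by (rule convergentI)
qed

text \<open>Nonnegativity of the mutual information of \<open>p\<close>: apply
  \<open>ln y \<le> y - 1\<close> to \<open>y = P a * Q b / p a b\<close>, multiply by
  \<open>p a b\<close> and sum, both total masses being 1. Terms with \<open>p a b = 0\<close>
  vanish on the right.\<close>

lemma joint_entropy_le:
  fixes p :: "'a \<Rightarrow> 'b \<Rightarrow> real"
  assumes fin: "finite A" "finite B" and nn: "\<And>a b. p a b \<ge> 0"
    and one: "(\<Sum>a\<in>A. \<Sum>b\<in>B. p a b) = 1"
    and P: "\<And>a. a \<in> A \<Longrightarrow> P a = (\<Sum>b\<in>B. p a b)" and Q: "\<And>b. b \<in> B \<Longrightarrow> Q b = (\<Sum>a\<in>A. p a b)"
  shows "(\<Sum>a\<in>A. P a * ln (P a)) + (\<Sum>b\<in>B. Q b * ln (Q b)) \<le> (\<Sum>a\<in>A. \<Sum>b\<in>B. p a b * ln (p a b))"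
proof -
  have PA: "(\<Sum>a\<in>A. P a) = 1" using one P by simp
  have QB: "(\<Sum>b\<in>B. Q b) = 1" using one Q by (simp add: sum.swap[of _ A B])
  have pP: "p a b \<le> P a" "p a b \<le> Q b" if "a \<in> A" "b \<in> B" for a b
    using that P Q nn fin by (auto intro!: member_le_sum)
  have ineq: "p a b - P a * Q b \<le> p a b * ln (p a b) - p a b * ln (P a) - p a b * ln (Q b)"
    if "a \<in> A" "b \<in> B" for a b
  proof (cases "p a b = 0")
    case True
    then show ?thesis using pP[OF that] by simp
  next
    case False
    then have pos: "p a b > 0" using nn[of a b] by simp
    then have pos': "P a > 0" "Q b > 0" using pP[OF that] by auto
    have "ln (P a * Q b / p a b) \<le> P a * Q b / p a b - 1"
      using pos pos' by (intro ln_le_minus_one) simp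
    then have "p a b * (ln (P a) + ln (Q b) - ln (p a b)) \<le> p a b * (P a * Q b / p a b - 1)"
      using pos pos' by (intro mult_left_mono) (simp_all add: ln_mult ln_div)
    also have "\<dots> = P a * Q b - p a b" using pos by (simp add: field_simps)
    finally show ?thesis by (simp add: algebra_simps)
  qed
  have "0 = (\<Sum>a\<in>A. \<Sum>b\<in>B. p a b - P a * Q b)"
    using one PA QB by (simp add: sum_subtractf flip: sum_distrib_left sum_distrib_right)
  also have "\<dots> \<le> (\<Sum>a\<in>A. \<Sum>b\<in>B. p a b * ln (p a b) - p a b * ln (P a) - p a b * ln (Q b))"
    by (intro sum_mono ineq)
  also have "\<dots> = (\<Sum>a\<in>A. \<Sum>b\<in>B. p a b * ln (p a b)) - (\<Sum>a\<in>A. \<Sum>b\<in>B. p a b * ln (P a))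
      - (\<Sum>b\<in>B. \<Sum>a\<in>A. p a b * ln (Q b))"
    by (simp add: sum_subtractf sum.swap[of "\<lambda>b a. p a b * ln (Q b)" A B])
  also have "(\<Sum>a\<in>A. \<Sum>b\<in>B. p a b * ln (P a)) = (\<Sum>a\<in>A. P a * ln (P a))"
    using P by (simp flip: sum_distrib_right)
  also have "(\<Sum>b\<in>B. \<Sum>a\<in>A. p a b * ln (Q b)) = (\<Sum>b\<in>B. Q b * ln (Q b))"
    using Q by (simp flip: sum_distrib_right)
  finally show ?thesis by simp
qed

lemma real_div_bounds:
  fixes n N :: nat
  assumes "N > 0"
  shows "real n / real N - 2 \<le> real (n div N - 1)" "real (n div N - 1) \<le> real n / real N"
proof -
  have "real (n div N) \<le> real n / real N" by (rule of_nat_div_le_of_nat)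
  moreover have "real n / real N - real (n div N) \<le> 1"
  proof -
    have "real (n mod N) / real N \<le> 1"
      using mod_less_divisor[OF assms, of n] by (intro divide_le_eq_1_pos[THEN iffD2]) simp_all
    moreover have "real n / real N = real (n div N) + real (n mod N) / real N"
    proof -
      have "real n = real N * real (n div N) + real (n mod N)"
        unfolding of_nat_mult[symmetric] of_nat_add[symmetric] mult_div_mod_eq ..
      then have "real n / real N = (real N * real (n div N) + real (n mod N)) / real N" by (rule arg_cong)
      then show ?thesis using assms by (simp add: add_divide_distrib)
    qed
    ultimately show ?thesis by linarith
  qed
  moreover have "real q - 1 \<le> real (q - 1)" "real (q - 1) \<le> real q" for q by (cases q; simp)+
  ultimately show "real n / real N - 2 \<le> real (n div N - 1)" "real (n div N - 1) \<le> real n / real N"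
    by linarith+
qed

text \<open>Of \<open>n\<close> steps seen from an unknown phase, \<open>n div N - 1\<close> full
  blocks of length \<open>N\<close> are certain; giving up one block does not change the
  rate.\<close>

lemma LIMSEQ_div_over:
  fixes N :: nat
  assumes "N > 0"
  shows "(\<lambda>n. real (n div N - 1) / real n) \<longlonglongrightarrow> 1 / real N"
proof (rule tendsto_sandwich)
  have *: "(real n / real N - 2) / real n = 1 / real N - 2 / real n" "real n / real N / real n = 1 / real N"
    if "n > 0" for n
    using that assms by (simp_all add: diff_divide_distrib)
  have "1 / real N - 2 / real n \<le> real (n div N - 1) / real n" if "n > 0" for n
    unfolding *(1)[OF that, symmetric] by (rule divide_right_mono[OF real_div_bounds(1)[OF assms]]) simp
  then show "\<forall>\<^sub>F n in sequentially. 1 / real N - 2 / real n \<le> real (n div N - 1) / real n"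
    by (rule eventually_mono[OF eventually_gt_at_top[of "0::nat"]])
  have "real (n div N - 1) / real n \<le> 1 / real N" if "n > 0" for n
    unfolding *(2)[OF that, symmetric] by (rule divide_right_mono[OF real_div_bounds(2)[OF assms]]) simp
  then show "\<forall>\<^sub>F n in sequentially. real (n div N - 1) / real n \<le> 1 / real N"
    by (rule eventually_mono[OF eventually_gt_at_top[of "0::nat"]])
  have "(\<lambda>n. 1 / real N - 2 / real n) \<longlonglongrightarrow> 1 / real N - 0"
    by (intro tendsto_intros lim_const_over_n)
  then show "(\<lambda>n. 1 / real N - 2 / real n) \<longlonglongrightarrow> 1 / real N"
    by simp
qed simp

section \<open>Entropy of a finite partition expressed by itineraries\<close>

definition itinerary_set :: "'a measure \<Rightarrow> ('a \<Rightarrow> 'a) \<Rightarrow> 'a set list \<Rightarrow> 'a set" where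
  "itinerary_set M f xs = {x \<in> space M. \<forall>i<length xs. (f ^^ i) x \<in> xs ! i}"

definition words :: "'i set \<Rightarrow> nat \<Rightarrow> 'i list set" where
  "words I n = {xs. set xs \<subseteq> I \<and> length xs = n}"

lemma finite_words: "finite I \<Longrightarrow> finite (words I n)"
  unfolding words_def by (rule finite_lists_length_eq)

lemma card_words: "finite I \<Longrightarrow> card (words I n) = card I ^ n"
  unfolding words_def by (rule card_lists_length_eq)

lemma words_append:
  "words I (m + n) = (\<lambda>(xs, ys). xs @ ys) ` (words I m \<times> words I n)"
proof
  show "words I (m + n) \<subseteq> (\<lambda>(xs, ys). xs @ ys) ` (words I m \<times> words I n)"
  proof
    fix zs assume "zs \<in> words I (m + n)"
    then show "zs \<in> (\<lambda>(xs, ys). xs @ ys) ` (words I m \<times> words I n)"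
      by (intro image_eqI[of _ _ "(take m zs, drop m zs)"])
         (auto simp: words_def dest: in_set_takeD in_set_dropD)
  qed
qed (auto simp: words_def)

lemma inj_words_append: "inj_on (\<lambda>(xs, ys). xs @ ys) (words I m \<times> words I n)"
  by (auto simp: inj_on_def words_def)

context
  fixes M :: "'a measure" and f :: "'a \<Rightarrow> 'a" and \<xi> :: "'a set set"
  assumes prob: "prob_space M" and meas: "f \<in> measurable M M" and inv: "distr M M f = M"
    and part: "finite_measurable_partition M \<xi>"
begin

interpretation prob_space M by (rule prob)

lemma part_facts: "finite \<xi>" "\<And>A. A \<in> \<xi> \<Longrightarrow> A \<in> sets M" "\<Union>\<xi> = space M" "disjoint \<xi>"
  using part unfolding finite_measurable_partition_def partition_on_def by auto

lemma itinerary_set_measurable: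
  assumes "set xs \<subseteq> \<xi>"
  shows "itinerary_set M f xs \<in> sets M"
proof -
  have "{x \<in> space M. (f ^^ i) x \<in> xs ! i} \<in> sets M" if "i < length xs" for i
  proof -
    have "xs ! i \<in> sets M" using that assms part_facts(2) nth_mem by blast
    moreover have "{x \<in> space M. (f ^^ i) x \<in> xs ! i} = (f ^^ i) -` (xs ! i) \<inter> space M" by auto
    ultimately show ?thesis using measurable_sets[OF funpow_measurable[OF meas]] by metis
  qed
  moreover have "itinerary_set M f xs = (\<Inter>i\<in>{..<length xs}. {x \<in> space M. (f ^^ i) x \<in> xs ! i}) \<inter> space M"
    unfolding itinerary_set_def by auto
  ultimately show ?thesis
    by (cases "xs = []") (auto intro!: sets.Int sets.finite_INT)
qed

lemma funpow_space: "x \<in> space M \<Longrightarrow> (f ^^ i) x \<in> space M"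
  using measurable_space[OF funpow_measurable[OF meas]] .

lemma ex_itinerary:
  assumes "x \<in> space M"
  shows "\<exists>xs\<in>words \<xi> n. x \<in> itinerary_set M f xs"
proof -
  have "\<exists>A\<in>\<xi>. (f ^^ i) x \<in> A" for i
    using funpow_space[OF assms, of i] part_facts(3) by blast
  then obtain a where a: "\<And>i. a i \<in> \<xi>" "\<And>i. (f ^^ i) x \<in> a i" by metis
  show ?thesis
    by (intro bexI[of _ "map a [0..<n]"]) (use a assms in \<open>auto simp: itinerary_set_def words_def\<close>)
qed

lemma itinerary_set_disjoint:
  assumes "xs \<in> words \<xi> n" "ys \<in> words \<xi> n" "x \<in> itinerary_set M f xs" "x \<in> itinerary_set M f ys"
  shows "xs = ys"
proof (rule nth_equalityI)
  show "length xs = length ys" using assms by (simp add: words_def)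
  fix i assume i: "i < length xs"
  then have "xs ! i \<in> \<xi>" "ys ! i \<in> \<xi>" "(f ^^ i) x \<in> xs ! i" "(f ^^ i) x \<in> ys ! i"
    using assms by (auto simp: words_def itinerary_set_def subset_eq)
  then show "xs ! i = ys ! i" using part_facts(4) unfolding disjoint_def by blast
qed

lemma itinerary_set_UN: "(\<Union>xs\<in>words \<xi> n. itinerary_set M f xs) = space M"
  using ex_itinerary by (auto simp: itinerary_set_def)

lemma disjoint_family_itinerary: "disjoint_family_on (itinerary_set M f) (words \<xi> n)"
  unfolding disjoint_family_on_def using itinerary_set_disjoint by blast

lemma sum_measure_itinerary:
  assumes "B \<in> sets M"
  shows "(\<Sum>xs\<in>words \<xi> n. measure M (B \<inter> itinerary_set M f xs)) = measure M B"
proof -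
  have "measure M (\<Union>xs\<in>words \<xi> n. B \<inter> itinerary_set M f xs) = (\<Sum>xs\<in>words \<xi> n. measure M (B \<inter> itinerary_set M f xs))"
  proof (rule finite_measure_finite_Union)
    show "finite (words \<xi> n)" by (rule finite_words[OF part_facts(1)])
    show "(\<lambda>xs. B \<inter> itinerary_set M f xs) ` words \<xi> n \<subseteq> events"
      using assms by (auto intro!: itinerary_set_measurable sets.Int simp: words_def)
    show "disjoint_family_on (\<lambda>xs. B \<inter> itinerary_set M f xs) (words \<xi> n)"
      using disjoint_family_itinerary[of n] unfolding disjoint_family_on_def by blast
  qed
  moreover have "(\<Union>xs\<in>words \<xi> n. B \<inter> itinerary_set M f xs) = B"
    using itinerary_set_UN[of n] sets.sets_into_space[OF assms] by blast
  ultimately show ?thesis by simp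
qed

lemma sum_measure_itinerary_space: "(\<Sum>xs\<in>words \<xi> n. measure M (itinerary_set M f xs)) = 1"
proof -
  have *: "space M \<inter> itinerary_set M f xs = itinerary_set M f xs" for xs
    by (rule Int_absorb1) (simp add: itinerary_set_def Collect_restrict)
  show ?thesis using sum_measure_itinerary[OF sets.top, of n] unfolding * prob_space .
qed

lemma iterated_join_eq: "iterated_join M f \<xi> n = itinerary_set M f ` words \<xi> n - {{}}"
proof -
  define S where "S a = {x \<in> space M. \<forall>i<n. (f ^^ i) x \<in> a i}" for a :: "nat \<Rightarrow> 'a set"
  have S_map: "itinerary_set M f (map a [0..<n]) = S a" for a
    by (simp add: itinerary_set_def S_def)
  have S_nth: "itinerary_set M f xs = S (\<lambda>i. xs ! i)" if "length xs = n" for xs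
    using that by (simp add: itinerary_set_def S_def)
  have "{S a | a. \<forall>i<n. a i \<in> \<xi>} \<subseteq> itinerary_set M f ` words \<xi> n"
  proof
    fix A assume "A \<in> {S a | a. \<forall>i<n. a i \<in> \<xi>}"
    then obtain a where a: "\<forall>i<n. a i \<in> \<xi>" "A = S a" by blast
    then have "map a [0..<n] \<in> words \<xi> n" by (auto simp: words_def)
    then show "A \<in> itinerary_set M f ` words \<xi> n"
      unfolding a(2) S_map[symmetric] by (rule imageI)
  qed
  moreover have "itinerary_set M f ` words \<xi> n \<subseteq> {S a | a. \<forall>i<n. a i \<in> \<xi>}"
  proof (rule image_subsetI)
    fix xs assume xs: "xs \<in> words \<xi> n"
    then have "\<forall>i<n. xs ! i \<in> \<xi>" "length xs = n" by (auto simp: words_def)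
    then show "itinerary_set M f xs \<in> {S a | a. \<forall>i<n. a i \<in> \<xi>}"
      using S_nth by blast
  qed
  ultimately have "{S a | a. \<forall>i<n. a i \<in> \<xi>} = itinerary_set M f ` words \<xi> n" by (rule subset_antisym)
  then show ?thesis unfolding iterated_join_def S_def by simp
qed

text \<open>Sums over words replace sums over atoms. Different words can name the same set only if
  it is empty, and an empty atom contributes \<open>0 * ln 0 = 0\<close>, so nothing is counted
  twice.\<close>

lemma partition_entropy_iterated_join:
  "partition_entropy M (iterated_join M f \<xi> n) =
     - (\<Sum>xs\<in>words \<xi> n. measure M (itinerary_set M f xs) * ln (measure M (itinerary_set M f xs)))"
proof -
  let ?\<eta> = "\<lambda>A. measure M A * ln (measure M A)"
  have fin: "finite (words \<xi> n)" using part_facts(1) by (rule finite_words)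
  have "(\<Sum>A\<in>iterated_join M f \<xi> n. ?\<eta> A) = (\<Sum>A\<in>itinerary_set M f ` words \<xi> n. ?\<eta> A)"
    unfolding iterated_join_eq using fin by (intro sum.mono_neutral_left) auto
  also have "\<dots> = sum (?\<eta> \<circ> itinerary_set M f) (words \<xi> n)"
  proof (rule sum.reindex_nontrivial[OF fin])
    fix xs ys assume a: "xs \<in> words \<xi> n" "ys \<in> words \<xi> n" "xs \<noteq> ys" "itinerary_set M f xs = itinerary_set M f ys"
    then have "itinerary_set M f xs = {}" using itinerary_set_disjoint[OF a(1,2)] by blast
    then show "?\<eta> (itinerary_set M f xs) = 0" by simp
  qed
  finally show ?thesis unfolding partition_entropy_def by simp
qed

lemma itinerary_set_append:
  assumes "set ys \<subseteq> \<xi>"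
  shows "itinerary_set M f (xs @ ys) =
    itinerary_set M f xs \<inter> ((f ^^ length xs) -` itinerary_set M f ys \<inter> space M)"
proof -
  have "(\<forall>i<length (xs @ ys). (f ^^ i) x \<in> (xs @ ys) ! i) \<longleftrightarrow>
     (\<forall>i<length xs. (f ^^ i) x \<in> xs ! i) \<and> (\<forall>i<length ys. (f ^^ i) ((f ^^ length xs) x) \<in> ys ! i)" for x
  proof -
    have "(\<forall>i<m + n. P i) \<longleftrightarrow> (\<forall>i<m. P i) \<and> (\<forall>i<n. P (i + m))" for P and m n :: nat
    proof (intro iffI conjI allI impI)
      fix i assume "(\<forall>i<m. P i) \<and> (\<forall>i<n. P (i + m))" "i < m + n"
      then show "P i" using le_Suc_ex[of m i] by (cases "i < m") (auto simp: add.commute)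
    qed auto
    then show ?thesis by (simp add: nth_append funpow_add)
  qed
  then show ?thesis unfolding itinerary_set_def using funpow_space by auto
qed

lemma measure_funpow_vimage:
  assumes "A \<in> sets M"
  shows "measure M ((f ^^ n) -` A \<inter> space M) = measure M A"
proof (induction n)
  case 0
  then show ?case using sets.sets_into_space[OF assms] by (simp add: Int_absorb2)
next
  case (Suc n)
  let ?B = "(f ^^ n) -` A \<inter> space M"
  have B: "?B \<in> sets M" using measurable_sets[OF funpow_measurable[OF meas] assms] .
  have "(f ^^ Suc n) -` A \<inter> space M = f -` ?B \<inter> space M"
    using measurable_space[OF meas] by (auto simp: funpow_swap1)
  then have "measure M ((f ^^ Suc n) -` A \<inter> space M) = measure M (f -` ?B \<inter> space M)"
    by (rule arg_cong)
  also have "\<dots> = measure (distr M M f) ?B"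
    by (rule measure_distr[OF meas B, symmetric])
  also have "\<dots> = measure M ?B" by (simp only: inv)
  also note Suc
  finally show ?case .
qed

text \<open>Concatenated words carry a joint distribution. Its first marginal is the distribution of
  prefixes because the suffix sets partition the space, and its second is the distribution of
  suffixes because the measure is invariant under \<open>f ^^ m\<close>.\<close>

lemma itinerary_entropy_subadd:
  "partition_entropy M (iterated_join M f \<xi> (m + n)) \<le>
    partition_entropy M (iterated_join M f \<xi> m) + partition_entropy M (iterated_join M f \<xi> n)"
proof -
  define p where "p = (\<lambda>xs ys. measure M (itinerary_set M f (xs @ ys)))"
  have "(\<Sum>zs\<in>words \<xi> (m+n). measure M (itinerary_set M f zs) * ln (measure M (itinerary_set M f zs))) =
    (\<Sum>xs\<in>words \<xi> m. \<Sum>ys\<in>words \<xi> n. p xs ys * ln (p xs ys))"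
    unfolding words_append
    by (subst sum.reindex[OF inj_words_append]) (simp add: p_def sum.cartesian_product case_prod_unfold o_def)
  also have "\<dots> \<ge> (\<Sum>xs\<in>words \<xi> m. measure M (itinerary_set M f xs) * ln (measure M (itinerary_set M f xs))) +
    (\<Sum>xs\<in>words \<xi> n. measure M (itinerary_set M f xs) * ln (measure M (itinerary_set M f xs)))"
  proof (rule joint_entropy_le)
    show P: "measure M (itinerary_set M f xs) = (\<Sum>ys\<in>words \<xi> n. p xs ys)" if xs: "xs \<in> words \<xi> m" for xs
    proof -
      have "measure M (itinerary_set M f xs) =
        measure M (\<Union>ys\<in>words \<xi> n. itinerary_set M f (xs @ ys))"
      proof -
        have "itinerary_set M f xs = (\<Union>ys\<in>words \<xi> n. itinerary_set M f (xs @ ys))"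
        proof
          show "itinerary_set M f xs \<subseteq> (\<Union>ys\<in>words \<xi> n. itinerary_set M f (xs @ ys))"
          proof
            fix x assume x: "x \<in> itinerary_set M f xs"
            then have "(f ^^ length xs) x \<in> space M" "x \<in> space M"
              using funpow_space by (auto simp: itinerary_set_def)
            then obtain ys where "ys \<in> words \<xi> n" "(f ^^ length xs) x \<in> itinerary_set M f ys"
              using ex_itinerary by blast
            then show "x \<in> (\<Union>ys\<in>words \<xi> n. itinerary_set M f (xs @ ys))"
              using x \<open>x \<in> space M\<close> by (auto simp: itinerary_set_append words_def)
          qed
        qed (auto simp: itinerary_set_append words_def)
        then show ?thesis by simp
      qed
      also have "\<dots> = (\<Sum>ys\<in>words \<xi> n. p xs ys)"
        unfolding p_def
      proof (rule finite_measure_finite_Union)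
        show "disjoint_family_on (\<lambda>ys. itinerary_set M f (xs @ ys)) (words \<xi> n)"
          unfolding disjoint_family_on_def
        proof (intro ballI impI)
          fix ys zs assume "ys \<in> words \<xi> n" "zs \<in> words \<xi> n" "ys \<noteq> zs"
          then show "itinerary_set M f (xs @ ys) \<inter> itinerary_set M f (xs @ zs) = {}"
            using itinerary_set_disjoint[of "xs @ ys" "m + n" "xs @ zs"] xs by (auto simp: words_def)
        qed
        show "finite (words \<xi> n)" by (rule finite_words[OF part_facts(1)])
      qed (use xs in \<open>auto intro!: itinerary_set_measurable simp: words_def\<close>)
      finally show ?thesis .
    qed
    show "measure M (itinerary_set M f ys) = (\<Sum>xs\<in>words \<xi> m. p xs ys)" if ys: "ys \<in> words \<xi> n" for ys
    proof -
      have *: "set ys \<subseteq> \<xi>" using ys by (simp add: words_def)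
      have "(\<Sum>xs\<in>words \<xi> m. p xs ys) =
        (\<Sum>xs\<in>words \<xi> m. measure M (((f ^^ m) -` itinerary_set M f ys \<inter> space M) \<inter> itinerary_set M f xs))"
        unfolding p_def by (intro sum.cong refl) (auto simp: itinerary_set_append[OF *] words_def Int_commute)
      also have "\<dots> = measure M ((f ^^ m) -` itinerary_set M f ys \<inter> space M)"
        by (intro sum_measure_itinerary measurable_sets[OF funpow_measurable[OF meas]] itinerary_set_measurable *)
      also have "\<dots> = measure M (itinerary_set M f ys)"
        by (intro measure_funpow_vimage itinerary_set_measurable *)
      finally show ?thesis by simp
    qed
    have "(\<Sum>xs\<in>words \<xi> m. measure M (itinerary_set M f xs)) = 1"
      by (rule sum_measure_itinerary_space)
    then show "(\<Sum>xs\<in>words \<xi> m. \<Sum>ys\<in>words \<xi> n. p xs ys) = 1" using P by simp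
  qed (auto simp: p_def finite_words part_facts(1))
  finally show ?thesis unfolding partition_entropy_iterated_join by simp
qed

lemma partition_entropy_nonneg: "partition_entropy M (iterated_join M f \<xi> n) \<ge> 0"
  unfolding partition_entropy_def
proof -
  have "measure M A * ln (measure M A) \<le> 0" for A
  proof (cases "measure M A = 0")
    case False
    then have "0 < measure M A" using measure_nonneg[of M A] by linarith
    then show ?thesis
      using prob_le_1[of A] by (intro mult_nonneg_nonpos) (simp_all add: ln_le_zero_iff)
  qed simp
  then show "0 \<le> - (\<Sum>A\<in>iterated_join M f \<xi> n. measure M A * ln (measure M A))"
    by (simp add: sum_nonpos)
qed

lemma entropy_wrt_LIMSEQ:
  "(\<lambda>n. partition_entropy M (iterated_join M f \<xi> n) / real n) \<longlonglongrightarrow> entropy_wrt M f \<xi>"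
  unfolding entropy_wrt_def
  by (intro iffD1[OF convergent_LIMSEQ_iff] fekete_convergent partition_entropy_nonneg itinerary_entropy_subadd)

text \<open>If no itinerary set is larger than \<open>p\<close> to the power \<open>- k n\<close>,
  the average of minus the logarithm of its measure is at least \<open>k n * ln p\<close>. No
  generating property of the partition enters.\<close>

lemma entropy_wrt_ge:
  assumes p: "p > 0" and k: "(\<lambda>n. real (k n) / real n) \<longlonglongrightarrow> c"
    and small: "\<And>n xs. xs \<in> words \<xi> n \<Longrightarrow> measure M (itinerary_set M f xs) \<le> (1 / p) ^ k n"
  shows "entropy_wrt M f \<xi> \<ge> c * ln p"
proof -
  have low: "partition_entropy M (iterated_join M f \<xi> n) \<ge> real (k n) * ln p" for n
  proof -
    have "real (k n) * ln p = (\<Sum>xs\<in>words \<xi> n. measure M (itinerary_set M f xs) * (real (k n) * ln p))"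
      unfolding sum_distrib_right[symmetric] sum_measure_itinerary_space by simp
    also have "\<dots> \<le> (\<Sum>xs\<in>words \<xi> n. - (measure M (itinerary_set M f xs) * ln (measure M (itinerary_set M f xs))))"
    proof (rule sum_mono)
      fix xs assume xs: "xs \<in> words \<xi> n"
      define q where "q = measure M (itinerary_set M f xs)"
      have "q * (real (k n) * ln p) \<le> - (q * ln q)"
      proof (cases "q = 0")
        case False
        moreover have "q \<ge> 0" unfolding q_def by (rule measure_nonneg)
        ultimately have pos: "q > 0" by linarith
        have "ln q \<le> ln ((1 / p) ^ k n)"
          using pos small[OF xs] p unfolding q_def[symmetric] by (intro ln_mono) auto
        also have "\<dots> = - (real (k n) * ln p)"
          using p by (simp add: ln_realpow ln_div)
        finally have "real (k n) * ln p \<le> - ln q" by simp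
        then have "q * (real (k n) * ln p) \<le> q * (- ln q)"
          using pos by (intro mult_left_mono) auto
        then show ?thesis by simp
      qed simp
      then show "measure M (itinerary_set M f xs) * (real (k n) * ln p) \<le>
        - (measure M (itinerary_set M f xs) * ln (measure M (itinerary_set M f xs)))"
        unfolding q_def .
    qed
    finally show ?thesis unfolding partition_entropy_iterated_join by (simp add: sum_negf)
  qed
  show ?thesis
  proof (rule LIMSEQ_le[OF tendsto_mult_right[OF k] entropy_wrt_LIMSEQ])
    show "\<exists>Na. \<forall>n\<ge>Na. real (k n) / real n * ln p \<le> partition_entropy M (iterated_join M f \<xi> n) / real n"
    proof (intro exI allI impI)
      fix n
      have "real (k n) * ln p / real n \<le> partition_entropy M (iterated_join M f \<xi> n) / real n"
        by (rule divide_right_mono[OF low]) simp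
      then show "real (k n) / real n * ln p \<le> partition_entropy M (iterated_join M f \<xi> n) / real n"
        by (simp only: times_divide_eq_left)
    qed
  qed
qed

end

section \<open>Homogeneous coordinates and rotation charts on the sphere\<close>

text \<open>The point with homogeneous coordinates [a : b]. In these coordinates rotations and
  rational maps are given by polynomials, and infinity is treated like every other point.\<close>

definition cp :: "complex \<Rightarrow> complex \<Rightarrow> riemann_sphere" where
  "cp a b = (if b = 0 then Infty else Point (a / b))"

lemma cp_scale: "k \<noteq> 0 \<Longrightarrow> cp (k * a) (k * b) = cp a b"
  by (simp add: cp_def)

lemma cp_1 [simp]: "cp a 1 = Point a"
  by (simp add: cp_def)

lemma cp_0 [simp]: "cp a 0 = Infty"
  by (simp add: cp_def)

lemma cp_cases:
  obtains a b where "s = cp a b" "a \<noteq> 0 \<or> b \<noteq> 0"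
  by (cases s) (metis cp_1 zero_neq_one, metis cp_0 zero_neq_one)

text \<open>The determinant form of the chordal distance. Numerator and denominator are homogeneous
  of the same degree in each pair of coordinates, so the formula holds uniformly, including at
  infinity.\<close>

lemma inner_cp:
  assumes "a \<noteq> 0 \<or> b \<noteq> 0" "c \<noteq> 0 \<or> e \<noteq> 0"
  shows "stereo (cp a b) \<bullet> stereo (cp c e) =
    1 - 2 * (cmod (a * e - b * c))\<^sup>2 / (((cmod a)\<^sup>2 + (cmod b)\<^sup>2) * ((cmod c)\<^sup>2 + (cmod e)\<^sup>2))"
proof -
  have PP: "1 - 2 * (cmod (a / b - c / e))\<^sup>2 / ((1 + (cmod (a / b))\<^sup>2) * (1 + (cmod (c / e))\<^sup>2)) =
    1 - 2 * (cmod (a * e - b * c))\<^sup>2 / (((cmod a)\<^sup>2 + (cmod b)\<^sup>2) * ((cmod c)\<^sup>2 + (cmod e)\<^sup>2))"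
    if "b \<noteq> 0" "e \<noteq> 0" for a b c e
  proof -
    have 1: "a / b - c / e = (a * e - b * c) / (b * e)" using that by (simp add: field_simps)
    have 2: "1 + (cmod (x / y))\<^sup>2 = ((cmod x)\<^sup>2 + (cmod y)\<^sup>2) / (cmod y)\<^sup>2" if "y \<noteq> 0" for x y
      using that by (simp add: norm_divide power_divide field_simps)
    show ?thesis unfolding 1 2[OF that(1)] 2[OF that(2)]
      using that by (simp add: norm_divide norm_mult power_divide power_mult_distrib)
  qed
  have IP: "stereo Infty \<bullet> stereo (Point (c / e)) = 1 - 2 * (cmod e)\<^sup>2 / ((cmod c)\<^sup>2 + (cmod e)\<^sup>2)"
    if "e \<noteq> 0" for c e
  proof -
    have nz: "(cmod c)\<^sup>2 + (cmod e)\<^sup>2 \<noteq> 0" "(cmod e)\<^sup>2 \<noteq> 0"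
      using that by (simp_all add: sum_power2_eq_zero_iff)
    have "(cmod (c / e))\<^sup>2 + 1 = ((cmod c)\<^sup>2 + (cmod e)\<^sup>2) / (cmod e)\<^sup>2"
      "(cmod (c / e))\<^sup>2 - 1 = ((cmod c)\<^sup>2 - (cmod e)\<^sup>2) / (cmod e)\<^sup>2"
      using that by (simp_all add: norm_divide power_divide diff_divide_distrib add_divide_distrib)
    then have "((cmod (c / e))\<^sup>2 - 1) / ((cmod (c / e))\<^sup>2 + 1) =
      ((cmod c)\<^sup>2 - (cmod e)\<^sup>2) / ((cmod c)\<^sup>2 + (cmod e)\<^sup>2)"
      using nz by simp
    also have "\<dots> = 1 - 2 * (cmod e)\<^sup>2 / ((cmod c)\<^sup>2 + (cmod e)\<^sup>2)"
      using nz by (simp add: field_simps)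
    finally show ?thesis by (simp add: stereo.simps)
  qed
  consider "b \<noteq> 0" "e \<noteq> 0" | "b = 0" "e \<noteq> 0" | "b \<noteq> 0" "e = 0" | "b = 0" "e = 0" by blast
  then show ?thesis
  proof cases
    case 1
    then show ?thesis using PP[of b e a c] by (simp add: cp_def inner_stereo_Point)
  next
    case 2
    then show ?thesis using assms IP[of e c] by (simp add: cp_def norm_mult power_mult_distrib)
  next
    case 3
    then show ?thesis using assms IP[of b a]
      by (simp add: cp_def norm_mult power_mult_distrib inner_commute norm_minus_commute mult.commute)
  next
    case 4
    then show ?thesis by (simp add: cp_def)
  qed
qed

text \<open>The action of the matrix with rows \<open>(\<alpha>, \<beta>)\<close> and
  \<open>(- cnj \<beta>, cnj \<alpha>)\<close>, a real multiple of a unitary one. No normalisation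
  is imposed, since scaling does not move points of the sphere.\<close>

definition rotation :: "complex \<Rightarrow> complex \<Rightarrow> riemann_sphere \<Rightarrow> riemann_sphere" where
  "rotation \<alpha> \<beta> s = (case s of Point w \<Rightarrow> cp (\<alpha> * w + \<beta>) (cnj \<alpha> - cnj \<beta> * w) | Infty \<Rightarrow> cp \<alpha> (- cnj \<beta>))"

lemma rotation_nz:
  assumes "a \<noteq> 0 \<or> b \<noteq> 0" "\<alpha> \<noteq> 0 \<or> \<beta> \<noteq> 0"
  shows "\<alpha> * a + \<beta> * b \<noteq> 0 \<or> cnj \<alpha> * b - cnj \<beta> * a \<noteq> 0"
proof (rule ccontr)
  assume "\<not> ?thesis"
  then have 1: "\<alpha> * a + \<beta> * b = 0" and 2: "cnj \<alpha> * b - cnj \<beta> * a = 0" by auto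
  have "(\<alpha> * cnj \<alpha> + \<beta> * cnj \<beta>) * a = cnj \<alpha> * (\<alpha> * a + \<beta> * b) - \<beta> * (cnj \<alpha> * b - cnj \<beta> * a)"
    "(\<alpha> * cnj \<alpha> + \<beta> * cnj \<beta>) * b = cnj \<beta> * (\<alpha> * a + \<beta> * b) + \<alpha> * (cnj \<alpha> * b - cnj \<beta> * a)"
    by (simp_all add: algebra_simps)
  then have "\<alpha> * cnj \<alpha> + \<beta> * cnj \<beta> = 0" using 1 2 assms(1) by auto
  then have "complex_of_real ((cmod \<alpha>)\<^sup>2 + (cmod \<beta>)\<^sup>2) = 0"
    by (simp only: complex_norm_square of_real_add)
  then have "(cmod \<alpha>)\<^sup>2 + (cmod \<beta>)\<^sup>2 = 0" by (simp only: of_real_eq_0_iff)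
  then show False using assms(2) by (simp add: sum_power2_eq_zero_iff)
qed

lemma rotation_cp:
  assumes "a \<noteq> 0 \<or> b \<noteq> 0"
  shows "rotation \<alpha> \<beta> (cp a b) = cp (\<alpha> * a + \<beta> * b) (cnj \<alpha> * b - cnj \<beta> * a)"
proof (cases "b = 0")
  case True
  then show ?thesis using assms cp_scale[of a \<alpha> "- cnj \<beta>"] by (simp add: rotation_def mult.commute)
next
  case False
  have "cp (\<alpha> * a + \<beta> * b) (cnj \<alpha> * b - cnj \<beta> * a) = cp (b * (\<alpha> * (a / b) + \<beta>)) (b * (cnj \<alpha> - cnj \<beta> * (a / b)))"
    using False by (intro arg_cong2[of _ _ _ _ cp]) (simp_all add: algebra_simps)
  also have "\<dots> = cp (\<alpha> * (a / b) + \<beta>) (cnj \<alpha> - cnj \<beta> * (a / b))"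
    using False by (rule cp_scale)
  finally show ?thesis using False by (simp add: rotation_def cp_def[of a b])
qed

lemma rotation_inverse:
  assumes "\<alpha> \<noteq> 0 \<or> \<beta> \<noteq> 0"
  shows "rotation (cnj \<alpha>) (- \<beta>) (rotation \<alpha> \<beta> s) = s"
proof -
  obtain a b where s: "s = cp a b" and ab: "a \<noteq> 0 \<or> b \<noteq> 0" by (rule cp_cases)
  define k where "k = \<alpha> * cnj \<alpha> + \<beta> * cnj \<beta>"
  have "k = complex_of_real ((cmod \<alpha>)\<^sup>2 + (cmod \<beta>)\<^sup>2)"
    unfolding k_def by (simp only: complex_norm_square of_real_add)
  moreover have "(cmod \<alpha>)\<^sup>2 + (cmod \<beta>)\<^sup>2 \<noteq> 0" using assms by (simp add: sum_power2_eq_zero_iff)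
  ultimately have k: "k \<noteq> 0" by (simp only: of_real_eq_0_iff not_False_eq_True)
  have "rotation (cnj \<alpha>) (- \<beta>) (rotation \<alpha> \<beta> s) = cp (k * a) (k * b)"
    unfolding s rotation_cp[OF ab] rotation_cp[OF rotation_nz[OF ab assms]] k_def
    by (rule arg_cong2[of _ _ _ _ cp]) (simp_all add: algebra_simps)
  then show ?thesis using cp_scale[OF k] s by simp
qed

lemma cmod_sq_complex: "complex_of_real ((cmod z)\<^sup>2) = z * cnj z"
  by (rule complex_norm_square)

text \<open>The matrix multiplies determinants by \<open>k\<close> and each squared norm by
  \<open>k\<close>, so the quotient in \<open>inner_cp\<close> is unchanged.\<close>

lemma dist_rotation:
  assumes "\<alpha> \<noteq> 0 \<or> \<beta> \<noteq> 0"
  shows "dist (rotation \<alpha> \<beta> s) (rotation \<alpha> \<beta> t) = dist s t"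
proof -
  obtain a b where s: "s = cp a b" and ab: "a \<noteq> 0 \<or> b \<noteq> 0" by (rule cp_cases)
  obtain c e where t: "t = cp c e" and ce: "c \<noteq> 0 \<or> e \<noteq> 0" by (rule cp_cases)
  define k where "k = (cmod \<alpha>)\<^sup>2 + (cmod \<beta>)\<^sup>2"
  have k: "k \<noteq> 0" using assms by (simp add: k_def sum_power2_eq_zero_iff)
  have kc: "complex_of_real k = \<alpha> * cnj \<alpha> + \<beta> * cnj \<beta>"
    unfolding k_def by (simp only: complex_norm_square of_real_add)
  have k0: "k \<ge> 0" unfolding k_def by simp
  have det: "(\<alpha> * a + \<beta> * b) * (cnj \<alpha> * e - cnj \<beta> * c) - (cnj \<alpha> * b - cnj \<beta> * a) * (\<alpha> * c + \<beta> * e)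
     = of_real k * (a * e - b * c)"
    unfolding kc by (simp add: algebra_simps)
  have nrm: "(cmod (\<alpha> * a + \<beta> * b))\<^sup>2 + (cmod (cnj \<alpha> * b - cnj \<beta> * a))\<^sup>2 = k * ((cmod a)\<^sup>2 + (cmod b)\<^sup>2)" for a b
  proof -
    have "complex_of_real ((cmod (\<alpha> * a + \<beta> * b))\<^sup>2 + (cmod (cnj \<alpha> * b - cnj \<beta> * a))\<^sup>2)
      = complex_of_real (k * ((cmod a)\<^sup>2 + (cmod b)\<^sup>2))"
      unfolding of_real_add of_real_mult kc cmod_sq_complex by (simp add: algebra_simps)
    then show ?thesis by (simp only: of_real_eq_iff)
  qed
  have "stereo (rotation \<alpha> \<beta> s) \<bullet> stereo (rotation \<alpha> \<beta> t) = stereo s \<bullet> stereo t"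
    unfolding s t rotation_cp[OF ab] rotation_cp[OF ce] inner_cp[OF ab ce]
      inner_cp[OF rotation_nz[OF ab assms] rotation_nz[OF ce assms]] det nrm
    using k k0 by (simp add: norm_mult power_mult_distrib power2_eq_square)
  then show ?thesis by (simp add: dist_riemann_sphere_def)
qed

text \<open>The affine chart transported by a rotation that takes 0 to \<open>x\<close>. All charts
  are isometric copies of each other, so local estimates have the same constants at every point of
  the sphere.\<close>

definition chart :: "riemann_sphere \<Rightarrow> complex \<Rightarrow> riemann_sphere" where
  "chart x w = (case x of Point z \<Rightarrow> rotation 1 z (Point w) | Infty \<Rightarrow> rotation 0 1 (Point w))"

definition unrotate :: "riemann_sphere \<Rightarrow> riemann_sphere \<Rightarrow> riemann_sphere" where
  "unrotate x s = (case x of Point z \<Rightarrow> rotation 1 (- z) s | Infty \<Rightarrow> rotation 0 (- 1) s)"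

definition coord :: "riemann_sphere \<Rightarrow> riemann_sphere \<Rightarrow> complex" where
  "coord x s = (case unrotate x s of Point w \<Rightarrow> w | Infty \<Rightarrow> 0)"

lemma chart_0 [simp]: "chart x 0 = x"
  by (cases x) (simp_all add: chart_def rotation_def)

lemma unrotate_chart [simp]: "unrotate x (chart x w) = Point w"
proof (cases x)
  case (Point z)
  then show ?thesis using rotation_inverse[of 1 z "Point w"] by (simp add: chart_def unrotate_def)
next
  case Infty
  then show ?thesis using rotation_inverse[of 0 1 "Point w"] by (simp add: chart_def unrotate_def)
qed

lemma coord_chart [simp]: "coord x (chart x w) = w"
  by (simp add: coord_def)

lemma chart_unrotate:
  assumes "unrotate x s = Point w"
  shows "chart x w = s"
proof (cases x)
  case (Point z)
  then show ?thesis using rotation_inverse[of 1 "-z" s] assms by (simp add: chart_def unrotate_def)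
next
  case Infty
  then show ?thesis using rotation_inverse[of 0 "-1" s] assms by (simp add: chart_def unrotate_def)
qed

lemma dist_chart: "dist (chart x u) (chart x v) = dist (Point u) (Point v)"
  by (cases x) (simp_all add: chart_def dist_rotation)

lemma dist_unrotate: "dist (unrotate x s) (unrotate x t) = dist s t"
  by (cases x) (simp_all add: unrotate_def dist_rotation)

text \<open>The constant comes from far points: if the chordal quantity \<open>c\<close> exceeds
  1/2, the distance is at most pi, which is less than 4 and hence than \<open>8 * c\<close>. For
  \<open>c \<le> 1/2\<close> the mean value theorem gives
  \<open>arcsin c \<le> 2 * c\<close>.\<close>

lemma dist_Point_le: "dist (Point u) (Point v) \<le> 8 * cmod (u - v)"
proof -
  define c where "c = cmod (u - v) / (sqrt (1 + (cmod u)\<^sup>2) * sqrt (1 + (cmod v)\<^sup>2))"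
  have s1: "sqrt (1 + (cmod u)\<^sup>2) \<ge> 1" "sqrt (1 + (cmod v)\<^sup>2) \<ge> 1" by simp_all
  then have "1 * 1 \<le> sqrt (1 + (cmod u)\<^sup>2) * sqrt (1 + (cmod v)\<^sup>2)" by (intro mult_mono) auto
  then have cle: "c \<le> cmod (u - v)"
    unfolding c_def by (simp add: divide_le_eq mult_le_cancel_left1 mult_left_le)
  have c0: "c \<ge> 0" by (simp add: c_def)
  have d: "dist (Point u) (Point v) = 2 * arcsin c" unfolding c_def by (rule dist_Point)
  show ?thesis
  proof (cases "c \<le> 1/2")
    case True
    have "arcsin c \<le> 2 * c"
    proof (cases "c = 0")
      case False
      then have "c > 0" using c0 by simp
      have "\<exists>z>0. z < c \<and> arcsin c - arcsin 0 = (c - 0) * inverse (sqrt (1 - z\<^sup>2))"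
        using \<open>c > 0\<close> True by (intro MVT2 DERIV_arcsin) auto
      then obtain z where z: "0 < z" "z < c" "arcsin c = c * inverse (sqrt (1 - z\<^sup>2))" by auto
      have "z\<^sup>2 \<le> (1/2)\<^sup>2" using z True by (intro power_mono) auto
      then have "(1/2)\<^sup>2 \<le> 1 - z\<^sup>2" by (simp add: power2_eq_square)
      then have "1/2 \<le> sqrt (1 - z\<^sup>2)" by (intro real_le_rsqrt)
      then have "inverse (sqrt (1 - z\<^sup>2)) \<le> inverse (1/2)" by (intro le_imp_inverse_le) auto
      then have "c * inverse (sqrt (1 - z\<^sup>2)) \<le> c * 2" using c0 by (intro mult_left_mono) auto
      then show ?thesis using z by simp
    qed simp
    then show ?thesis using d cle c0 by linarith
  next
    case False
    have "dist (Point u) (Point v) \<le> pi"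
      unfolding dist_riemann_sphere_def using inner_unit_bounds[of "stereo (Point u)" "stereo (Point v)"]
      by (intro arccos_ubound) auto
    then show ?thesis using pi_less_4 False cle by linarith
  qed
qed

text \<open>On the unit disc the product of the two square roots is at most 2, so the chordal
  quantity is at least half the Euclidean distance; the angle is at least its sine.\<close>

lemma cmod_le_dist_Point:
  assumes "cmod u \<le> 1" "cmod v \<le> 1"
  shows "cmod (u - v) \<le> dist (Point u) (Point v)"
proof -
  define q where "q = sqrt (1 + (cmod u)\<^sup>2) * sqrt (1 + (cmod v)\<^sup>2)"
  define c where "c = cmod (u - v) / q"
  have c0: "c \<ge> 0" by (simp add: c_def q_def)
  have d: "dist (Point u) (Point v) = 2 * arcsin c" unfolding c_def q_def by (rule dist_Point)
  have "(cmod u)\<^sup>2 \<le> 1" "(cmod v)\<^sup>2 \<le> 1" using assms by (simp_all add: power_le_one)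
  then have "q \<le> sqrt 2 * sqrt 2" unfolding q_def by (intro mult_mono) auto
  then have q: "q \<le> 2" by simp
  have q0: "q > 0" unfolding q_def using one_plus_sq_pos[of u] one_plus_sq_pos[of v] by simp
  have c1: "c \<le> 1"
  proof (rule ccontr)
    assume "\<not> c \<le> 1"
    define r where "r = (1 + (cmod u)\<^sup>2) * (1 + (cmod v)\<^sup>2)"
    have r: "r > 0" using one_plus_sq_pos[of u] one_plus_sq_pos[of v] by (simp add: r_def)
    have "q\<^sup>2 = r" using one_plus_sq_pos[of u] one_plus_sq_pos[of v]
      by (simp add: q_def r_def power_mult_distrib)
    have "-1 \<le> stereo (Point u) \<bullet> stereo (Point v)" using inner_unit_bounds[of "stereo (Point u)" "stereo (Point v)"] by simp
    then have "(cmod (u - v))\<^sup>2 / r \<le> 1" unfolding inner_stereo_Point r_def[symmetric] by simp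
    then have "c\<^sup>2 \<le> 1" unfolding c_def power_divide \<open>q\<^sup>2 = r\<close> .
    then show False using \<open>\<not> c \<le> 1\<close> c0 by (simp add: power_le_one_iff)
  qed
  have "sin (arcsin c) = c" using c0 c1 by (intro sin_arcsin) auto
  moreover have "sin (arcsin c) \<le> arcsin c"
    by (rule sin_x_le_x) (use c0 c1 arcsin_le_arcsin[of 0 c] in simp)
  ultimately have "c \<le> arcsin c" by simp
  moreover have "cmod (u - v) \<le> 2 * c"
    unfolding c_def using q q0 mult_right_mono[OF q, of "cmod (u - v)"] by (simp add: field_simps)
  ultimately show ?thesis unfolding d by linarith
qed

text \<open>A distance below 1 is below pi/2, so the point lies in the open hemisphere that
  corresponds to the unit disc. This is why 1 serves as the radius of validity of all
  charts.\<close>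

lemma dist_lt_1_Point:
  assumes "dist (Point 0) s < 1"
  obtains w where "s = Point w" "cmod w < 1" "cmod w \<le> dist (Point 0) s"
proof (cases s)
  case Infty
  have "dist (Point 0) s = arccos (- 1)"
    by (simp add: Infty dist_riemann_sphere_def stereo.simps)
  then show ?thesis using assms pi_gt3 by simp
next
  case (Point w)
  have "cmod w < 1"
  proof (rule ccontr)
    assume "\<not> cmod w < 1"
    then have w: "(cmod w)\<^sup>2 \<ge> 1" by (simp add: one_le_power)
    have "stereo (Point 0) \<bullet> stereo (Point w) = 1 - 2 * (cmod w)\<^sup>2 / (1 + (cmod w)\<^sup>2)"
      unfolding inner_stereo_Point by simp
    also have "\<dots> \<le> 0" using w one_plus_sq_pos[of w] by (simp add: field_simps)
    finally have "arccos 0 \<le> dist (Point 0) s"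
      unfolding Point dist_riemann_sphere_def using inner_unit_bounds[of "stereo (Point 0)" "stereo (Point w)"]
      by (intro arccos_le_arccos) auto
    then show False using assms pi_gt3 by simp
  qed
  then show ?thesis using that[OF Point] cmod_le_dist_Point[of 0 w] Point by simp
qed

lemma chart_coord:
  assumes "dist x s < 1"
  shows "chart x (coord x s) = s" "cmod (coord x s) < 1" "cmod (coord x s) \<le> dist x s"
proof -
  have ux: "unrotate x x = Point 0" using unrotate_chart[of x 0] by simp
  have "dist (Point 0) (unrotate x s) = dist x s"
    using dist_unrotate[of x x s] ux by simp
  then obtain w where w: "unrotate x s = Point w" "cmod w < 1" "cmod w \<le> dist x s"
    using assms dist_lt_1_Point[of "unrotate x s"] by metis
  then have "coord x s = w" by (simp add: coord_def)
  then show "chart x (coord x s) = s" "cmod (coord x s) < 1" "cmod (coord x s) \<le> dist x s"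
    using w chart_unrotate by auto
qed

lemma dist_chart_le: "dist (chart x u) (chart x v) \<le> 8 * cmod (u - v)"
  unfolding dist_chart by (rule dist_Point_le)

lemma dist_chart_center_le: "dist x (chart x v) \<le> 8 * cmod v" "dist (chart x v) x \<le> 8 * cmod v"
  using dist_chart_le[of x 0 v] dist_chart_le[of x v 0] by auto

lemma continuous_chart: "continuous_on A (chart x)"
proof -
  have "isCont (chart x) u" for u
    unfolding continuous_at_eps_delta
  proof (intro allI impI)
    fix e :: real assume "e > 0"
    then show "\<exists>d>0. \<forall>v. dist v u < d \<longrightarrow> dist (chart x v) (chart x u) < e"
      by (intro exI[of _ "e/8"]) (auto simp: dist_norm intro: le_less_trans[OF dist_chart_le])
  qed
  then show ?thesis by (simp add: continuous_at_imp_continuous_on)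
qed

lemma compact_riemann_sphere: "compact (UNIV :: riemann_sphere set)"
proof -
  have "UNIV = chart (Point 0) ` cball 0 1 \<union> chart Infty ` cball 0 1"
  proof (intro equalityI subsetI)
    fix s :: riemann_sphere
    show "s \<in> chart (Point 0) ` cball 0 1 \<union> chart Infty ` cball 0 1"
    proof (cases s)
      case (Point w)
      show ?thesis
      proof (cases "cmod w \<le> 1")
        case True
        then show ?thesis using Point
          by (intro UnI1 image_eqI[of _ _ w]) (simp_all add: chart_def rotation_def)
      next
        case False
        then show ?thesis using Point
          by (intro UnI2 image_eqI[of _ _ "- inverse w"])
             (auto simp: chart_def rotation_def cp_def norm_inverse inverse_le_1_iff divide_inverse)
      qed
    next
      case Infty
      then show ?thesis by (intro UnI2 image_eqI[of _ _ 0]) simp_all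
    qed
  qed auto
  then show ?thesis
    by (metis compact_Un compact_continuous_image continuous_chart compact_cball)
qed


definition rot :: "riemann_sphere \<Rightarrow> riemann_sphere \<Rightarrow> riemann_sphere" where
  "rot x s = (case x of Point z \<Rightarrow> rotation 1 z s | Infty \<Rightarrow> rotation 0 1 s)"

lemma chart_eq_rot: "chart x w = rot x (Point w)"
  by (cases x) (simp_all add: chart_def rot_def)

lemma rot_unrotate [simp]: "rot x (unrotate x s) = s" "unrotate x (rot x s) = s"
  using rotation_inverse[of 1 "- (case x of Point z \<Rightarrow> z | Infty \<Rightarrow> 0)" s] rotation_inverse[of 0 "- 1" s]
    rotation_inverse[of 1 "case x of Point z \<Rightarrow> z | Infty \<Rightarrow> 0" s] rotation_inverse[of 0 "1" s]
  by (cases x; simp add: rot_def unrotate_def)+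

lemma dist_rot: "dist (rot x s) (rot x t) = dist s t"
  by (cases x) (simp_all add: rot_def dist_rotation)

lemma at_rot: "at (rot x s) = filtermap (rot x) (at s)"
proof (rule filter_eqI)
  fix P
  have "(\<forall>t. t \<noteq> rot x s \<and> dist t (rot x s) < d \<longrightarrow> P t) \<longleftrightarrow> (\<forall>t. t \<noteq> s \<and> dist t s < d \<longrightarrow> P (rot x t))" for d
    by (metis dist_rot rot_unrotate)
  then show "eventually P (at (rot x s)) = eventually P (filtermap (rot x) (at s))"
    unfolding eventually_filtermap eventually_at by simp
qed

lemma spherical_deriv_conj:
  "spherical_deriv (\<lambda>s. unrotate y (F (rot x s))) s = spherical_deriv F (rot x s)"
  unfolding spherical_deriv_def dist_unrotate at_rot Topological_Spaces.Lim_def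
  by (simp add: filterlim_filtermap dist_rot)

section \<open>Rational maps of the plane into the sphere\<close>

text \<open>Homogeneous numerator and denominator without common zeros. The class is stable under
  rotations and under \<open>f\<close>, so every iterate read in any two charts is holomorphic by
  one argument.\<close>

definition rational_curve :: "(complex \<Rightarrow> riemann_sphere) \<Rightarrow> bool" where
  "rational_curve H \<longleftrightarrow> (\<exists>a b. (\<forall>w. poly a w \<noteq> 0 \<or> poly b w \<noteq> 0) \<and> (\<forall>w. H w = cp (poly a w) (poly b w)))"

lemma rational_curve_rotation:
  assumes "rational_curve H" "\<alpha> \<noteq> 0 \<or> \<beta> \<noteq> 0"
  shows "rational_curve (\<lambda>w. rotation \<alpha> \<beta> (H w))"
proof -
  obtain a b where ab: "\<And>w. poly a w \<noteq> 0 \<or> poly b w \<noteq> 0" "\<And>w. H w = cp (poly a w) (poly b w)"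
    using assms(1) unfolding rational_curve_def by blast
  show ?thesis unfolding rational_curve_def
    using rotation_nz[OF ab(1) assms(2)] rotation_cp[OF ab(1)] ab(2)
    by (intro exI[of _ "smult \<alpha> a + smult \<beta> b"] exI[of _ "smult (cnj \<alpha>) b - smult (cnj \<beta>) a"]) simp
qed

lemma rational_curve_unrotate:
  assumes "rational_curve H"
  shows "rational_curve (\<lambda>w. unrotate x (H w))"
  using rational_curve_rotation[OF assms, of 1 "- (case x of Point z \<Rightarrow> z | Infty \<Rightarrow> 0)"]
    rational_curve_rotation[OF assms, of 0 "-1"]
  by (cases x) (simp_all add: unrotate_def)

lemma rational_curve_chart: "rational_curve (chart x)"
proof -
  have "rational_curve Point"
    unfolding rational_curve_def by (intro exI[of _ "[:0, 1:]"] exI[of _ 1]) simp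
  then show ?thesis
    using rational_curve_rotation[of Point 1 "case x of Point z \<Rightarrow> z | Infty \<Rightarrow> 0"]
      rational_curve_rotation[of Point 0 1]
    by (cases x) (simp_all add: chart_def[abs_def])
qed

lemma rational_curve_holomorphic:
  assumes "rational_curve H" "\<And>w. w \<in> S \<Longrightarrow> H w \<noteq> Infty"
  shows "\<exists>g. g holomorphic_on S \<and> (\<forall>w\<in>S. H w = Point (g w))"
proof -
  obtain a b where ab: "\<And>w. H w = cp (poly a w) (poly b w)"
    using assms(1) unfolding rational_curve_def by blast
  have nz: "poly b w \<noteq> 0" if "w \<in> S" for w
    using assms(2)[OF that] unfolding ab by (auto simp: cp_def)
  show ?thesis
    by (intro exI[of _ "\<lambda>w. poly a w / poly b w"] conjI ballI holomorphic_intros nz)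
       (use nz in \<open>auto simp: ab cp_def\<close>)
qed

lemma rational_curve_coord_holomorphic:
  assumes H: "rational_curve H" and near: "\<And>w. w \<in> S \<Longrightarrow> dist y (H w) < 1"
  shows "(\<lambda>w. coord y (H w)) holomorphic_on S"
proof -
  have pt: "unrotate y (H w) = Point (coord y (H w))" if "w \<in> S" for w
    using chart_coord(1)[OF near[OF that]] unrotate_chart[of y "coord y (H w)"] by simp
  then obtain g where g: "g holomorphic_on S" "\<forall>w\<in>S. unrotate y (H w) = Point (g w)"
    using rational_curve_holomorphic[OF rational_curve_unrotate[OF H, of y], of S] by fastforce
  then show ?thesis
    using pt by (subst holomorphic_cong[of S S _ g]) auto
qed

text \<open>By \<open>inner_cp\<close> the distance between two values is the arccos of an
  expression continuous in the homogeneous coordinates, so poles are treated like other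
  points.\<close>

lemma rational_curve_continuous:
  assumes "rational_curve H"
  shows "isCont H w"
proof -
  obtain a b where ab: "\<And>w. poly a w \<noteq> 0 \<or> poly b w \<noteq> 0" "\<And>w. H w = cp (poly a w) (poly b w)"
    using assms unfolding rational_curve_def by blast
  have nz: "(cmod (poly a w))\<^sup>2 + (cmod (poly b w))\<^sup>2 \<noteq> 0" for w
    using ab(1)[of w] by (simp add: sum_power2_eq_zero_iff)
  define r where "r v = 1 - 2 * (cmod (poly a v * poly b w - poly b v * poly a w))\<^sup>2 /
     (((cmod (poly a v))\<^sup>2 + (cmod (poly b v))\<^sup>2) * ((cmod (poly a w))\<^sup>2 + (cmod (poly b w))\<^sup>2))" for v
  have r: "stereo (H v) \<bullet> stereo (H w) = r v" for v
    unfolding r_def ab(2) by (rule inner_cp[OF ab(1) ab(1)])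
  have rb: "- 1 \<le> r v" "r v \<le> 1" for v
    using inner_unit_bounds[of "stereo (H v)" "stereo (H w)"] unfolding r by auto
  have "isCont r w"
    unfolding r_def using nz by (intro continuous_intros) auto
  then have "(r \<longlongrightarrow> r w) (at w)" by (simp add: isCont_def)
  moreover have "continuous_on {-1..1} arccos" by (rule continuous_on_arccos')
  ultimately have "((\<lambda>v. arccos (r v)) \<longlongrightarrow> arccos (r w)) (at w)"
    using rb by (intro continuous_on_tendsto_compose[of "{- 1..1}" arccos]) auto
  moreover have "arccos (r w) = 0" using r[of w] by simp
  ultimately have "((\<lambda>v. dist (H v) (H w)) \<longlongrightarrow> 0) (at w)"
    unfolding dist_riemann_sphere_def r by simp
  then show ?thesis unfolding isCont_def by (rule tendsto_dist_iff[THEN iffD2])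
qed

lemma isCont_sphereI:
  fixes F :: "riemann_sphere \<Rightarrow> 'a :: metric_space"
  assumes "isCont (\<lambda>w. F (chart x w)) 0"
  shows "isCont F x"
  unfolding continuous_at_eps_delta
proof (intro allI impI)
  fix e :: real assume "e > 0"
  then obtain d where d: "d > 0" "\<And>v. cmod v < d \<Longrightarrow> dist (F (chart x v)) (F x) < e"
    using assms unfolding continuous_at_eps_delta by auto
  have "dist (F s) (F x) < e" if "dist s x < min d 1" for s
    using that chart_coord[of x s] d(2)[of "coord x s"] by (simp add: dist_commute)
  then show "\<exists>d>0. \<forall>s. dist s x < d \<longrightarrow> dist (F s) (F x) < e"
    using d(1) by (intro exI[of _ "min d 1"]) auto
qed

lemma spherical_deriv_chart:
  assumes "open S" "w \<in> S" and near: "\<And>v. v \<in> S \<Longrightarrow> dist y (F (chart x v)) < 1"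
    and G: "((\<lambda>v. coord y (F (chart x v))) has_field_derivative D) (at w)"
  shows "spherical_deriv F (chart x w) =
    cmod D * (1 + (cmod w)\<^sup>2) / (1 + (cmod (coord y (F (chart x w))))\<^sup>2)"
proof -
  have "\<forall>\<^sub>F v in nhds w. v \<in> S" using assms by (simp add: eventually_nhds_in_open)
  then have "\<forall>\<^sub>F v in nhds w. unrotate y (F (rot x (Point v))) = Point (coord y (F (chart x v)))"
  proof eventually_elim
    case (elim v)
    show ?case
      using chart_coord(1)[OF near[OF elim]] unrotate_chart[of y "coord y (F (chart x v))"]
      by (simp add: chart_eq_rot)
  qed
  from spherical_deriv_Point[OF G, of "\<lambda>s. unrotate y (F (rot x s))", OF this]
  show ?thesis by (simp add: spherical_deriv_conj chart_eq_rot)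
qed

locale rational_dynamics =
  fixes p q :: "complex poly" and f :: "riemann_sphere \<Rightarrow> riemann_sphere" and d :: nat
  assumes cop: "coprime p q" and q0: "q \<noteq> 0" and f_eq: "f = rational_eval p q"
    and d_eq: "d = max (degree p) (degree q)" and d2: "d \<ge> 2"
begin

text \<open>Both \<open>p\<close> and \<open>q\<close> are homogenised to the same degree
  \<open>d\<close>, even if one of them has smaller degree; this makes \<open>f\<close> act on
  homogeneous coordinates also at infinity.\<close>

definition hom :: "complex poly \<Rightarrow> complex \<Rightarrow> complex \<Rightarrow> complex" where
  "hom r u v = (\<Sum>i\<le>d. coeff r i * u ^ i * v ^ (d - i))"

lemma hom_nz:
  assumes "degree r \<le> d" "v \<noteq> 0"
  shows "hom r u v = v ^ d * poly r (u / v)"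
proof -
  have "poly r (u / v) = (\<Sum>i\<le>d. coeff r i * (u / v) ^ i)"
    unfolding poly_altdef using assms(1) by (intro sum.mono_neutral_left) (auto simp: coeff_eq_0)
  also have "v ^ d * \<dots> = (\<Sum>i\<le>d. coeff r i * u ^ i * v ^ (d - i))"
    unfolding sum_distrib_left
    by (intro sum.cong refl) (use assms(2) in \<open>simp add: power_divide power_diff\<close>)
  finally show ?thesis by (simp add: hom_def)
qed

lemma hom_0: "hom r u 0 = coeff r d * u ^ d"
proof -
  have "hom r u 0 = (\<Sum>i\<le>d. if i = d then coeff r d * u ^ d else 0)"
    unfolding hom_def by (intro sum.cong refl) auto
  then show ?thesis by simp
qed

lemma deg: "degree p \<le> d" "degree q \<le> d"
  by (simp_all add: d_eq)

lemma no_common_root: "\<not> (poly p z = 0 \<and> poly q z = 0)"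
  using cop coprime_poly_0[of p q z] by blast

lemma f_cp:
  assumes "u \<noteq> 0 \<or> v \<noteq> 0"
  shows "f (cp u v) = cp (hom p u v) (hom q u v)" "hom p u v \<noteq> 0 \<or> hom q u v \<noteq> 0"
proof -
  have "f (cp u v) = cp (hom p u v) (hom q u v) \<and> (hom p u v \<noteq> 0 \<or> hom q u v \<noteq> 0)"
  proof (cases "v = 0")
    case False
    then have "f (cp u v) = cp (poly p (u / v)) (poly q (u / v))"
      by (simp add: f_eq cp_def)
    then show ?thesis
      unfolding hom_nz[OF deg(1) False] hom_nz[OF deg(2) False]
      using cp_scale[of "v ^ d" "poly p (u / v)" "poly q (u / v)"] False no_common_root[of "u / v"] by auto
  next
    case True
    then have u: "u ^ d \<noteq> 0" using assms by simp
    have h: "hom r u v = coeff r d * u ^ d" for r using True hom_0 by simp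
    show ?thesis
    proof (cases "degree p > degree q")
      case True
      then have "d = degree p" "coeff q d = 0" by (auto simp: d_eq coeff_eq_0)
      moreover have "p \<noteq> 0" using True by auto
      ultimately show ?thesis using True \<open>v = 0\<close> u unfolding h by (simp add: f_eq cp_def)
    next
      case False
      then have "d = degree q" by (simp add: d_eq)
      then show ?thesis using False \<open>v = 0\<close> u q0 unfolding h by (simp add: f_eq cp_def)
    qed
  qed
  then show "f (cp u v) = cp (hom p u v) (hom q u v)" "hom p u v \<noteq> 0 \<or> hom q u v \<noteq> 0" by auto
qed

definition hompoly :: "complex poly \<Rightarrow> complex poly \<Rightarrow> complex poly \<Rightarrow> complex poly" where
  "hompoly r a b = (\<Sum>i\<le>d. smult (coeff r i) (a ^ i * b ^ (d - i)))"

lemma poly_hompoly: "poly (hompoly r a b) w = hom r (poly a w) (poly b w)"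
  by (simp add: hompoly_def hom_def poly_sum mult.assoc)

lemma rational_curve_f:
  assumes "rational_curve H"
  shows "rational_curve (\<lambda>w. f (H w))"
proof -
  obtain a b where ab: "\<And>w. poly a w \<noteq> 0 \<or> poly b w \<noteq> 0" "\<And>w. H w = cp (poly a w) (poly b w)"
    using assms unfolding rational_curve_def by blast
  show ?thesis unfolding rational_curve_def
    by (intro exI[of _ "hompoly p a b"] exI[of _ "hompoly q a b"])
       (use f_cp[OF ab(1)] ab(2) in \<open>simp add: poly_hompoly\<close>)
qed

lemma rational_curve_funpow:
  assumes "rational_curve H"
  shows "rational_curve (\<lambda>w. (f ^^ n) (H w))"
  by (induction n) (use assms rational_curve_f in auto)

lemma isCont_funpow: "isCont (f ^^ n) x"
  by (intro isCont_sphereI rational_curve_continuous rational_curve_funpow rational_curve_chart)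

lemma isCont_f: "isCont f x"
  using isCont_funpow[where n = "Suc 0" and x = x] by simp

lemma continuous_on_funpow: "continuous_on A (f ^^ n)"
  by (simp add: continuous_at_imp_continuous_on isCont_funpow)

text \<open>Uniform continuity of \<open>f\<close> on the compact sphere: one disc size is good for
  all charts at once.\<close>

lemma uniform_radius:
  obtains \<rho> where "\<rho> > 0" "\<rho> \<le> 1" "\<And>x w. cmod w < \<rho> \<Longrightarrow> dist (f x) (f (chart x w)) < 1"
proof -
  have "uniformly_continuous_on UNIV f"
    using continuous_on_funpow[of UNIV 1] by (intro compact_uniformly_continuous compact_riemann_sphere) simp
  then obtain e where e: "e > 0" "\<And>s t. dist s t < e \<Longrightarrow> dist (f s) (f t) < 1"
    unfolding uniformly_continuous_on_def by (metis UNIV_I zero_less_one)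
  show ?thesis
  proof (rule that[of "min 1 (e/8)"])
    fix x w assume "cmod w < min 1 (e / 8)"
    then have "8 * cmod w < e" by simp
    then have "dist x (chart x w) < e" using dist_chart_center_le(1)[of x w] by linarith
    then show "dist (f x) (f (chart x w)) < 1" by (rule e(2))
  qed (use e in auto)
qed

definition local_map :: "riemann_sphere \<Rightarrow> complex \<Rightarrow> complex" where
  "local_map x w = coord (f x) (f (chart x w))"

lemma spherical_deriv_facts:
  obtains \<rho> where "\<rho> > 0" "\<rho> \<le> 1"
    "\<And>x. local_map x holomorphic_on ball 0 \<rho>" "\<And>x. local_map x 0 = 0"
    "\<And>x w. w \<in> ball 0 \<rho> \<Longrightarrow> cmod (local_map x w) < 1"
    "\<And>x w. w \<in> ball 0 \<rho> \<Longrightarrow> f (chart x w) = chart (f x) (local_map x w)"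
    "\<And>x w. w \<in> ball 0 \<rho> \<Longrightarrow> spherical_deriv f (chart x w) =
       cmod (deriv (local_map x) w) * (1 + (cmod w)\<^sup>2) / (1 + (cmod (local_map x w))\<^sup>2)"
proof -
  obtain \<rho> where \<rho>: "\<rho> > 0" "\<rho> \<le> 1" "\<And>x w. cmod w < \<rho> \<Longrightarrow> dist (f x) (f (chart x w)) < 1"
    using uniform_radius by blast
  show ?thesis
  proof (rule that[OF \<rho>(1,2)])
    fix x
    show hol: "local_map x holomorphic_on ball 0 \<rho>"
      unfolding local_map_def[abs_def]
      by (intro rational_curve_coord_holomorphic rational_curve_f rational_curve_chart \<rho>(3)) simp
    show "local_map x 0 = 0"
      using coord_chart[of "f x" 0] by (simp add: local_map_def)
    fix w assume w: "w \<in> ball (0::complex) \<rho>"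
    then have d: "dist (f x) (f (chart x w)) < 1" by (intro \<rho>(3)) simp
    show "cmod (local_map x w) < 1" "f (chart x w) = chart (f x) (local_map x w)"
      using chart_coord[OF d] by (simp_all add: local_map_def)
    have "(local_map x has_field_derivative deriv (local_map x) w) (at w)"
      using hol w by (intro holomorphic_derivI) auto
    then show "spherical_deriv f (chart x w) =
       cmod (deriv (local_map x) w) * (1 + (cmod w)\<^sup>2) / (1 + (cmod (local_map x w))\<^sup>2)"
      unfolding local_map_def[abs_def]
      by (intro spherical_deriv_chart[OF open_ball w]) (auto intro: \<rho>(3))
  qed
qed

lemma spherical_deriv_center: "spherical_deriv f x = cmod (deriv (local_map x) 0)"
proof -
  obtain \<rho> where \<rho>: "\<rho> > 0" "\<And>x. local_map x 0 = 0"
    "\<And>x w. w \<in> ball 0 \<rho> \<Longrightarrow> spherical_deriv f (chart x w) =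
       cmod (deriv (local_map x) w) * (1 + (cmod w)\<^sup>2) / (1 + (cmod (local_map x w))\<^sup>2)"
    using spherical_deriv_facts by metis
  show ?thesis using \<rho>(2)[of x] \<rho>(3)[of 0 x] \<rho>(1) by simp
qed

lemma isCont_spherical_deriv: "isCont (spherical_deriv f) x"
proof (rule isCont_sphereI)
  obtain \<rho> where \<rho>: "\<rho> > 0" "local_map x holomorphic_on ball 0 \<rho>"
    "\<And>w. w \<in> ball 0 \<rho> \<Longrightarrow> spherical_deriv f (chart x w) =
       cmod (deriv (local_map x) w) * (1 + (cmod w)\<^sup>2) / (1 + (cmod (local_map x w))\<^sup>2)"
    using spherical_deriv_facts by metis
  define h where "h w = cmod (deriv (local_map x) w) * (1 + (cmod w)\<^sup>2) / (1 + (cmod (local_map x w))\<^sup>2)" for w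
  have "continuous_on (ball 0 \<rho>) h"
    unfolding h_def
    by (intro continuous_intros holomorphic_on_imp_continuous_on holomorphic_deriv \<rho>(2) open_ball)
       (simp add: one_plus_sq_nz)
  then have "isCont h 0"
    using \<rho>(1) by (simp add: continuous_on_eq_continuous_at)
  moreover have "\<forall>\<^sub>F w in nhds 0. spherical_deriv f (chart x w) = h w"
    by (rule eventually_mono[OF eventually_nhds_in_open[of "ball 0 \<rho>" 0]])
       (use \<rho>(1) in \<open>auto simp: \<rho>(3) h_def\<close>)
  ultimately show "isCont (\<lambda>w. spherical_deriv f (chart x w)) 0"
    by (subst isCont_cong) auto
qed

lemma spherical_deriv_bounds:
  obtains \<Lambda> where "\<Lambda> > 1" "\<And>x. 0 \<le> spherical_deriv f x" "\<And>x. spherical_deriv f x \<le> \<Lambda>"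
proof -
  obtain \<rho> where \<rho>: "\<rho> > 0"
    "\<And>x w. w \<in> ball 0 \<rho> \<Longrightarrow> spherical_deriv f (chart x w) =
       cmod (deriv (local_map x) w) * (1 + (cmod w)\<^sup>2) / (1 + (cmod (local_map x w))\<^sup>2)"
    using spherical_deriv_facts by metis
  have nn: "0 \<le> spherical_deriv f x" for x
    using \<rho>(2)[of 0 x] \<rho>(1) by (simp add: divide_nonneg_pos one_plus_sq_pos)
  have "compact (range (spherical_deriv f))"
    by (intro compact_continuous_image compact_riemann_sphere continuous_at_imp_continuous_on)
       (simp add: isCont_spherical_deriv)
  then have "bounded (range (spherical_deriv f))" by (rule compact_imp_bounded)
  then obtain B where B: "\<And>x. spherical_deriv f x \<le> B"
    unfolding bounded_iff by (metis abs_le_D1 rangeI real_norm_def)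
  show ?thesis
    by (rule that[of "max 2 B"]) (use nn B in \<open>auto simp: le_max_iff_disj\<close>)
qed

section \<open>Counting preimages by the degree of a chart polynomial\<close>

lemma coeff_mult_top:
  fixes a b :: "complex poly"
  assumes "degree a \<le> m" "degree b \<le> n"
  shows "coeff (a * b) (m + n) = coeff a m * coeff b n"
proof -
  have "coeff a i * coeff b (m + n - i) = 0" if "i \<le> m + n" "i \<noteq> m" for i
  proof (cases "i < m")
    case True
    then have "degree b < m + n - i" using assms(2) by linarith
    then show ?thesis by (simp add: coeff_eq_0)
  next
    case False
    then have "degree a < i" using assms(1) that by linarith
    then show ?thesis by (simp add: coeff_eq_0)
  qed
  then have "(\<Sum>i\<le>m + n. coeff a i * coeff b (m + n - i)) = (\<Sum>i\<le>m + n. if i = m then coeff a m * coeff b n else 0)"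
    by (intro sum.cong) auto
  then show ?thesis by (simp add: coeff_mult)
qed

lemma coeff_power_top:
  fixes a :: "complex poly"
  assumes "degree a \<le> 1"
  shows "degree (a ^ n) \<le> n" "coeff (a ^ n) n = coeff a 1 ^ n"
proof -
  have "degree (a ^ n) \<le> n \<and> coeff (a ^ n) n = coeff a 1 ^ n"
  proof (induction n)
    case (Suc n)
    have "degree (a * a ^ n) \<le> degree a + degree (a ^ n)" by (rule degree_mult_le)
    moreover have "coeff (a * a ^ n) (1 + n) = coeff a 1 * coeff (a ^ n) n"
      using assms Suc by (intro coeff_mult_top) auto
    ultimately show ?case using assms Suc by simp
  qed simp
  then show "degree (a ^ n) \<le> n" "coeff (a ^ n) n = coeff a 1 ^ n" by auto
qed

lemma hompoly_linear:
  assumes "degree a \<le> 1" "degree b \<le> 1"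
  shows "degree (hompoly r a b) \<le> d" "coeff (hompoly r a b) d = hom r (coeff a 1) (coeff b 1)"
proof -
  have tm: "degree (a ^ i * b ^ (d - i)) \<le> d" "coeff (a ^ i * b ^ (d - i)) d = coeff a 1 ^ i * coeff b 1 ^ (d - i)"
    if "i \<le> d" for i
  proof -
    have "degree (a ^ i * b ^ (d - i)) \<le> degree (a ^ i) + degree (b ^ (d - i))" by (rule degree_mult_le)
    then show "degree (a ^ i * b ^ (d - i)) \<le> d"
      using coeff_power_top(1)[OF assms(1), of i] coeff_power_top(1)[OF assms(2), of "d - i"] that by linarith
    have "coeff (a ^ i * b ^ (d - i)) (i + (d - i)) = coeff (a ^ i) i * coeff (b ^ (d - i)) (d - i)"
      by (intro coeff_mult_top coeff_power_top assms)
    then show "coeff (a ^ i * b ^ (d - i)) d = coeff a 1 ^ i * coeff b 1 ^ (d - i)"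
      using that coeff_power_top(2)[OF assms(1)] coeff_power_top(2)[OF assms(2)] by simp
  qed
  show "degree (hompoly r a b) \<le> d"
    unfolding hompoly_def
    by (intro degree_sum_le) (auto simp: tm(1))
  show "coeff (hompoly r a b) d = hom r (coeff a 1) (coeff b 1)"
    unfolding hompoly_def hom_def coeff_sum by (intro sum.cong refl) (simp add: tm(2) mult.assoc)
qed

text \<open>Read in the charts at \<open>x\<close> and \<open>y\<close>, \<open>f\<close> is
  \<open>N / M\<close>. The zeros of \<open>N\<close> are the preimages of \<open>y\<close> other
  than the antipode \<open>rot x Infty\<close> of \<open>x\<close>, and a degree below
  \<open>d\<close> records that the antipode is a preimage too.\<close>

lemma chart_polynomials:
  obtains N M where "\<And>w. poly N w \<noteq> 0 \<or> poly M w \<noteq> 0"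
    "\<And>w. unrotate y (f (chart x w)) = cp (poly N w) (poly M w)" "degree N \<le> d"
    "coeff N d = 0 \<Longrightarrow> unrotate y (f (rot x Infty)) = Point 0"
proof -
  obtain \<alpha> \<beta> where ab: "\<alpha> \<noteq> 0 \<or> \<beta> \<noteq> 0" "rot x = rotation \<alpha> \<beta>"
  proof (cases x)
    case (Point z)
    then show ?thesis using that[of 1 z] by (auto simp: rot_def fun_eq_iff)
  next
    case Infty
    then show ?thesis using that[of 1 0] that[of 0 1] by (auto simp: rot_def fun_eq_iff)
  qed
  obtain \<gamma> \<delta> where gd: "\<gamma> \<noteq> 0 \<or> \<delta> \<noteq> 0" "unrotate y = rotation \<gamma> \<delta>"
  proof (cases y)
    case (Point z)
    then show ?thesis using that[of 1 "- z"] by (auto simp: unrotate_def fun_eq_iff)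
  next
    case Infty
    then show ?thesis using that[of 0 "- 1"] by (auto simp: unrotate_def fun_eq_iff)
  qed
  define a where "a = [:\<beta>, \<alpha>:]"
  define b where "b = [:cnj \<alpha>, - cnj \<beta>:]"
  have da: "degree a \<le> 1" "degree b \<le> 1" by (simp_all add: a_def b_def)
  have nz: "poly a w \<noteq> 0 \<or> poly b w \<noteq> 0" for w
    using rotation_nz[of w 1 \<alpha> \<beta>] ab(1) by (simp add: a_def b_def add.commute mult.commute)
  have ch: "chart x w = cp (poly a w) (poly b w)" for w
    using rotation_cp[of w 1 \<alpha> \<beta>] by (simp add: chart_eq_rot ab(2) a_def b_def algebra_simps)
  have inf: "rot x Infty = cp (coeff a 1) (coeff b 1)" "coeff a 1 \<noteq> 0 \<or> coeff b 1 \<noteq> 0"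
    using rotation_cp[of 1 0 \<alpha> \<beta>] ab(1) by (simp_all add: ab(2) a_def b_def)
  define P where "P = hompoly p a b"
  define Q where "Q = hompoly q a b"
  define N where "N = smult \<gamma> P + smult \<delta> Q"
  define M where "M = smult (cnj \<gamma>) Q - smult (cnj \<delta>) P"
  have un: "unrotate y (cp u v) = cp (\<gamma> * u + \<delta> * v) (cnj \<gamma> * v - cnj \<delta> * u)"
    "\<gamma> * u + \<delta> * v \<noteq> 0 \<or> cnj \<gamma> * v - cnj \<delta> * u \<noteq> 0" if "u \<noteq> 0 \<or> v \<noteq> 0" for u v
    using rotation_cp[OF that, of \<gamma> \<delta>] rotation_nz[OF that gd(1)] by (simp_all add: gd(2))
  show ?thesis
  proof (rule that)
    fix w
    have f: "f (chart x w) = cp (poly P w) (poly Q w)" "poly P w \<noteq> 0 \<or> poly Q w \<noteq> 0"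
      using f_cp[OF nz[of w]] by (simp_all add: ch P_def Q_def poly_hompoly)
    show "poly N w \<noteq> 0 \<or> poly M w \<noteq> 0" "unrotate y (f (chart x w)) = cp (poly N w) (poly M w)"
      using un[OF f(2)] by (simp_all add: f(1) N_def M_def)
  next
    show "degree N \<le> d"
      unfolding N_def P_def Q_def
      by (intro degree_add_le order_trans[OF degree_smult_le hompoly_linear(1)[OF da]])
  next
    assume c: "coeff N d = 0"
    have f: "f (rot x Infty) = cp (coeff P d) (coeff Q d)" "coeff P d \<noteq> 0 \<or> coeff Q d \<noteq> 0"
      unfolding inf(1) P_def Q_def hompoly_linear(2)[OF da] by (rule f_cp[OF inf(2)])+
    have "\<gamma> * coeff P d + \<delta> * coeff Q d = 0" using c by (simp add: N_def)
    then show "unrotate y (f (rot x Infty)) = Point 0"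
      unfolding f(1) using un[OF f(2)] by (simp add: cp_def)
  qed
qed

lemma unrotate_self_iff: "unrotate y s = Point 0 \<longleftrightarrow> s = y"
  using chart_unrotate[of y s 0] unrotate_chart[of y 0] by auto

lemma f_surj: "\<exists>z. f z = y"
proof -
  obtain N M where NM: "\<And>w. poly N w \<noteq> 0 \<or> poly M w \<noteq> 0"
    "\<And>w. unrotate y (f (chart y w)) = cp (poly N w) (poly M w)" "degree N \<le> d"
    "coeff N d = 0 \<Longrightarrow> unrotate y (f (rot y Infty)) = Point 0"
    using chart_polynomials[of y y] by blast
  show ?thesis
  proof (cases "coeff N d = 0")
    case True
    then show ?thesis using NM(4) unrotate_self_iff by blast
  next
    case False
    then have "degree N \<ge> d" by (rule le_degree)
    then have "\<not> constant (poly N)" using d2 by (simp add: constant_degree)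
    then obtain z where "poly N z = 0" using fundamental_theorem_of_algebra by blast
    then have "unrotate y (f (chart y z)) = Point 0"
      using NM(1,2)[of z] by (simp add: cp_def)
    then show ?thesis unfolding unrotate_self_iff by blast
  qed
qed

lemma funpow_surj: "\<exists>z. (f ^^ n) z = y"
proof (induction n arbitrary: y)
  case (Suc n)
  then show ?case using f_surj[of y] by (metis funpow.simps(2) o_apply)
qed simp

text \<open>If \<open>x\<close> were the only preimage of \<open>f x\<close>, the polynomial
  \<open>N\<close> would have degree \<open>d \<ge> 2\<close> with 0 as its only root. The root
  would be multiple, so the derivative at \<open>x\<close> would vanish.\<close>

lemma other_preimage:
  assumes "spherical_deriv f x \<noteq> 0"
  shows "\<exists>z. z \<noteq> x \<and> f z = f x"
proof (rule ccontr)
  assume "\<not> ?thesis"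
  then have only: "f z = f x \<Longrightarrow> z = x" for z by blast
  obtain N M where NM: "\<And>w. poly N w \<noteq> 0 \<or> poly M w \<noteq> 0"
    "\<And>w. unrotate (f x) (f (chart x w)) = cp (poly N w) (poly M w)" "degree N \<le> d"
    "coeff N d = 0 \<Longrightarrow> unrotate (f x) (f (rot x Infty)) = Point 0"
    using chart_polynomials[of "f x" x] by blast
  have root: "z = 0" if "poly N z = 0" for z
  proof -
    have "unrotate (f x) (f (chart x z)) = Point 0"
      using NM(1,2)[of z] that by (simp add: cp_def)
    then have "chart x z = x" unfolding unrotate_self_iff by (rule only)
    then show ?thesis using coord_chart[of x z] coord_chart[of x 0] by simp
  qed
  have "cp (poly N 0) (poly M 0) = Point 0"
    using NM(2)[of 0] unrotate_self_iff[of "f x" "f x"] by simp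
  then have N0: "poly N 0 = 0" and M0: "poly M 0 \<noteq> 0"
    by (auto simp: cp_def split: if_splits)
  have "coeff N d \<noteq> 0"
  proof
    assume "coeff N d = 0"
    then have "rot x Infty = x" using NM(4) only unfolding unrotate_self_iff by blast
    then have "unrotate x (rot x Infty) = unrotate x x" by simp
    then show False using unrotate_self_iff[of x x] by simp
  qed
  then have degN: "degree N = d" using NM(3) le_degree[of N d] by simp
  have "[:- 0, 1:] dvd N" using N0 by (simp only: poly_eq_0_iff_dvd)
  then obtain N1 where "N = [:- 0, 1:] * N1" by (rule dvdE)
  then have N1: "N = [:0, 1:] * N1" by (simp only: minus_zero)
  have "N1 \<noteq> 0"
  proof
    assume "N1 = 0"
    then show False using degN d2 unfolding N1 by simp
  qed
  then have "degree N1 + 1 = d" using degN unfolding N1 by (simp add: degree_mult_eq)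
  then have "\<not> constant (poly N1)" using d2 by (simp add: constant_degree)
  then obtain z where z: "poly N1 z = 0" using fundamental_theorem_of_algebra by blast
  have "poly N z = 0" unfolding N1 using z by simp
  then have "z = 0" by (rule root)
  then have "poly N1 0 = 0" using z by simp
  then have "poly (pderiv N) 0 = 0" unfolding N1 by (simp add: pderiv_mult pderiv_pCons)
  then have h: "(poly N has_field_derivative 0) (at 0)" using poly_DERIV[of N 0] by simp
  have "((\<lambda>w. poly N w / poly M w) has_field_derivative
      (0 * poly M 0 - poly N 0 * poly (pderiv M) 0) / (poly M 0 * poly M 0)) (at 0)"
    by (rule DERIV_divide[OF h poly_DERIV M0])
  then have der: "((\<lambda>w. poly N w / poly M w) has_field_derivative 0) (at 0)"
    using N0 by simp
  have ev: "\<forall>\<^sub>F w in nhds 0. poly N w / poly M w = local_map x w"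
  proof -
    have "open {w. poly M w \<noteq> 0}" by (intro open_Collect_neq continuous_intros)
    then have "\<forall>\<^sub>F w in nhds 0. w \<in> {w. poly M w \<noteq> 0}"
      by (rule eventually_nhds_in_open) (simp add: M0)
    then show ?thesis
    proof (rule eventually_mono)
      fix w assume "w \<in> {w. poly M w \<noteq> 0}"
      then show "poly N w / poly M w = local_map x w"
        unfolding local_map_def coord_def NM(2) by (simp add: cp_def)
    qed
  qed
  have "(local_map x has_field_derivative 0) (at 0)"
    by (rule DERIV_cong_ev[OF refl ev refl, THEN iffD1, OF der])
  then have "deriv (local_map x) 0 = 0" by (rule DERIV_imp_deriv)
  then show False using assms by (simp add: spherical_deriv_center)
qed

end

section \<open>Horseshoes\<close>

lemma dist_le_pi: "dist (s::riemann_sphere) t \<le> pi"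
  unfolding dist_riemann_sphere_def using inner_unit_bounds[of "stereo s" "stereo t"]
  by (intro arccos_ubound) auto

text \<open>The branches are indexed by all natural numbers although only those below
  \<open>p\<close> have disjoint images: streams then range over the full alphabet, and the
  Bernoulli measure below charges only the first \<open>p\<close> symbols.\<close>

locale contracting_branches =
  fixes f :: "riemann_sphere \<Rightarrow> riemann_sphere" and G :: "nat \<Rightarrow> riemann_sphere \<Rightarrow> riemann_sphere"
    and X :: "riemann_sphere set" and N p :: nat and lam :: real
  assumes cont: "\<And>x. isCont f x"
    and X: "compact X" "X \<noteq> {}"
    and GX: "\<And>i x. x \<in> X \<Longrightarrow> G i x \<in> X"
    and fG: "\<And>i x. x \<in> X \<Longrightarrow> (f ^^ N) (G i x) = x"
    and lip: "\<And>i x y. x \<in> X \<Longrightarrow> y \<in> X \<Longrightarrow> dist (G i x) (G i y) \<le> lam * dist x y"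
    and lam: "0 < lam" "lam < 1"
    and disj: "\<And>i j x y. i < p \<Longrightarrow> j < p \<Longrightarrow> i \<noteq> j \<Longrightarrow> x \<in> X \<Longrightarrow> y \<in> X \<Longrightarrow> G i x \<noteq> G j y"
    and p2: "p \<ge> 2" and N0: "N > 0"
begin

lemma isCont_iterate: "isCont (f ^^ n) x"
proof (induction n arbitrary: x)
  case (Suc n)
  have "isCont (f ^^ n) (f x)" by (rule Suc)
  then have "isCont (\<lambda>y. (f ^^ n) (f y)) x" by (rule isCont_o2[OF cont])
  then show ?case by (simp add: funpow_swap1 o_def)
qed (simp add: id_def)

lemma word_in_X: "x \<in> X \<Longrightarrow> foldr G xs x \<in> X"
  by (induction xs) (auto intro: GX)

lemma word_dist:
  assumes "x \<in> X" "y \<in> X"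
  shows "dist (foldr G xs x) (foldr G xs y) \<le> lam ^ length xs * dist x y"
proof (induction xs)
  case (Cons i xs)
  have "dist (G i (foldr G xs x)) (G i (foldr G xs y)) \<le> lam * dist (foldr G xs x) (foldr G xs y)"
    by (intro lip word_in_X assms)
  also have "\<dots> \<le> lam * (lam ^ length xs * dist x y)"
    using lam by (intro mult_left_mono Cons) auto
  finally show ?case by (simp add: mult.assoc)
qed simp

lemma word_dist_pi:
  assumes "x \<in> X" "y \<in> X"
  shows "dist (foldr G xs x) (foldr G xs y) \<le> lam ^ length xs * pi"
  using word_dist[OF assms] by (rule order_trans) (use lam in \<open>auto intro!: mult_left_mono dist_le_pi\<close>)

definition base_point where "base_point = (SOME x. x \<in> X)"

lemma base_point: "base_point \<in> X"
  unfolding base_point_def using X(2) by (simp add: some_in_eq)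

text \<open>The first symbol is the outermost branch, so longer prefixes give nested images and
  \<open>f ^^ N\<close> acts on codes as the shift.\<close>

definition coding :: "nat stream \<Rightarrow> riemann_sphere" where
  "coding \<omega> = lim (\<lambda>n. foldr G (stake n \<omega>) base_point)"

lemma lam_pi_tendsto: "(\<lambda>n. lam ^ n * pi) \<longlonglongrightarrow> 0"
  using lam by (intro tendsto_mult_left_zero LIMSEQ_realpow_zero) auto

lemma coding_tendsto_base: "(\<lambda>n. foldr G (stake n \<omega>) base_point) \<longlonglongrightarrow> coding \<omega>"
proof -
  have step: "dist (foldr G (stake (m + k) \<omega>) base_point) (foldr G (stake m \<omega>) base_point) \<le> lam ^ m * pi" for m k
  proof -
    have "stake (m + k) \<omega> = stake m \<omega> @ stake k (sdrop m \<omega>)" by (simp only: stake_add)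
    then show ?thesis
      using word_dist_pi[of "foldr G (stake k (sdrop m \<omega>)) base_point" base_point "stake m \<omega>"]
        word_in_X[OF base_point] base_point by (simp only: foldr_append o_apply length_stake)
  qed
  have "Cauchy (\<lambda>n. foldr G (stake n \<omega>) base_point)"
  proof (rule metric_CauchyI)
    fix e :: real assume "e > 0"
    then obtain M where M: "\<And>n. n \<ge> M \<Longrightarrow> lam ^ n * pi < e / 2"
      using lam_pi_tendsto[THEN LIMSEQ_D, of "e/2"] lam by (auto simp: abs_mult)
    have near: "dist (foldr G (stake n \<omega>) base_point) (foldr G (stake M \<omega>) base_point) < e / 2" if "n \<ge> M" for n
      using step[of M "n - M"] M[of M] that by simp
    have "dist (foldr G (stake m \<omega>) base_point) (foldr G (stake n \<omega>) base_point) < e" if "m \<ge> M" "n \<ge> M" for m n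
      using near[OF that(1)] near[OF that(2)] by (rule dist_triangle_half_l)
    then show "\<exists>M. \<forall>m\<ge>M. \<forall>n\<ge>M. dist (foldr G (stake m \<omega>) base_point) (foldr G (stake n \<omega>) base_point) < e"
      by blast
  qed
  moreover have "Topological_Spaces.complete (UNIV :: riemann_sphere set)" by (rule compact_imp_complete[OF compact_riemann_sphere])
  ultimately have "convergent (\<lambda>n. foldr G (stake n \<omega>) base_point)"
    unfolding convergent_def by (auto elim!: completeE)
  then show ?thesis unfolding coding_def by (simp add: convergent_LIMSEQ_iff)
qed

lemma coding_in_X: "coding \<omega> \<in> X"
  by (rule closed_sequentially[OF compact_imp_closed[OF X(1)] _ coding_tendsto_base])
     (simp add: word_in_X base_point)

lemma coding_tendsto:
  assumes "x \<in> X"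
  shows "(\<lambda>n. foldr G (stake n \<omega>) x) \<longlonglongrightarrow> coding \<omega>"
proof -
  have b: "dist (foldr G (stake n \<omega>) x) (coding \<omega>) \<le>
      lam ^ n * pi + dist (foldr G (stake n \<omega>) base_point) (coding \<omega>)" for n
    using word_dist_pi[OF assms base_point, of "stake n \<omega>"]
      dist_triangle[of "foldr G (stake n \<omega>) x" "coding \<omega>" "foldr G (stake n \<omega>) base_point"]
    unfolding length_stake by linarith
  have "(\<lambda>n. lam ^ n * pi + dist (foldr G (stake n \<omega>) base_point) (coding \<omega>)) \<longlonglongrightarrow> 0 + 0"
    by (intro tendsto_add lam_pi_tendsto tendsto_dist_iff[THEN iffD1] coding_tendsto_base)
  then have "(\<lambda>n. lam ^ n * pi + dist (foldr G (stake n \<omega>) base_point) (coding \<omega>)) \<longlonglongrightarrow> 0" by simp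
  then have "(\<lambda>n. dist (foldr G (stake n \<omega>) x) (coding \<omega>)) \<longlonglongrightarrow> 0"
    by (rule tendsto_sandwich[OF _ _ tendsto_const, rotated 2]) (simp_all add: b)
  then show ?thesis by (rule tendsto_dist_iff[THEN iffD2])
qed

lemma coding_stl: "coding \<omega> = G (shd \<omega>) (coding (stl \<omega>))"
proof (rule LIMSEQ_unique)
  show "(\<lambda>n. foldr G (stake (Suc n) \<omega>) base_point) \<longlonglongrightarrow> coding \<omega>"
    by (rule LIMSEQ_Suc[OF coding_tendsto_base])
  have d: "(\<lambda>n. lam * dist (foldr G (stake n (stl \<omega>)) base_point) (coding (stl \<omega>))) \<longlonglongrightarrow> lam * 0"
    by (intro tendsto_intros coding_tendsto_base[THEN tendsto_dist_iff[THEN iffD1]])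
  have "(\<lambda>n. dist (foldr G (stake (Suc n) \<omega>) base_point) (G (shd \<omega>) (coding (stl \<omega>)))) \<longlonglongrightarrow> 0"
  proof (rule tendsto_sandwich[OF _ _ tendsto_const])
    show "\<forall>\<^sub>F n in sequentially. dist (foldr G (stake (Suc n) \<omega>) base_point) (G (shd \<omega>) (coding (stl \<omega>)))
      \<le> lam * dist (foldr G (stake n (stl \<omega>)) base_point) (coding (stl \<omega>))"
      by (intro always_eventually allI) (simp add: lip word_in_X base_point coding_in_X)
  qed (use d in \<open>auto\<close>)
  then show "(\<lambda>n. foldr G (stake (Suc n) \<omega>) base_point) \<longlonglongrightarrow> G (shd \<omega>) (coding (stl \<omega>))"
    by (rule tendsto_dist_iff[THEN iffD2])
qed

lemma funpow_coding: "(f ^^ (N * k)) (coding \<omega>) = coding (sdrop k \<omega>)"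
proof (induction k arbitrary: \<omega>)
  case (Suc k)
  have "(f ^^ N) (coding \<omega>) = coding (stl \<omega>)"
    by (subst coding_stl) (rule fG[OF coding_in_X])
  moreover have "N * Suc k = N * k + N" by simp
  ultimately show ?case using Suc[of "stl \<omega>"] by (simp only: funpow_add o_apply sdrop.simps)
qed simp

lemma funpow_word: "x \<in> X \<Longrightarrow> (f ^^ (N * length xs)) (foldr G xs x) = x"
proof (induction xs)
  case (Cons i xs)
  have "(f ^^ N) (G i (foldr G xs x)) = foldr G xs x" by (intro fG word_in_X Cons)
  moreover have "N * length (i # xs) = N * length xs + N" by simp
  ultimately show ?case using Cons by (simp only: funpow_add o_apply foldr.simps)
qed simp

text \<open>Arbitrarily close to a coded point there are points that return to two fixed distinct points
  of \<open>X\<close> at the same time, so the iterates are not equicontinuous there.\<close>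

lemma coding_in_julia: "coding \<omega> \<in> julia_set f"
proof (rule ccontr)
  assume "coding \<omega> \<notin> julia_set f"
  then obtain U where U: "open U" "coding \<omega> \<in> U" "normal_family_on U (range (\<lambda>n. f ^^ n))"
    unfolding julia_set_def fatou_set_def by auto
  define s where "s n = f ^^ (N * n)" for n
  have "range s \<subseteq> range (\<lambda>n. f ^^ n)" by (auto simp: s_def)
  then obtain r g where r: "strict_mono r"
    "\<And>K. compact K \<Longrightarrow> K \<subseteq> U \<Longrightarrow> uniform_limit K (s \<circ> r) g sequentially"
    using U(3) unfolding normal_family_on_def by meson
  obtain e where e: "e > 0" "cball (coding \<omega>) e \<subseteq> U"
    using U open_contains_cball by blast
  let ?K = "cball (coding \<omega>) e"
  have K: "compact ?K" using compact_Int_closed[OF compact_riemann_sphere closed_cball] by simp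
  have lim: "uniform_limit ?K (s \<circ> r) g sequentially" by (rule r(2)[OF K e(2)])
  have "continuous_on ?K g"
  proof (rule uniform_limit_theorem[OF _ lim])
    show "\<forall>\<^sub>F n in sequentially. continuous_on ?K ((s \<circ> r) n)"
      by (intro always_eventually allI continuous_at_imp_continuous_on ballI) (simp add: s_def isCont_iterate)
  qed simp
  have eq: "x = g (coding \<omega>)" if x: "x \<in> X" for x
  proof -
    define a where "a n = foldr G (stake (r n) \<omega>) x" for n
    have a: "a \<longlonglongrightarrow> coding \<omega>"
      unfolding a_def using LIMSEQ_subseq_LIMSEQ[OF coding_tendsto[OF x] r(1)] by (simp add: o_def)
    have aK: "\<forall>\<^sub>F n in sequentially. a n \<in> ?K"
      using tendstoD[OF a e(1)] by (rule eventually_mono) (simp add: dist_commute less_imp_le)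
    have ga: "(\<lambda>n. g (a n)) \<longlonglongrightarrow> g (coding \<omega>)"
      by (rule continuous_on_tendsto_compose[OF \<open>continuous_on ?K g\<close> a _ aK]) (use e in simp)
    have "(\<lambda>n. dist (g (a n)) x) \<longlonglongrightarrow> 0"
    proof (rule tendstoI)
      fix \<epsilon> :: real assume "\<epsilon> > 0"
      from uniform_limitD[OF lim this] aK
      show "\<forall>\<^sub>F n in sequentially. dist (dist (g (a n)) x) 0 < \<epsilon>"
      proof eventually_elim
        case (elim n)
        have "(s \<circ> r) n (a n) = x"
          using funpow_word[OF x, of "stake (r n) \<omega>"] by (simp add: s_def a_def)
        then show ?case using elim by (auto simp: dist_commute)
      qed
    qed
    then have "(\<lambda>n. g (a n)) \<longlonglongrightarrow> x" by (rule tendsto_dist_iff[THEN iffD2])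
    then show ?thesis using ga by (rule LIMSEQ_unique)
  qed
  have "G 0 base_point = G 1 base_point"
    using eq[OF GX[OF base_point, of 0]] eq[OF GX[OF base_point, of 1]] by simp
  then show False using disj[of 0 1 base_point base_point] p2 base_point by simp
qed

section \<open>The Bernoulli measure and the invariant measure it induces\<close>

definition symbol_pmf :: "nat pmf" where "symbol_pmf = pmf_of_set {..<p}"

definition bernoulli :: "nat stream measure" where "bernoulli = stream_space (measure_pmf symbol_pmf)"

lemma p_set: "{..<p} \<noteq> {}" "finite {..<p}"
proof -
  have "0 \<in> {..<p}" using p2 by simp
  then show "{..<p} \<noteq> {}" by blast
qed simp

lemma prob_bernoulli: "prob_space bernoulli"
  unfolding bernoulli_def by (rule prob_space.prob_space_stream_space[OF measure_pmf.prob_space_axioms])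

lemma space_bernoulli [simp]: "space bernoulli = UNIV"
  by (simp add: bernoulli_def space_stream_space)

lemma sets_bernoulli: "sets bernoulli = sets (stream_space (count_space UNIV))"
  unfolding bernoulli_def by (rule sets_stream_space_cong) simp

lemma measurable_snth_bernoulli [measurable]: "(\<lambda>\<omega>. \<omega> !! n) \<in> measurable bernoulli (count_space UNIV)"
  unfolding measurable_cong_sets[OF sets_bernoulli refl] by measurable

lemma measurable_stl_bernoulli: "stl \<in> measurable bernoulli bernoulli"
  unfolding bernoulli_def using measurable_stl by simp

lemma emeasure_stl_vimage:
  assumes "A \<in> sets bernoulli"
  shows "emeasure bernoulli (stl -` A) = emeasure bernoulli A"
proof -
  have "stl -` A \<in> sets bernoulli" using measurable_sets[OF measurable_stl_bernoulli assms] by simp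
  then have "emeasure bernoulli (stl -` A) = (\<integral>\<^sup>+t. emeasure bernoulli {x. t ## x \<in> stl -` A} \<partial>symbol_pmf)"
    using prob_space.emeasure_stream_space[OF measure_pmf.prob_space_axioms, of "stl -` A"]
    by (simp add: bernoulli_def space_stream_space)
  then show ?thesis by simp
qed

lemma cylinder_sets: "{\<omega>. \<forall>k<m. \<omega> !! k \<in> B k} \<in> sets bernoulli"
proof -
  have "{\<omega> \<in> space bernoulli. \<forall>k<m. \<omega> !! k \<in> B k} \<in> sets bernoulli" by measurable
  then show ?thesis by simp
qed

lemma emeasure_cylinder:
  "emeasure bernoulli {\<omega>. \<forall>k<m. \<omega> !! k \<in> B k} = (\<Prod>k<m. emeasure symbol_pmf (B k))"
proof (induction m arbitrary: B)
  case 0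
  then show ?case using prob_space.emeasure_space_1[OF prob_bernoulli] by simp
next
  case (Suc m)
  let ?C = "{\<omega>. \<forall>k<m. \<omega> !! k \<in> B (Suc k)}"
  have eq: "{x. t ## x \<in> {\<omega>. \<forall>k<Suc m. \<omega> !! k \<in> B k}} = (if t \<in> B 0 then ?C else {})" for t
    by (auto simp: less_Suc_eq_0_disj)
  have "emeasure bernoulli {\<omega>. \<forall>k<Suc m. \<omega> !! k \<in> B k} =
      (\<integral>\<^sup>+t. emeasure bernoulli {x. t ## x \<in> {\<omega>. \<forall>k<Suc m. \<omega> !! k \<in> B k}} \<partial>symbol_pmf)"
    using prob_space.emeasure_stream_space[OF measure_pmf.prob_space_axioms, of "{\<omega>. \<forall>k<Suc m. \<omega> !! k \<in> B k}"] cylinder_sets[of "Suc m" B]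
    by (simp add: bernoulli_def space_stream_space)
  also have "\<dots> = (\<integral>\<^sup>+t. emeasure bernoulli ?C * indicator (B 0) t \<partial>symbol_pmf)"
    unfolding eq by (intro nn_integral_cong) (auto simp: indicator_def)
  also have "\<dots> = emeasure bernoulli ?C * emeasure symbol_pmf (B 0)"
    by (simp add: nn_integral_cmult_indicator)
  also have "\<dots> = (\<Prod>k<Suc m. emeasure symbol_pmf (B k))"
    unfolding Suc[of "\<lambda>k. B (Suc k)"] prod.lessThan_Suc_shift by (simp add: mult.commute)
  finally show ?case .
qed

lemma symbol_measure_le:
  assumes "\<And>i j. i \<in> B \<Longrightarrow> j \<in> B \<Longrightarrow> i < p \<Longrightarrow> j < p \<Longrightarrow> i = j"
  shows "emeasure symbol_pmf B \<le> ennreal (1 / real p)"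
proof -
  have "card ({..<p} \<inter> B) \<le> 1"
    using assms by (subst card_le_Suc0_iff_eq[unfolded One_nat_def[symmetric]]) auto
  then show ?thesis
    unfolding symbol_pmf_def emeasure_pmf_of_set[OF p_set]
    using p2 by (intro ennreal_leI) (simp add: divide_right_mono)
qed

abbreviation J where "J \<equiv> julia_set f"
abbreviation RJ where "RJ \<equiv> restrict_space (borel :: riemann_sphere measure) (julia_set f)"

lemma coding_measurable: "coding \<in> measurable bernoulli RJ"
proof (rule measurable_restrict_space2)
  show "coding \<in> space bernoulli \<rightarrow> J" using coding_in_julia by auto
  show "coding \<in> measurable bernoulli borel"
  proof (rule borel_measurable_LIMSEQ_metric)
    fix n
    have "stake n \<in> measurable bernoulli (count_space UNIV)"
      unfolding measurable_cong_sets[OF sets_bernoulli refl] by measurable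
    then show "(\<lambda>\<omega>. foldr G (stake n \<omega>) base_point) \<in> measurable bernoulli borel"
      by (rule measurable_compose) simp
  qed (rule coding_tendsto_base)
qed

text \<open>The assumption expresses that \<open>f\<close> maps the Julia set into itself. For the
  map of the theorem it is read off from \<open>\<mu>\<close>, since \<open>invariant_prob\<close>
  contains it.\<close>

context
  assumes fm: "f \<in> measurable (restrict_space borel (julia_set f)) (restrict_space borel (julia_set f))"
begin

lemma iterate_coding_measurable: "(\<lambda>\<omega>. (f ^^ j) (coding \<omega>)) \<in> measurable bernoulli RJ"
  by (rule measurable_compose[OF coding_measurable funpow_measurable[OF fm]])

definition phase_space :: "(nat \<times> nat stream) measure" where
  "phase_space = measure_pmf (pmf_of_set {..<N}) \<Otimes>\<^sub>M bernoulli"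

text \<open>The image of the Bernoulli measure under \<open>coding\<close> is invariant only under
  \<open>f ^^ N\<close>; the uniformly distributed phase \<open>j\<close> averages its images under
  the first \<open>N\<close> iterates.\<close>

definition horseshoe :: "riemann_sphere measure" where
  "horseshoe = distr phase_space RJ (\<lambda>(j, \<omega>). (f ^^ j) (coding \<omega>))"

lemma N_set: "{..<N} \<noteq> {}" "finite {..<N}"
proof -
  have "0 \<in> {..<N}" using N0 by simp
  then show "{..<N} \<noteq> {}" by blast
qed simp

lemma phase_map_measurable: "(\<lambda>(j, \<omega>). (f ^^ j) (coding \<omega>)) \<in> measurable phase_space RJ"
proof -
  have "sets phase_space = sets (count_space UNIV \<Otimes>\<^sub>M bernoulli)"
    unfolding phase_space_def by (rule sets_pair_measure_cong) simp_all
  then show ?thesis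
    by (subst measurable_cong_sets[OF _ refl], assumption)
       (intro measurable_pair_measure_countable1, simp_all add: iterate_coding_measurable)
qed

lemma prob_phase: "prob_space phase_space"
proof -
  interpret B: prob_space bernoulli by (rule prob_bernoulli)
  interpret pair_prob_space "measure_pmf (pmf_of_set {..<N})" bernoulli ..
  show ?thesis unfolding phase_space_def by (rule prob_space_axioms)
qed

lemma prob_horseshoe: "prob_space horseshoe"
  unfolding horseshoe_def by (rule prob_space.prob_space_distr[OF prob_phase phase_map_measurable])

lemma sets_horseshoe: "sets horseshoe = sets RJ" "space horseshoe = J"
  by (simp_all add: horseshoe_def space_restrict_space)

lemma phase_sets: "A \<in> sets RJ \<Longrightarrow> {\<omega>. (f ^^ j) (coding \<omega>) \<in> A} \<in> sets bernoulli"
  using measurable_sets[OF iterate_coding_measurable, of A j] by (simp add: vimage_def)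

lemma emeasure_horseshoe:
  assumes "A \<in> sets RJ"
  shows "emeasure horseshoe A = (\<Sum>j<N. emeasure bernoulli {\<omega>. (f ^^ j) (coding \<omega>) \<in> A}) / of_nat N"
proof -
  interpret B: prob_space bernoulli by (rule prob_bernoulli)
  let ?F = "\<lambda>(j, \<omega>). (f ^^ j) (coding \<omega>)"
  have m: "?F -` A \<inter> space phase_space \<in> sets (measure_pmf (pmf_of_set {..<N}) \<Otimes>\<^sub>M bernoulli)"
    using measurable_sets[OF phase_map_measurable assms] by (simp add: phase_space_def)
  have sp: "space phase_space = UNIV" by (simp add: phase_space_def space_pair_measure)
  have "emeasure horseshoe A = emeasure phase_space (?F -` A \<inter> space phase_space)"
    unfolding horseshoe_def using assms by (intro emeasure_distr phase_map_measurable)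
  also have "\<dots> = (\<integral>\<^sup>+j. emeasure bernoulli (Pair j -` (?F -` A \<inter> space phase_space)) \<partial>measure_pmf (pmf_of_set {..<N}))"
    unfolding phase_space_def using m[unfolded phase_space_def] by (intro B.emeasure_pair_measure_alt)
  also have "\<dots> = (\<Sum>j<N. emeasure bernoulli {\<omega>. (f ^^ j) (coding \<omega>) \<in> A}) / of_nat N"
    unfolding nn_integral_pmf_of_set[OF N_set] sp by (simp add: vimage_def ennreal_of_nat_eq_real_of_nat)
  finally show ?thesis .
qed

text \<open>Applying \<open>f\<close> advances the phase by one. Phase \<open>N\<close> is phase 0
  of the shifted stream, and the Bernoulli measure is shift invariant.\<close>

lemma invariant_horseshoe: "invariant_prob f horseshoe"
  unfolding invariant_prob_def
proof (intro conjI)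
  show fmh: "f \<in> measurable horseshoe horseshoe"
    using fm unfolding measurable_cong_sets[OF sets_horseshoe(1) sets_horseshoe(1)] .
  show "distr horseshoe horseshoe f = horseshoe"
  proof (rule measure_eqI)
    fix A assume "A \<in> sets (distr horseshoe horseshoe f)"
    then have A: "A \<in> sets RJ" by (simp add: sets_horseshoe)
    define E where "E j = emeasure bernoulli {\<omega>. (f ^^ j) (coding \<omega>) \<in> A}" for j
    have fA: "f -` A \<inter> J \<in> sets RJ"
      using measurable_sets[OF fm A] by (simp add: space_restrict_space)
    have J: "(f ^^ j) (coding \<omega>) \<in> J" for j \<omega>
      using measurable_space[OF iterate_coding_measurable, of \<omega> j] by (simp add: space_restrict_space)
    have "emeasure (distr horseshoe horseshoe f) A = emeasure horseshoe (f -` A \<inter> J)"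
      using A by (subst emeasure_distr[OF fmh]) (simp_all add: sets_horseshoe)
    also have "\<dots> = (\<Sum>j<N. E (Suc j)) / of_nat N"
      unfolding emeasure_horseshoe[OF fA] E_def using J by simp
    also have "(\<Sum>j<N. E (Suc j)) = (\<Sum>j<N. E j)"
    proof -
      have "{\<omega>. (f ^^ N) (coding \<omega>) \<in> A} = stl -` {\<omega>. (f ^^ 0) (coding \<omega>) \<in> A}"
        using funpow_coding[of 1] by auto
      then have "E N = E 0"
        unfolding E_def using emeasure_stl_vimage[OF phase_sets[OF A, of 0]] by simp
      obtain M where M: "N = Suc M" using N0 by (cases N) auto
      have "(\<Sum>j<N. E (Suc j)) = (\<Sum>j<M. E (Suc j)) + E 0"
        using \<open>E N = E 0\<close> by (simp add: M)
      also have "\<dots> = (\<Sum>j<N. E j)"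
        unfolding M sum.lessThan_Suc_shift by (simp add: add.commute)
      finally show ?thesis .
    qed
    finally show "emeasure (distr horseshoe horseshoe f) A = emeasure horseshoe A"
      unfolding emeasure_horseshoe[OF A] E_def .
  qed simp
qed (simp_all add: prob_horseshoe sets_horseshoe)

text \<open>Averaging over the phases turns the integral into the mean of
  \<open>birkhoff_sum f g N\<close> at coded points, divided by \<open>N\<close>. By
  \<open>coding_stl\<close> a coded point is some \<open>G i x\<close> with \<open>x\<close> in
  \<open>X\<close>, where the block bound applies.\<close>

lemma integral_horseshoe_ge:
  assumes g: "g \<in> borel_measurable RJ" and bd: "\<And>x. x \<in> J \<Longrightarrow> \<bar>g x\<bar> \<le> B"
    and low: "\<And>i x. x \<in> X \<Longrightarrow> x \<in> J \<Longrightarrow> G i x \<in> J \<Longrightarrow> \<beta> \<le> birkhoff_sum f g N (G i x)"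
  shows "\<beta> / real N \<le> (\<integral>x. g x \<partial>horseshoe)"
proof -
  interpret B: prob_space bernoulli by (rule prob_bernoulli)
  interpret P: pair_prob_space "measure_pmf (pmf_of_set {..<N})" bernoulli ..
  interpret PH: prob_space phase_space by (rule prob_phase)
  have J: "(f ^^ j) (coding \<omega>) \<in> J" for j \<omega>
    using measurable_space[OF iterate_coding_measurable, of \<omega> j] by (simp add: space_restrict_space)
  have gm: "(\<lambda>\<omega>. g ((f ^^ j) (coding \<omega>))) \<in> borel_measurable bernoulli" for j
    by (rule measurable_compose[OF iterate_coding_measurable g])
  have gi: "integrable bernoulli (\<lambda>\<omega>. g ((f ^^ j) (coding \<omega>)))" for j
    by (rule B.integrable_const_bound[of _ B]) (use gm bd J in auto)
  have gp: "(\<lambda>z. g (case z of (j, \<omega>) \<Rightarrow> (f ^^ j) (coding \<omega>))) \<in> borel_measurable phase_space"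
    by (rule measurable_compose[OF phase_map_measurable g])
  have ip: "integrable phase_space (\<lambda>z. g (case z of (j, \<omega>) \<Rightarrow> (f ^^ j) (coding \<omega>)))"
    by (rule PH.integrable_const_bound[of _ B]) (use gp bd J in \<open>auto split: prod.splits\<close>)
  have "(\<integral>x. g x \<partial>horseshoe) = (\<integral>z. g (case z of (j, \<omega>) \<Rightarrow> (f ^^ j) (coding \<omega>)) \<partial>phase_space)"
    unfolding horseshoe_def using g by (intro integral_distr phase_map_measurable)
  also have "\<dots> = (\<integral>j. (\<integral>\<omega>. g ((f ^^ j) (coding \<omega>)) \<partial>bernoulli) \<partial>measure_pmf (pmf_of_set {..<N}))"
    using P.integral_fst'[of "\<lambda>z. g (case z of (j, \<omega>) \<Rightarrow> (f ^^ j) (coding \<omega>))"] ip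
    by (simp add: phase_space_def)
  also have "\<dots> = (\<Sum>j<N. \<integral>\<omega>. g ((f ^^ j) (coding \<omega>)) \<partial>bernoulli) / real N"
    using integral_pmf_of_set[OF N_set] by simp
  also have "(\<Sum>j<N. \<integral>\<omega>. g ((f ^^ j) (coding \<omega>)) \<partial>bernoulli) = (\<integral>\<omega>. birkhoff_sum f g N (coding \<omega>) \<partial>bernoulli)"
    unfolding birkhoff_sum_def using gi by (simp add: Bochner_Integration.integral_sum)
  finally have eq: "(\<integral>x. g x \<partial>horseshoe) = (\<integral>\<omega>. birkhoff_sum f g N (coding \<omega>) \<partial>bernoulli) / real N" .
  have "\<beta> \<le> birkhoff_sum f g N (coding \<omega>)" for \<omega>
    using low[of "coding (stl \<omega>)" "shd \<omega>"] coding_in_X coding_in_julia[of \<omega>] coding_in_julia[of "stl \<omega>"]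
      coding_stl[of \<omega>] by simp
  moreover have "integrable bernoulli (\<lambda>\<omega>. birkhoff_sum f g N (coding \<omega>))"
    unfolding birkhoff_sum_def by (intro Bochner_Integration.integrable_sum gi)
  ultimately have "(\<integral>\<omega>. \<beta> \<partial>bernoulli) \<le> (\<integral>\<omega>. birkhoff_sum f g N (coding \<omega>) \<partial>bernoulli)"
    by (intro integral_mono) auto
  then have "\<beta> \<le> (\<integral>\<omega>. birkhoff_sum f g N (coding \<omega>) \<partial>bernoulli)" using B.prob_space by simp
  then show ?thesis unfolding eq by (rule divide_right_mono) simp
qed

text \<open>The complement of the branch images is one more cell, which makes this a partition of
  the whole Julia set; the empty set is removed because \<open>partition_on\<close> does not admit
  it.\<close>

definition cells :: "riemann_sphere set set" where
  "cells = insert (J - (\<Union>i<p. G i ` X)) ((\<lambda>i. G i ` X \<inter> J) ` {..<p}) - {{}}"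

lemma Union_Diff_empty: "\<Union>(A - {{}}) = \<Union>A"
  by auto

lemma branch_closed: "closed (G i ` X)"
proof -
  have "continuous_on X (G i)"
    unfolding continuous_on_iff
  proof (intro ballI allI impI)
    fix x and \<epsilon> :: real assume x: "x \<in> X" and e: "\<epsilon> > 0"
    have "dist (G i y) (G i x) < \<epsilon>" if "y \<in> X" "dist y x < \<epsilon>" for y
    proof -
      have "lam * dist y x \<le> 1 * dist y x" using lam by (intro mult_right_mono) auto
      then show ?thesis using lip[OF that(1) x, of i] that(2) by linarith
    qed
    then show "\<exists>d>0. \<forall>x'\<in>X. dist x' x < d \<longrightarrow> dist (G i x') (G i x) < \<epsilon>"
      using e by blast
  qed
  then show ?thesis by (intro compact_imp_closed compact_continuous_image X(1))
qed

lemma cells_partition: "finite_measurable_partition horseshoe cells"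
  unfolding finite_measurable_partition_def
proof (intro conjI)
  show "finite cells" by (simp add: cells_def)
  show "cells \<subseteq> sets horseshoe"
    unfolding sets_horseshoe
  proof
    fix C assume "C \<in> cells"
    then consider "C = J - (\<Union>i<p. G i ` X)" | i where "C = G i ` X \<inter> J"
      unfolding cells_def by blast
    then have "\<exists>A\<in>sets borel. C = J \<inter> A"
    proof cases
      case 1
      have "- (\<Union>i<p. G i ` X) \<in> sets borel"
        by (intro borel_comp sets.finite_UN borel_closed[OF branch_closed]) simp
      then show ?thesis using 1 by (intro bexI[of _ "- (\<Union>i<p. G i ` X)"]) (simp_all only: Diff_eq)
    next
      case 2
      then show ?thesis
        by (intro bexI[of _ "G i ` X"] borel_closed[OF branch_closed]) (simp only: Int_commute)
    qed
    then show "C \<in> sets RJ" unfolding sets_restrict_space by blast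
  qed
  show "partition_on (space horseshoe) cells"
    unfolding sets_horseshoe(2)
  proof (rule partition_onI)
    have "\<Union>cells = \<Union>(insert (J - (\<Union>i<p. G i ` X)) ((\<lambda>i. G i ` X \<inter> J) ` {..<p}))"
      unfolding cells_def by (simp only: Union_Diff_empty)
    also have "\<dots> = (J - (\<Union>i<p. G i ` X)) \<union> (\<Union>i<p. G i ` X) \<inter> J"
      by (simp only: Union_insert UN_simps)
    also have "\<dots> = J" by blast
    finally show "\<Union>cells = J" .
    fix A B assume AB: "A \<in> cells" "B \<in> cells" "A \<noteq> B"
    have "A = B" if x: "x \<in> A" "x \<in> B" for x
    proof (cases "\<exists>i<p. x \<in> G i ` X")
      case False
      have "C = J - (\<Union>i<p. G i ` X)" if C: "C \<in> cells" "x \<in> C" for C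
        using C False by (auto simp: cells_def)
      from this[OF AB(1) x(1)] this[OF AB(2) x(2)] show ?thesis by simp
    next
      case True
      then obtain i where i: "i < p" "x \<in> G i ` X" by blast
      have "C = G i ` X \<inter> J" if C: "C \<in> cells" "x \<in> C" for C
      proof -
        have "C \<noteq> J - (\<Union>i<p. G i ` X)" using C(2) i(1,2) by auto
        then obtain e where e: "e < p" "C = G e ` X \<inter> J" using C(1) unfolding cells_def by blast
        obtain y where y: "y \<in> X" "x = G e y" using e(2) C(2) by blast
        obtain z where z: "z \<in> X" "x = G i z" using i(2) by blast
        have "e = i" using disj[OF e(1) i(1) _ y(1) z(1)] y(2) z(2) by metis
        then show ?thesis using e(2) by simp
      qed
      from this[OF AB(1) x(1)] this[OF AB(2) x(2)] show ?thesis by simp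
    qed
    then show "disjnt A B" using AB(3) unfolding disjnt_iff by blast
  qed (auto simp: cells_def)
qed

lemma prod_mono_ennreal:
  fixes a b :: "nat \<Rightarrow> ennreal"
  assumes "\<And>k. k < m \<Longrightarrow> a k \<le> b k"
  shows "(\<Prod>k<m. a k) \<le> (\<Prod>k<m. b k)"
  using assms by (induction m) (auto intro!: mult_mono)

text \<open>Seen from phase \<open>j\<close>, the itinerary names the cell of the coded point at the
  times \<open>N * k - j\<close>. By disjointness each such cell admits at most one symbol below
  \<open>p\<close>, so the symbols 1 to \<open>m\<close> each contribute a factor
  \<open>1 / p\<close>.\<close>

lemma horseshoe_itinerary_small:
  assumes xs: "xs \<in> words cells n" and m: "m = 0 \<or> N * (m + 1) \<le> n"
  shows "measure horseshoe (itinerary_set horseshoe f xs) \<le> (1 / real p) ^ m"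
proof -
  interpret prob_space horseshoe by (rule prob_horseshoe)
  have A: "itinerary_set horseshoe f xs \<in> sets RJ"
    using itinerary_set_measurable[OF prob_horseshoe _ _ cells_partition, of f xs] invariant_horseshoe xs
    unfolding invariant_prob_def sets_horseshoe(1) words_def by auto
  have E: "emeasure bernoulli {\<omega>. (f ^^ j) (coding \<omega>) \<in> itinerary_set horseshoe f xs} \<le> ennreal ((1 / real p) ^ m)"
    if j: "j < N" for j
  proof -
    \<comment> \<open>Symbol 0 belongs to the block that has already begun at phase
      \<open>j\<close>, so it is left free for every \<open>j\<close>.\<close>
    define B where "B k = (if k = 0 then UNIV else {i. \<exists>y\<in>X. G i y \<in> xs ! (N * k - j)})" for k
    have idx: "N * k - j < n" "j + (N * k - j) = N * k" if "0 < k" "k < Suc m" for k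
    proof -
      have "N * k \<le> N * m" "N * 1 \<le> N * k" using that by (simp_all only: mult_le_mono2 less_Suc_eq_le Suc_le_eq One_nat_def)
      moreover have "N * m + N \<le> n" using m that by auto
      ultimately show "N * k - j < n" "j + (N * k - j) = N * k" using j N0 by linarith+
    qed
    have sub: "{\<omega>. (f ^^ j) (coding \<omega>) \<in> itinerary_set horseshoe f xs} \<subseteq> {\<omega>. \<forall>k<Suc m. \<omega> !! k \<in> B k}"
    proof (intro subsetI CollectI allI impI)
      fix \<omega> k assume \<omega>: "\<omega> \<in> {\<omega>. (f ^^ j) (coding \<omega>) \<in> itinerary_set horseshoe f xs}" and k: "k < Suc m"
      show "\<omega> !! k \<in> B k"
      proof (cases "k = 0")
        case False
        then have i: "N * k - j < n" "j + (N * k - j) = N * k" using idx k by auto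
        have "length xs = n" using xs by (simp add: words_def)
        then have "(f ^^ (N * k - j)) ((f ^^ j) (coding \<omega>)) \<in> xs ! (N * k - j)"
          using \<omega> i(1) by (simp add: itinerary_set_def)
        then have "(f ^^ (N * k)) (coding \<omega>) \<in> xs ! (N * k - j)"
          using i(2) by (metis add.commute funpow_add o_apply)
        then have "G (shd (sdrop k \<omega>)) (coding (stl (sdrop k \<omega>))) \<in> xs ! (N * k - j)"
          unfolding funpow_coding by (subst (asm) coding_stl)
        then show ?thesis using False coding_in_X by (auto simp: B_def)
      qed (simp add: B_def)
    qed
    have small: "emeasure symbol_pmf (B (Suc k)) \<le> ennreal (1 / real p)" if "k < m" for k
    proof (rule symbol_measure_le)
      fix a b assume ab: "a \<in> B (Suc k)" "b \<in> B (Suc k)" "a < p" "b < p"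
      define C where "C = xs ! (N * Suc k - j)"
      have "N * Suc k - j < length xs" using idx[of "Suc k"] that xs by (simp add: words_def)
      then have C: "C \<in> cells" unfolding C_def using xs nth_mem unfolding words_def by blast
      obtain y z where yz: "y \<in> X" "G a y \<in> C" "z \<in> X" "G b z \<in> C"
        using ab by (auto simp: B_def C_def)
      have "C \<noteq> J - (\<Union>i<p. G i ` X)" using yz ab by auto
      then obtain e where e: "e < p" "C = G e ` X \<inter> J" using C by (auto simp: cells_def)
      obtain y' where "y' \<in> X" "G a y = G e y'" using yz(2) e(2) by blast
      then have "a = e" using disj[OF ab(3) e(1) _ yz(1), of y'] by metis
      moreover obtain z' where "z' \<in> X" "G b z = G e z'" using yz(4) e(2) by blast
      then have "b = e" using disj[OF ab(4) e(1) _ yz(3), of z'] by metis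
      ultimately have "a = e" "b = e" by simp_all
      then show "a = b" by simp
    qed
    have "emeasure bernoulli {\<omega>. (f ^^ j) (coding \<omega>) \<in> itinerary_set horseshoe f xs} \<le>
      emeasure bernoulli {\<omega>. \<forall>k<Suc m. \<omega> !! k \<in> B k}"
      by (rule emeasure_mono[OF sub cylinder_sets])
    also have "\<dots> = (\<Prod>k<m. emeasure symbol_pmf (B (Suc k))) * emeasure symbol_pmf (B 0)"
      unfolding emeasure_cylinder prod.lessThan_Suc_shift by (simp add: mult.commute)
    also have "\<dots> \<le> (\<Prod>k<m. ennreal (1 / real p)) * 1"
      by (intro mult_mono prod_mono_ennreal measure_pmf.emeasure_le_1) (simp_all add: small)
    also have "\<dots> = ennreal ((1 / real p) ^ m)" by (simp add: ennreal_power)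
    finally show ?thesis .
  qed
  have "emeasure horseshoe (itinerary_set horseshoe f xs) \<le> (\<Sum>j<N. ennreal ((1 / real p) ^ m)) / of_nat N"
    unfolding emeasure_horseshoe[OF A] by (intro divide_right_mono_ennreal sum_mono E) simp
  also have "\<dots> = ennreal ((1 / real p) ^ m)"
    using N0 by (simp add: ennreal_of_nat_eq_real_of_nat divide_ennreal flip: ennreal_mult)
  finally show ?thesis by (simp add: emeasure_eq_measure)
qed

lemma entropy_horseshoe: "measure_entropy horseshoe f \<ge> ereal (ln p / N)"
proof -
  have inv: "f \<in> measurable horseshoe horseshoe" "distr horseshoe horseshoe f = horseshoe"
    using invariant_horseshoe unfolding invariant_prob_def by auto
  have *: "N * (n div N - 1 + 1) \<le> n" if "n div N - 1 \<noteq> 0" for n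
  proof -
    have "n div N - 1 + 1 = n div N" using that by linarith
    then show ?thesis using times_div_less_eq_dividend[of N n] by (simp only:)
  qed
  have "measure horseshoe (itinerary_set horseshoe f xs) \<le> (1 / real p) ^ (n div N - 1)"
    if "xs \<in> words cells n" for n xs
    by (rule horseshoe_itinerary_small[OF that]) (use * in blast)
  then have "1 / real N * ln (real p) \<le> entropy_wrt horseshoe f cells"
    by (intro entropy_wrt_ge[OF prob_horseshoe inv cells_partition _ LIMSEQ_div_over[OF N0]])
       (use p2 in auto)
  then have "ereal (ln p / N) \<le> ereal (entropy_wrt horseshoe f cells)" by simp
  also have "\<dots> \<le> measure_entropy horseshoe f"
    unfolding measure_entropy_def by (rule SUP_upper) (simp add: cells_partition)
  finally show ?thesis .
qed

end

end

text \<open>Words of the same length and the same total time are separated, and by pigeonhole there are many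
  of them.\<close>

locale free_branches =
  fixes f :: "riemann_sphere \<Rightarrow> riemann_sphere" and g :: "nat \<Rightarrow> riemann_sphere \<Rightarrow> riemann_sphere"
    and X :: "riemann_sphere set" and I :: "nat set" and T :: "nat \<Rightarrow> nat" and lam :: real
  assumes cont: "\<And>x. isCont f x"
    and X: "compact X" "X \<noteq> {}"
    and I: "finite I"
    and gX: "\<And>i x. i \<in> I \<Longrightarrow> x \<in> X \<Longrightarrow> g i x \<in> X"
    and fg: "\<And>i x. i \<in> I \<Longrightarrow> x \<in> X \<Longrightarrow> (f ^^ T i) (g i x) = x"
    and T0: "\<And>i. i \<in> I \<Longrightarrow> T i > 0" and T_inj: "inj_on T I"
    and lip: "\<And>i x y. i \<in> I \<Longrightarrow> x \<in> X \<Longrightarrow> y \<in> X \<Longrightarrow> dist (g i x) (g i y) \<le> lam * dist x y"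
    and lam: "0 < lam" "lam < 1"
    and sep: "\<And>i l x. i \<in> I \<Longrightarrow> l \<in> I \<Longrightarrow> T i < T l \<Longrightarrow> x \<in> X \<Longrightarrow> (f ^^ (T l - T i)) (g l x) \<notin> X"
    and fm: "f \<in> measurable (restrict_space borel (julia_set f)) (restrict_space borel (julia_set f))"
begin

definition tot :: "nat list \<Rightarrow> nat" where "tot w = sum_list (map T w)"

lemma tot_simps [simp]: "tot [] = 0" "tot (i # w) = T i + tot w" "tot (u @ v) = tot u + tot v"
  by (simp_all add: tot_def)

lemma word_X: "set w \<subseteq> I \<Longrightarrow> x \<in> X \<Longrightarrow> foldr g w x \<in> X"
  by (induction w) (auto intro: gX)

lemma funpow_tot: "set w \<subseteq> I \<Longrightarrow> x \<in> X \<Longrightarrow> (f ^^ tot w) (foldr g w x) = x"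
proof (induction w)
  case (Cons i w)
  then have "(f ^^ T i) (g i (foldr g w x)) = foldr g w x" by (intro fg word_X) auto
  moreover have "tot (i # w) = tot w + T i" by simp
  ultimately show ?case using Cons by (simp only: funpow_add o_apply foldr.simps) simp
qed simp

lemma word_lip:
  assumes "set w \<subseteq> I" "x \<in> X" "y \<in> X"
  shows "dist (foldr g w x) (foldr g w y) \<le> lam ^ length w * dist x y"
  using assms(1)
proof (induction w)
  case (Cons i w)
  have "dist (g i (foldr g w x)) (g i (foldr g w y)) \<le> lam * dist (foldr g w x) (foldr g w y)"
    using Cons assms by (intro lip word_X) auto
  also have "\<dots> \<le> lam * (lam ^ length w * dist x y)"
    using lam Cons by (intro mult_left_mono) auto
  finally show ?case by (simp add: mult.assoc)
qed simp

text \<open>After \<open>tot u\<close> steps the common point has become \<open>g i x\<close>, which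
  lies in \<open>X\<close>. Followed along the other word it has become
  \<open>(f ^^ (T l - T i)) (g l x)\<close>, which by \<open>sep\<close> does not.\<close>

lemma words_separated_aux:
  assumes "set u \<subseteq> I" "set v \<subseteq> I" "i \<in> I" "l \<in> I" "x \<in> X" "T i < T l" "tot u + T i = tot v + T l"
  shows "foldr g (u @ [i]) x \<noteq> foldr g (v @ [l]) x"
proof
  assume eq: "foldr g (u @ [i]) x = foldr g (v @ [l]) x"
  have "(f ^^ tot u) (foldr g u (g i x)) = g i x" using assms by (intro funpow_tot gX)
  moreover have "tot u = (T l - T i) + tot v" using assms by simp
  ultimately have "(f ^^ (T l - T i)) ((f ^^ tot v) (foldr g v (g l x))) = g i x"
    using eq by (simp add: funpow_add)
  moreover have "(f ^^ tot v) (foldr g v (g l x)) = g l x" using assms by (intro funpow_tot gX)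
  ultimately have "(f ^^ (T l - T i)) (g l x) = g i x" by simp
  moreover have "g i x \<in> X" using assms by (intro gX)
  ultimately show False using sep[OF assms(3,4,6,5)] by simp
qed

text \<open>Words are compared from the last letter. Equal totals force equal return times of the
  last letters, hence equal letters, which can then be peeled off.\<close>

lemma words_separated:
  assumes "set u \<subseteq> I" "set v \<subseteq> I" "x \<in> X" "length u = length v" "tot u = tot v"
    "foldr g u x = foldr g v x"
  shows "u = v"
  using assms
proof (induction u arbitrary: v x rule: rev_induct)
  case (snoc i u)
  then obtain w l where v: "v = w @ [l]" by (cases v rule: rev_cases) auto
  have "\<not> T i < T l" using words_separated_aux[of u w i l x] snoc.prems unfolding v by auto
  moreover have "\<not> T l < T i" using words_separated_aux[of w u l i x] snoc.prems unfolding v by auto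
  ultimately have il: "i = l" using T_inj snoc.prems unfolding v by (auto dest: inj_onD)
  have "u = w"
    by (rule snoc.IH[of w "g i x"]) (use snoc.prems il gX in \<open>auto simp: v\<close>)
  then show ?case using il v by simp
qed simp

lemma funpow_julia: "x \<in> julia_set f \<Longrightarrow> (f ^^ n) x \<in> julia_set f"
  using measurable_space[OF funpow_measurable[OF fm], of x n] by (simp add: space_restrict_space)

lemma birkhoff_word:
  assumes low: "\<And>i x. i \<in> I \<Longrightarrow> x \<in> X \<Longrightarrow> x \<in> julia_set f \<Longrightarrow> g i x \<in> julia_set f \<Longrightarrow>
      real (T i) * P0 - C \<le> birkhoff_sum f \<psi> (T i) (g i x)"
    and w: "set w \<subseteq> I" "x \<in> X" "foldr g w x \<in> julia_set f"
  shows "real (tot w) * P0 - real (length w) * C \<le> birkhoff_sum f \<psi> (tot w) (foldr g w x)"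
  using w(1,3)
proof (induction w)
  case (Cons i w)
  let ?y = "foldr g w x"
  have y: "?y \<in> X" "i \<in> I" using Cons w by (auto intro: word_X)
  have f: "(f ^^ T i) (g i ?y) = ?y" using y by (intro fg)
  then have J: "?y \<in> julia_set f" using funpow_julia[of "g i ?y" "T i"] Cons by simp
  have "real (T i) * P0 - C \<le> birkhoff_sum f \<psi> (T i) (g i ?y)"
    using y J Cons by (intro low) auto
  moreover have "real (tot w) * P0 - real (length w) * C \<le> birkhoff_sum f \<psi> (tot w) ?y"
    using Cons J by auto
  ultimately show ?case by (simp add: birkhoff_sum_add f algebra_simps)
qed simp

text \<open>The \<open>M ^ r\<close> words of length \<open>r\<close> have at most
  \<open>r * Tm + 1\<close> totals, so some total \<open>N\<close> is shared by at least
  \<open>M ^ r / (r * Tm + 1)\<close> of them. They contribute \<open>ln p / N\<close> to the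
  entropy and lose at most \<open>r * C / N\<close> in the integral. As \<open>ln M > C\<close>, the
  linear gain beats the logarithm of the number of totals for large \<open>r\<close>.\<close>

theorem large_pressure:
  assumes \<psi>: "\<psi> \<in> borel_measurable (restrict_space borel (julia_set f))"
      "\<And>x. x \<in> julia_set f \<Longrightarrow> \<bar>\<psi> x\<bar> \<le> B"
    and low: "\<And>i x. i \<in> I \<Longrightarrow> x \<in> X \<Longrightarrow> x \<in> julia_set f \<Longrightarrow> g i x \<in> julia_set f \<Longrightarrow>
      real (T i) * P0 - C \<le> birkhoff_sum f \<psi> (T i) (g i x)"
    and C: "C \<ge> 0" and card: "real (card I) > exp C"
  shows "\<exists>\<nu> h. invariant_prob f \<nu> \<and> measure_entropy \<nu> f \<ge> ereal h \<and> h + (\<integral>x. \<psi> x \<partial>\<nu>) > P0"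
proof -
  define M where "M = card I"
  have M: "real M > exp C" using card by (simp add: M_def)
  have M0: "real M > 0" by (rule less_trans[OF exp_gt_zero M])
  have lnM: "ln (real M) > C" using M M0 by (subst exp_less_cancel_iff[symmetric]) simp
  \<comment> \<open>The successor makes \<open>Tm\<close> positive, as the limit below
    requires.\<close>
  define Tm where "Tm = Suc (Max (T ` I))"
  have Tm: "T i \<le> Tm" if "i \<in> I" for i
    unfolding Tm_def using that I by (intro le_SucI Max_ge) auto
  have "(\<lambda>r. ln (real r * c + 1) / real r) \<longlonglongrightarrow> 0" if "c > 0" for c :: real
    using that by real_asymp
  then have lim: "(\<lambda>r. ln (real r * real Tm + 1) / real r) \<longlonglongrightarrow> 0"
    by (simp add: Tm_def)
  have "ln (real M) - C > 0" using lnM by simp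
  from LIMSEQ_D[OF lim this] obtain r0
    where r0: "\<And>r. r \<ge> r0 \<Longrightarrow> \<bar>ln (real r * real Tm + 1) / real r\<bar> < ln (real M) - C"
    unfolding real_norm_def diff_0_right by blast
  define r where "r = Suc r0"
  have r: "ln (real r * real Tm + 1) < real r * (ln M - C)"
  proof -
    have "ln (real r * real Tm + 1) / real r < ln M - C" using r0[of r] by (simp add: r_def)
    moreover have "real r > 0" by (simp add: r_def)
    ultimately show ?thesis by (simp add: pos_divide_less_eq mult.commute)
  qed
  have q0: "0 < real r * real Tm + 1" by (intro add_nonneg_pos) auto
  have tot_le: "tot w \<le> length w * Tm" if "set w \<subseteq> I" for w
    using that
  proof (induction w)
    case (Cons i w)
    then have "T i \<le> Tm" "tot w \<le> length w * Tm" using Tm[of i] by auto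
    then show ?case by simp
  qed simp
  let ?W = "\<lambda>N. {w \<in> words I r. tot w = N}"
  have "\<exists>N\<in>{..r * Tm}. real (M ^ r) / (real r * real Tm + 1) \<le> real (card (?W N))"
  proof (rule ccontr)
    assume "\<not> ?thesis"
    then have lt: "real (card (?W N)) < real (M ^ r) / (real r * real Tm + 1)" if "N \<le> r * Tm" for N
      using that by (meson not_le atMost_iff)
    have "words I r = (\<Union>N\<in>{..r * Tm}. ?W N)" using tot_le by (auto simp: words_def)
    then have "M ^ r \<le> (\<Sum>N\<in>{..r * Tm}. card (?W N))"
      using card_UN_le[of "{..r * Tm}" ?W] card_words[OF I, of r] by (simp add: M_def)
    then have "real (M ^ r) \<le> (\<Sum>N\<in>{..r * Tm}. real (card (?W N)))"
      unfolding of_nat_sum[symmetric] of_nat_le_iff .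
    also have "\<dots> < (\<Sum>N\<in>{..r * Tm}. real (M ^ r) / (real r * real Tm + 1))"
      by (rule sum_strict_mono) (use lt in auto)
    also have "\<dots> = (real r * real Tm + 1) * (real (M ^ r) / (real r * real Tm + 1))"
      by (simp add: algebra_simps)
    also have "\<dots> = real (M ^ r)" using q0 by simp
    finally show False by simp
  qed
  then obtain N where N: "real (M ^ r) / (real r * real Tm + 1) \<le> real (card (?W N))" by blast
  define p where "p = card (?W N)"
  have finW: "finite (?W N)" using finite_words[OF I] by simp
  have "exp (real r * C) * (real r * real Tm + 1) < real M ^ r"
  proof -
    have "exp (real r * C) * (real r * real Tm + 1) = exp (real r * C + ln (real r * real Tm + 1))"
      using q0 by (simp add: exp_add)
    also have "\<dots> < exp (real r * ln M)" using r by (simp add: algebra_simps)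
    also have "\<dots> = real M ^ r" using M0 by (simp add: exp_of_nat_mult)
    finally show ?thesis .
  qed
  then have "exp (real r * C) < real M ^ r / (real r * real Tm + 1)"
    using q0 by (simp add: pos_less_divide_eq)
  then have pbig: "exp (real r * C) < real p" using N by (simp add: p_def)
  moreover have "1 \<le> exp (real r * C)" using C by simp
  ultimately have "real p > 1" by linarith
  then have p2: "p \<ge> 2" by simp
  obtain e where e: "bij_betw e {0..<p} (?W N)"
    using ex_bij_betw_nat_finite[OF finW] unfolding p_def by blast
  \<comment> \<open>The first word is repeated beyond \<open>p\<close>, because
    \<open>contracting_branches\<close> wants a branch for every index.\<close>
  define E where "E i = (if i < p then e i else e 0)" for i
  have "E i \<in> ?W N" for i
    using bij_betwE[OF e] p2 by (simp add: E_def)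
  then have Ew: "set (E i) \<subseteq> I" "length (E i) = r" "tot (E i) = N" for i
    by (auto simp: words_def)
  have "N > 0"
  proof -
    obtain i w where w: "E 0 = i # w" using Ew(2)[of 0] by (cases "E 0") (auto simp: r_def)
    then have "T i \<le> N" "i \<in> I" using Ew(1,3)[of 0] by auto
    then show ?thesis using T0[of i] by linarith
  qed
  interpret H: contracting_branches f "\<lambda>i x. foldr g (E i) x" X N p lam
  proof
    show "dist (foldr g (E i) x) (foldr g (E i) y) \<le> lam * dist x y" if "x \<in> X" "y \<in> X" for i x y
    proof -
      have "lam ^ length (E i) \<le> lam ^ 1"
        unfolding Ew(2) by (rule power_decreasing) (use lam in \<open>auto simp: r_def\<close>)
      then have "lam ^ length (E i) * dist x y \<le> lam * dist x y" by (intro mult_right_mono) auto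
      then show ?thesis using word_lip[OF Ew(1) that, of i] by simp
    qed
    show "(f ^^ N) (foldr g (E i) x) = x" if "x \<in> X" for i x
      using funpow_tot[OF Ew(1)[of i] that] Ew(3)[of i] by simp
    show "foldr g (E i) x \<noteq> foldr g (E j) y" if "i < p" "j < p" "i \<noteq> j" "x \<in> X" "y \<in> X" for i j x y
    proof
      assume eq: "foldr g (E i) x = foldr g (E j) y"
      have "x = y"
        using funpow_tot[OF Ew(1)[of i] that(4)] funpow_tot[OF Ew(1)[of j] that(5)] Ew(3)[of i] Ew(3)[of j] eq by simp
      then have "E i = E j"
        using words_separated[OF Ew(1)[of i] Ew(1)[of j] that(4)] Ew(2,3) eq by simp
      then have "e i = e j" using that by (simp add: E_def)
      then show False using bij_betw_imp_inj_on[OF e] that by (auto dest: inj_onD)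
    qed
  qed (use cont X lam word_X[OF Ew(1)] p2 \<open>N > 0\<close> in auto)
  define \<nu> where "\<nu> = H.horseshoe"
  have "(real N * P0 - real r * C) / real N \<le> (\<integral>x. \<psi> x \<partial>\<nu>)"
    unfolding \<nu>_def
  proof (rule H.integral_horseshoe_ge[OF fm \<psi>])
    fix i x assume x: "x \<in> X" "x \<in> julia_set f" "foldr g (E i) x \<in> julia_set f"
    show "real N * P0 - real r * C \<le> birkhoff_sum f \<psi> N (foldr g (E i) x)"
      using birkhoff_word[OF low Ew(1)[of i] x(1,3)] Ew(2,3) by simp
  qed
  moreover have "(real N * P0 - real r * C) / real N = P0 - real r * C / real N"
    using \<open>N > 0\<close> by (simp add: diff_divide_distrib)
  moreover have "real r * C / real N < ln p / real N"
  proof (rule divide_strict_right_mono)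
    have "ln (exp (real r * C)) < ln (real p)" using pbig \<open>real p > 1\<close> by (subst ln_less_cancel_iff) auto
    then show "real r * C < ln p" by simp
  qed (use \<open>N > 0\<close> in simp)
  ultimately have "ln p / real N + (\<integral>x. \<psi> x \<partial>\<nu>) > P0" by linarith
  then show ?thesis
    using H.invariant_horseshoe[OF fm] H.entropy_horseshoe[OF fm] unfolding \<nu>_def by blast
qed

end

section \<open>Quantitative inverse branches\<close>

text \<open>The constant is \<open>2! / (\<rho> / 4)\<^sup>2\<close>, from the Cauchy estimate for
  the second derivative on discs of radius \<open>\<rho> / 4\<close> centred in the half
  disc.\<close>

lemma deriv_increment_bound:
  fixes G :: "complex \<Rightarrow> complex"
  assumes hol: "G holomorphic_on ball 0 \<rho>" and \<rho>: "\<rho> > 0" and bd: "\<And>w. w \<in> ball 0 \<rho> \<Longrightarrow> cmod (G w) \<le> B"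
    and u: "cmod u \<le> \<rho> / 2"
  shows "cmod (deriv G u - deriv G 0) \<le> 32 * B / \<rho>\<^sup>2 * cmod u"
proof -
  have hd: "deriv G holomorphic_on ball 0 \<rho>" by (intro holomorphic_deriv hol open_ball)
  have second: "cmod (deriv (deriv G) w) \<le> 32 * B / \<rho>\<^sup>2" if w: "w \<in> cball 0 (\<rho> / 2)" for w
  proof -
    have sub: "cball w (\<rho> / 4) \<subseteq> ball 0 \<rho>"
    proof
      fix v assume "v \<in> cball w (\<rho> / 4)"
      then have "cmod v \<le> cmod w + \<rho> / 4"
        using norm_triangle_ineq[of w "v - w"] by (simp add: dist_norm norm_minus_commute)
      then show "v \<in> ball 0 \<rho>" using w \<rho> by simp
    qed
    have "cmod ((deriv ^^ 2) G w) \<le> fact 2 * B / (\<rho> / 4) ^ 2"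
    proof (rule Cauchy_inequality)
      show "G holomorphic_on ball w (\<rho> / 4)"
        using hol sub ball_subset_cball by (meson holomorphic_on_subset order_trans)
      show "continuous_on (cball w (\<rho> / 4)) G"
        using hol sub by (meson holomorphic_on_imp_continuous_on holomorphic_on_subset)
      show "cmod (G x) \<le> B" if "cmod (w - x) = \<rho> / 4" for x
        using sub that by (intro bd) (auto simp: dist_norm)
    qed (use \<rho> in simp)
    then show ?thesis using \<rho> by (simp add: numeral_2_eq_2 field_simps)
  qed
  have "cmod (deriv G u - deriv G 0) \<le> 32 * B / \<rho>\<^sup>2 * cmod (u - 0)"
  proof (rule field_differentiable_bound[where S = "cball 0 (\<rho> / 2)"])
    fix z assume z: "z \<in> cball (0::complex) (\<rho> / 2)"
    then have "z \<in> ball 0 \<rho>" using \<rho> by simp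
    then show "(deriv G has_field_derivative deriv (deriv G) z) (at z within cball 0 (\<rho> / 2))"
      by (rule has_field_derivative_at_within[OF holomorphic_derivI[OF hd open_ball]])
    show "cmod (deriv (deriv G) z) \<le> 32 * B / \<rho>\<^sup>2" by (rule second[OF z])
  qed (use u \<rho> in auto)
  then show ?thesis by simp
qed

lemma expansion_near_0:
  fixes G :: "complex \<Rightarrow> complex"
  assumes hol: "G holomorphic_on ball 0 \<rho>" and "s < \<rho>"
    and var: "\<And>w. w \<in> cball 0 s \<Longrightarrow> cmod (deriv G w - deriv G 0) \<le> \<epsilon>"
    and u: "u \<in> cball 0 s" and v: "v \<in> cball 0 s"
  shows "(cmod (deriv G 0) - \<epsilon>) * cmod (u - v) \<le> cmod (G u - G v)"
proof -
  define h where "h w = G w - deriv G 0 * w" for w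
  have "cmod (h u - h v) \<le> \<epsilon> * cmod (u - v)"
  proof (rule field_differentiable_bound[where S = "cball 0 s" and f' = "\<lambda>w. deriv G w - deriv G 0"])
    fix z assume z: "z \<in> cball (0::complex) s"
    then have "z \<in> ball 0 \<rho>" using assms(2) by simp
    then have "(G has_field_derivative deriv G z) (at z within cball 0 s)"
      by (rule has_field_derivative_at_within[OF holomorphic_derivI[OF hol open_ball]])
    then show "(h has_field_derivative deriv G z - deriv G 0) (at z within cball 0 s)"
      unfolding h_def by (auto intro!: derivative_eq_intros)
  qed (use u v var in auto)
  moreover have "h u - h v = (G u - G v) - deriv G 0 * (u - v)" by (simp add: h_def algebra_simps)
  ultimately have 1: "cmod ((G u - G v) - deriv G 0 * (u - v)) \<le> \<epsilon> * cmod (u - v)" by (simp only:)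
  have "cmod (deriv G 0 * (u - v)) \<le> cmod (G u - G v) + cmod ((G u - G v) - deriv G 0 * (u - v))"
    by (metis norm_minus_commute norm_triangle_sub)
  then have "cmod (deriv G 0) * cmod (u - v) \<le> cmod (G u - G v) + \<epsilon> * cmod (u - v)"
    using 1 unfolding norm_mult by linarith
  then show ?thesis unfolding left_diff_distrib by linarith
qed

text \<open>On the disc of radius \<open>s\<close> the derivative varies by at most the fraction
  \<eta> of its value at 0, so \<open>G\<close> expands distances by at least
  \<open>(1 - \<eta>) * cmod (deriv G 0)\<close>. It is therefore injective there, and its image
  contains the disc of correspondingly scaled radius.\<close>

lemma quantitative_inverse:
  fixes G :: "complex \<Rightarrow> complex"
  assumes hol: "G holomorphic_on ball 0 \<rho>" and \<rho>: "\<rho> > 0" and bd: "\<And>w. w \<in> ball 0 \<rho> \<Longrightarrow> cmod (G w) \<le> 1"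
    and G0: "G 0 = 0" and A: "cmod (deriv G 0) > 0"
    and s: "0 < s" "s \<le> \<rho> / 2" and \<eta>: "0 < \<eta>" "\<eta> \<le> 1 / 2" and small: "32 / \<rho>\<^sup>2 * s \<le> \<eta> * cmod (deriv G 0)"
  obtains \<iota> :: "complex \<Rightarrow> complex" where "\<iota> holomorphic_on ball 0 ((1 - \<eta>) * cmod (deriv G 0) * s)"
    "\<And>w. w \<in> ball 0 ((1 - \<eta>) * cmod (deriv G 0) * s) \<Longrightarrow> cmod (\<iota> w) < s \<and> G (\<iota> w) = w"
proof -
  define A' where "A' = cmod (deriv G 0)"
  have sr: "s < \<rho>" using s \<rho> by simp
  have var: "cmod (deriv G w - deriv G 0) \<le> \<eta> * A'" if "w \<in> cball 0 s" for w
  proof -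
    have "cmod (deriv G w - deriv G 0) \<le> 32 * 1 / \<rho>\<^sup>2 * cmod w"
      using that s by (intro deriv_increment_bound[OF hol \<rho> bd]) auto
    also have "\<dots> \<le> 32 / \<rho>\<^sup>2 * s" using that by (auto intro!: mult_left_mono divide_right_mono)
    finally show ?thesis using small by (simp add: A'_def)
  qed
  have exp: "(1 - \<eta>) * A' * cmod (u - v) \<le> cmod (G u - G v)" if "u \<in> cball 0 s" "v \<in> cball 0 s" for u v
    using expansion_near_0[OF hol sr var that] by (simp add: A'_def algebra_simps)
  have pos: "(1 - \<eta>) * A' > 0" using \<eta> A by (simp add: A'_def)
  have inj: "inj_on G (cball 0 s)"
  proof (rule inj_onI)
    fix u v assume "u \<in> cball 0 s" "v \<in> cball 0 s" "G u = G v"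
    then have "(1 - \<eta>) * A' * cmod (u - v) \<le> 0" using exp[of u v] by simp
    then have "(1 - \<eta>) * A' * cmod (u - v) \<le> (1 - \<eta>) * A' * 0" by (simp only: mult_zero_right)
    then have "cmod (u - v) \<le> 0" unfolding mult_le_cancel_left_pos[OF pos] .
    then show "u = v" by simp
  qed
  have injb: "inj_on G (ball 0 s)" using inj by (rule inj_on_subset) auto
  have holb: "G holomorphic_on ball 0 s" using hol by (rule holomorphic_on_subset) (use sr in auto)
  have img: "ball 0 ((1 - \<eta>) * A' * s) \<subseteq> G ` ball 0 s"
  proof -
    have "ball (G 0) ((1 - \<eta>) * A' * s) \<subseteq> G ` ball 0 s"
    proof (rule ball_subset_open_map_image)
      have "cball 0 s \<subseteq> ball (0::complex) \<rho>" using sr by auto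
      then show "continuous_on (closure (ball 0 s)) G"
        using hol s by (simp add: closure_ball) (meson holomorphic_on_imp_continuous_on holomorphic_on_subset)
      show "open (G ` interior (ball 0 s))"
        using open_mapping_thm3[OF holb open_ball injb] by simp
      fix z assume "z \<in> frontier (ball (0::complex) s)"
      then have "cmod z = s" using s by (simp add: frontier_ball)
      then show "(1 - \<eta>) * A' * s \<le> cmod (G z - G 0)" using exp[of z 0] s by simp
    qed (use s pos in auto)
    then show ?thesis by (simp add: G0)
  qed
  obtain \<iota> where \<iota>: "\<iota> holomorphic_on (G ` ball 0 s)" "\<And>z. z \<in> ball 0 s \<Longrightarrow> \<iota> (G z) = z"
    using holomorphic_has_inverse[OF holb open_ball injb] by metis
  show ?thesis
  proof (rule that)
    show "\<iota> holomorphic_on ball 0 ((1 - \<eta>) * cmod (deriv G 0) * s)"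
      using \<iota>(1) img by (simp add: A'_def holomorphic_on_subset)
    fix w :: complex assume "w \<in> ball 0 ((1 - \<eta>) * cmod (deriv G 0) * s)"
    then have "w \<in> G ` ball 0 s" using img by (auto simp: A'_def)
    then obtain z where "z \<in> ball 0 s" "w = G z" by auto
    then show "cmod (\<iota> w) < s \<and> G (\<iota> w) = w" using \<iota>(2)[of z] by simp
  qed
qed

lemma one_minus_sum_le_prod:
  fixes \<eta> :: "nat \<Rightarrow> real"
  assumes "\<And>j. 0 \<le> \<eta> j" "\<And>j. \<eta> j \<le> 1"
  shows "1 - (\<Sum>j<n. \<eta> j) \<le> (\<Prod>j<n. 1 - \<eta> j)"
proof (induction n)
  case (Suc n)
  have p1: "(\<Prod>j<n. 1 - \<eta> j) \<le> 1" "0 \<le> (\<Prod>j<n. 1 - \<eta> j)"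
    using assms by (auto intro!: prod_le_1 prod_nonneg)
  then have "\<eta> n * (\<Prod>j<n. 1 - \<eta> j) \<le> \<eta> n * 1" using assms by (intro mult_left_mono) auto
  then show ?case using Suc by (simp add: algebra_simps)
qed simp

lemma geometric_partial_sum_le:
  fixes \<theta> :: real
  assumes "0 \<le> \<theta>" "\<theta> < 1"
  shows "(\<Sum>j<n. \<theta> ^ j) \<le> 1 / (1 - \<theta>)"
proof -
  have "(\<Sum>j<n. \<theta> ^ j) = (1 - \<theta> ^ n) / (1 - \<theta>)" using assms by (simp add: sum_gp_strict)
  also have "\<dots> \<le> 1 / (1 - \<theta>)" using assms by (intro divide_right_mono) auto
  finally show ?thesis .
qed

context rational_dynamics
begin

definition hyperbolic_time :: "real \<Rightarrow> real \<Rightarrow> riemann_sphere \<Rightarrow> nat \<Rightarrow> bool" where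
  "hyperbolic_time c L x n \<longleftrightarrow> (\<forall>k\<in>{1..n}. spherical_deriv f ((f ^^ (n - k)) x) \<ge> exp (- L - c / 2 * real k) \<and>
     (\<Prod>j<k. spherical_deriv f ((f ^^ (n - Suc j)) x)) \<ge> exp (c * real k))"

text \<open>\<open>H k\<close> is the branch of the inverse of \<open>f ^^ k\<close> from
  \<open>(f ^^ n) x\<close> back to \<open>(f ^^ (n - k)) x\<close>, read in the charts centred at
  these two points. The distortion bound is one-sided: with \<open>t \<ge> 0\<close>, an upper bound
  for derivatives bounds the potential from below. Positivity says that the pulled back discs
  contain no critical points.\<close>

definition inverse_branches :: "real \<Rightarrow> real \<Rightarrow> riemann_sphere \<Rightarrow> nat \<Rightarrow> (nat \<Rightarrow> complex \<Rightarrow> complex) \<Rightarrow> bool" where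
  "inverse_branches c r x n H \<longleftrightarrow>
     (\<forall>w. H 0 w = w) \<and>
     (\<forall>k\<le>n. H k holomorphic_on ball 0 r) \<and>
     (\<forall>k\<le>n. \<forall>w\<in>ball 0 r. cmod (H k w) \<le> 2 * r * exp (- c * real k)) \<and>
     (\<forall>k<n. \<forall>w\<in>ball 0 r. f (chart ((f ^^ (n - Suc k)) x) (H (Suc k) w)) = chart ((f ^^ (n - k)) x) (H k w)) \<and>
     (\<forall>k<n. \<forall>w\<in>ball 0 r. 0 < spherical_deriv f (chart ((f ^^ (n - Suc k)) x) (H (Suc k) w)) \<and>
        spherical_deriv f (chart ((f ^^ (n - Suc k)) x) (H (Suc k) w)) \<le>
        spherical_deriv f ((f ^^ (n - Suc k)) x) * exp (2 * exp (- c / 2) ^ Suc k))"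

text \<open>At a hyperbolic time the branch of \<open>f ^^ n\<close> along the orbit of \<open>x\<close> has an inverse on a disc of
  definite size: the derivative may shrink only like \<open>exp (- c k / 2)\<close>, while the pulled back discs shrink
  like \<open>exp (- c k)\<close>, so the pullback never meets a critical point.\<close>

lemma hyperbolic_branches:
  assumes c: "c > 0"
  obtains r where "r > 0" "r \<le> 1/4"
    "\<And>x n. hyperbolic_time c L x n \<Longrightarrow> \<exists>H. inverse_branches c r x n H"
proof -
  obtain \<rho> where \<rho>: "\<rho> > 0" "\<rho> \<le> 1"
    "\<And>x. local_map x holomorphic_on ball 0 \<rho>" "\<And>x. local_map x 0 = 0"
    "\<And>x w. w \<in> ball 0 \<rho> \<Longrightarrow> cmod (local_map x w) < 1"
    "\<And>x w. w \<in> ball 0 \<rho> \<Longrightarrow> f (chart x w) = chart (f x) (local_map x w)"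
    "\<And>x w. w \<in> ball 0 \<rho> \<Longrightarrow> spherical_deriv f (chart x w) =
       cmod (deriv (local_map x) w) * (1 + (cmod w)\<^sup>2) / (1 + (cmod (local_map x w))\<^sup>2)"
    using spherical_deriv_facts by blast
  define \<theta> where "\<theta> = exp (- c / 2)"
  have \<theta>: "0 < \<theta>" "\<theta> < 1" using c by (simp_all add: \<theta>_def)
  have \<theta>k: "\<theta> ^ k = exp (- (c / 2) * real k)" for k
    unfolding \<theta>_def by (simp add: exp_of_nat_mult[symmetric] mult.commute)
  have \<theta>2k: "\<theta> ^ k * \<theta> ^ k = exp (- c * real k)" for k
    unfolding \<theta>k by (simp add: exp_add[symmetric] algebra_simps)
  \<comment> \<open>With this factor the relative errors \<open>\<eta> j\<close> sum to at most 1/2,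
    so the product of the losses \<open>1 - \<eta> j\<close> stays at least 1/2.\<close>
  define e0 where "e0 = (1 - \<theta>) / 2"
  have e0: "0 < e0" "e0 \<le> 1/2" using \<theta> by (simp_all add: e0_def)
  define \<eta> where "\<eta> j = e0 * \<theta> ^ Suc j" for j
  have \<theta>le: "\<theta> ^ k \<le> 1" "0 < \<theta> ^ k" for k using \<theta> by (simp_all add: power_le_one)
  have \<eta>: "0 < \<eta> j" "\<eta> j \<le> 1/2" for j
    unfolding \<eta>_def using e0 \<theta>le[of "Suc j"] mult_mono[of e0 "1/2" "\<theta> ^ Suc j" 1] by (auto simp del: power_Suc)
  have prod_half: "(\<Prod>j<k. 1 - \<eta> j) \<ge> 1/2" for k
  proof -
    have "(\<Sum>j<k. \<eta> j) = e0 * \<theta> * (\<Sum>j<k. \<theta> ^ j)"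
      unfolding \<eta>_def sum_distrib_left by (simp add: algebra_simps)
    also have "\<dots> \<le> e0 * 1 * (1 / (1 - \<theta>))"
      using e0 \<theta> by (intro mult_mono geometric_partial_sum_le) (auto intro!: sum_nonneg)
    also have "\<dots> = 1/2" using \<theta> by (simp add: e0_def)
    finally have "(\<Sum>j<k. \<eta> j) \<le> 1/2" .
    moreover have "1 - (\<Sum>j<k. \<eta> j) \<le> (\<Prod>j<k. 1 - \<eta> j)"
      by (rule one_minus_sum_le_prod) (use \<eta> order_trans[OF \<eta>(2)] in \<open>auto simp: less_imp_le\<close>)
    ultimately show ?thesis by linarith
  qed
  \<comment> \<open>The first bound keeps all pulled back discs within \<open>\<rho> / 2\<close>;
    the last one is the smallness needed in \<open>key\<close>.\<close>
  define r where "r = min (\<rho> / 4) (min (1/4) (e0 * exp (- L) * \<rho>\<^sup>2 / 64))"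
  have r: "r > 0" "r \<le> \<rho> / 4" "r \<le> 1/4" "r \<le> e0 * exp (- L) * \<rho>\<^sup>2 / 64"
    using \<rho> e0 by (auto simp: r_def)
  show ?thesis
  proof (rule that[OF r(1,3)])
    fix x n assume hyp: "hyperbolic_time c L x n"
    define y where "y k = (f ^^ (n - k)) x" for k
    define A where "A k = spherical_deriv f (y k)" for k
    \<comment> \<open>From the radius \<open>R (Suc k)\<close>, \<open>quantitative_inverse\<close>
      yields a disc of radius \<open>(1 - \<eta> k) * A (Suc k) * R (Suc k)\<close>. The definition
      makes this equal to \<open>R k\<close>, so that successive inverses compose.\<close>
    define R where "R k = r / (\<Prod>j<k. (1 - \<eta> j) * A (Suc j))" for k
    have fy: "f (y (Suc k)) = y k" if "k < n" for k
    proof -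
      have "n - k = Suc (n - Suc k)" using that by simp
      then show ?thesis by (simp add: y_def)
    qed
    have Alow: "A (Suc k) \<ge> exp (- L) * \<theta> ^ Suc k" if "k < n" for k
    proof -
      have "Suc k \<in> {1..n}" using that by simp
      then have "exp (- L - c / 2 * real (Suc k)) \<le> A (Suc k)"
        using hyp unfolding hyperbolic_time_def A_def y_def by blast
      moreover have "exp (- L - c / 2 * real (Suc k)) = exp (- L) * \<theta> ^ Suc k"
        unfolding \<theta>k exp_add[symmetric] by simp
      ultimately show ?thesis by simp
    qed
    have Apos: "A (Suc k) > 0" if "k < n" for k
      by (rule less_le_trans[OF _ Alow[OF that]]) (use \<theta> in simp)
    have Aprod: "(\<Prod>j<k. A (Suc j)) \<ge> exp (c * real k)" if "k \<le> n" for k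
    proof (cases "k = 0")
      case False
      then have "k \<in> {1..n}" using that by simp
      then show ?thesis using hyp unfolding hyperbolic_time_def A_def y_def by blast
    qed simp
    have Rbound: "0 < R k \<and> R k \<le> 2 * r * exp (- c * real k)" if "k \<le> n" for k
    proof -
      have "(\<Prod>j<k. (1 - \<eta> j) * A (Suc j)) = (\<Prod>j<k. 1 - \<eta> j) * (\<Prod>j<k. A (Suc j))"
        by (rule prod.distrib)
      also have "\<dots> \<ge> 1/2 * exp (c * real k)"
        by (intro mult_mono prod_half Aprod that) (use order_trans[OF _ prod_half, of 0 k] in auto)
      finally have P: "(\<Prod>j<k. (1 - \<eta> j) * A (Suc j)) \<ge> exp (c * real k) / 2" by simp
      have P0: "(\<Prod>j<k. (1 - \<eta> j) * A (Suc j)) > 0" by (rule less_le_trans[OF _ P]) simp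
      have "R k \<le> r / (exp (c * real k) / 2)"
        unfolding R_def using r P P0 by (intro divide_left_mono) auto
      also have "\<dots> = 2 * r * exp (- c * real k)" by (simp add: exp_minus field_simps)
      finally show ?thesis using P0 r by (simp add: R_def)
    qed
    have Rstep: "(1 - \<eta> k) * A (Suc k) * R (Suc k) = R k" if "k < n" for k
    proof -
      have "(1 - \<eta> k) * A (Suc k) \<noteq> 0" using Apos[OF that] \<eta>(2)[of k] by simp
      moreover have "a * (r / (P * a)) = r / P" if "a \<noteq> 0" for a P :: real using that by simp
      ultimately show ?thesis unfolding R_def prod.lessThan_Suc by blast
    qed
    have R0: "R 0 = r" by (simp add: R_def)
    have Rsmall: "R k \<le> \<rho> / 2" "R k \<le> \<theta> ^ k" if "k \<le> n" for k
    proof -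
      have e1: "exp (- c * real k) \<le> 1" using c by simp
      have "R k \<le> 2 * r * exp (- c * real k)" using Rbound[OF that] by simp
      also have "\<dots> \<le> 2 * r * 1" using r e1 by (intro mult_left_mono) auto
      also have "\<dots> \<le> \<rho> / 2" using r by simp
      finally show "R k \<le> \<rho> / 2" .
      have "R k \<le> 2 * r * (\<theta> ^ k * \<theta> ^ k)" unfolding \<theta>2k using Rbound[OF that] by simp
      also have "\<dots> \<le> 1 * (1 * \<theta> ^ k)" using r \<theta>le[of k] by (intro mult_mono) auto
      finally show "R k \<le> \<theta> ^ k" by simp
    qed
    \<comment> \<open>Up to constants the radius decays like the square of
      \<open>\<theta> ^ Suc k\<close>, while the derivative is at least of order
      \<open>\<theta> ^ Suc k\<close>; the remaining factor \<open>\<theta> ^ Suc k\<close> is the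
      summable error \<open>\<eta> k\<close>.\<close>
    have key: "32 / \<rho>\<^sup>2 * R (Suc k) \<le> \<eta> k * A (Suc k)" if "k < n" for k
    proof -
      have "32 / \<rho>\<^sup>2 * R (Suc k) \<le> 32 / \<rho>\<^sup>2 * (2 * r * (\<theta> ^ Suc k * \<theta> ^ Suc k))"
        unfolding \<theta>2k using Rbound[of "Suc k"] that by (intro mult_left_mono) auto
      also have "\<dots> = 64 / \<rho>\<^sup>2 * r * (\<theta> ^ Suc k * \<theta> ^ Suc k)" by simp
      also have "\<dots> \<le> (e0 * exp (- L)) * (\<theta> ^ Suc k * \<theta> ^ Suc k)"
      proof (rule mult_right_mono)
        show "64 / \<rho>\<^sup>2 * r \<le> e0 * exp (- L)" using r(4) \<rho>(1) by (simp add: field_simps)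
      qed (use \<theta> in simp)
      also have "\<dots> = \<eta> k * (exp (- L) * \<theta> ^ Suc k)" by (simp add: \<eta>_def)
      also have "\<dots> \<le> \<eta> k * A (Suc k)" using \<eta>(1)[of k] Alow[OF that] by (intro mult_left_mono) auto
      finally show ?thesis .
    qed
    have Ader: "A k = cmod (deriv (local_map (y k)) 0)" for k
      unfolding A_def by (rule spherical_deriv_center)
    have "\<exists>\<iota>. \<iota> holomorphic_on ball 0 (R k) \<and>
        (\<forall>w\<in>ball 0 (R k). cmod (\<iota> w) < R (Suc k) \<and> local_map (y (Suc k)) (\<iota> w) = w)" if k: "k < n" for k
    proof -
      have h1: "cmod (local_map (y (Suc k)) w) \<le> 1" if "w \<in> ball 0 \<rho>" for w
        using \<rho>(5)[OF that] by (rule less_imp_le)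
      have h2: "0 < cmod (deriv (local_map (y (Suc k))) 0)" using Apos[OF k] unfolding Ader .
      have h3: "0 < R (Suc k)" "R (Suc k) \<le> \<rho> / 2" using Rbound[of "Suc k"] Rsmall[of "Suc k"] k by auto
      have h4: "32 / \<rho>\<^sup>2 * R (Suc k) \<le> \<eta> k * cmod (deriv (local_map (y (Suc k))) 0)"
        using key[OF k] unfolding Ader .
      show ?thesis
        by (rule quantitative_inverse[OF \<rho>(3,1) h1 \<rho>(4) h2 h3 \<eta> h4])
           (use Rstep[OF k] in \<open>auto simp: Ader\<close>)
    qed
    then obtain \<iota> where \<iota>: "\<And>k. k < n \<Longrightarrow> \<iota> k holomorphic_on ball 0 (R k)"
      "\<And>k w. k < n \<Longrightarrow> w \<in> ball 0 (R k) \<Longrightarrow> cmod (\<iota> k w) < R (Suc k) \<and> local_map (y (Suc k)) (\<iota> k w) = w"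
      by metis
    define H where "H = rec_nat (\<lambda>w. w) (\<lambda>k h w. \<iota> k (h w))"
    have H0: "H 0 w = w" and HS: "H (Suc k) w = \<iota> k (H k w)" for k w
      by (simp_all add: H_def)
    have H: "H k holomorphic_on ball 0 r \<and> (\<forall>w\<in>ball 0 r. cmod (H k w) < R k)" if "k \<le> n" for k
      using that
    proof (induction k)
      case 0
      have "H 0 = (\<lambda>w. w)" by (simp add: H_def)
      then show ?case by (simp add: R0)
    next
      case (Suc k)
      then have IH: "H k holomorphic_on ball 0 r" "\<And>w. w \<in> ball 0 r \<Longrightarrow> H k w \<in> ball 0 (R k)" and k: "k < n"
        by auto
      have "(\<iota> k \<circ> H k) holomorphic_on ball 0 r"
        by (rule holomorphic_on_compose_gen[OF IH(1) \<iota>(1)[OF k]]) (use IH(2) in auto)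
      moreover have "H (Suc k) = \<iota> k \<circ> H k" by (auto simp: HS)
      ultimately have "H (Suc k) holomorphic_on ball 0 r" by (simp only:)
      moreover have "cmod (H (Suc k) w) < R (Suc k)" if "w \<in> ball 0 r" for w
        unfolding HS using \<iota>(2)[OF k IH(2)[OF that]] by blast
      ultimately show ?case by blast
    qed
    have step: "local_map (y (Suc k)) (H (Suc k) w) = H k w" "cmod (H (Suc k) w) < R (Suc k)" "H (Suc k) w \<in> ball 0 \<rho>"
      if "k < n" "w \<in> ball 0 r" for k w
    proof -
      have "H k w \<in> ball 0 (R k)" using H[of k] that by auto
      then show 1: "local_map (y (Suc k)) (H (Suc k) w) = H k w" "cmod (H (Suc k) w) < R (Suc k)"
        using \<iota>(2)[OF that(1)] by (simp_all add: HS)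
      show "H (Suc k) w \<in> ball 0 \<rho>" using 1(2) Rsmall(1)[of "Suc k"] that(1) \<rho>(1) by simp
    qed
    show "\<exists>H. inverse_branches c r x n H"
      unfolding inverse_branches_def y_def[symmetric]
    proof (intro exI[of _ H] conjI allI impI ballI)
      fix k w assume k: "k \<le> n" and w: "w \<in> ball (0::complex) r"
      have "cmod (H k w) < R k" "R k \<le> 2 * r * exp (- c * real k)" using H[OF k] w Rbound[OF k] by auto
      then show "cmod (H k w) \<le> 2 * r * exp (- c * real k)" by linarith
    next
      fix k w assume k: "k < n" and w: "w \<in> ball (0::complex) r"
      show "f (chart (y (Suc k)) (H (Suc k) w)) = chart (y k) (H k w)"
        unfolding \<rho>(6)[OF step(3)[OF k w]] step(1)[OF k w] fy[OF k] ..
      let ?v = "H (Suc k) w" and ?G = "local_map (y (Suc k))"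
      have sd: "spherical_deriv f (chart (y (Suc k)) ?v) = cmod (deriv ?G ?v) * (1 + (cmod ?v)\<^sup>2) / (1 + (cmod (?G ?v))\<^sup>2)"
        by (rule \<rho>(7)[OF step(3)[OF k w]])
      have Rs: "R (Suc k) \<le> \<rho> / 2" "R (Suc k) \<le> \<theta> ^ Suc k" using Rsmall[of "Suc k"] k by auto
      have "cmod (deriv ?G ?v - deriv ?G 0) \<le> 32 * 1 / \<rho>\<^sup>2 * cmod ?v"
        by (rule deriv_increment_bound[OF \<rho>(3,1)]) (use \<rho>(5) step(2)[OF k w] Rs in \<open>auto intro: less_imp_le\<close>)
      also have "\<dots> \<le> 32 / \<rho>\<^sup>2 * R (Suc k)" using step(2)[OF k w] by (auto intro!: divide_right_mono)
      also have "\<dots> \<le> \<eta> k * A (Suc k)" by (rule key[OF k])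
      finally have var: "cmod (deriv ?G ?v - deriv ?G 0) \<le> \<eta> k * A (Suc k)" .
      have "cmod (deriv ?G ?v) \<le> cmod (deriv ?G 0) + cmod (deriv ?G ?v - deriv ?G 0)"
        by (rule norm_triangle_sub)
      then have up: "cmod (deriv ?G ?v) \<le> A (Suc k) * (1 + \<eta> k)" using var unfolding Ader by (simp add: algebra_simps)
      have "cmod (deriv ?G 0) \<le> cmod (deriv ?G ?v) + cmod (deriv ?G ?v - deriv ?G 0)"
        by (metis norm_minus_commute norm_triangle_sub)
      then have "A (Suc k) * (1 - \<eta> k) \<le> cmod (deriv ?G ?v)" using var unfolding Ader by (simp add: algebra_simps)
      moreover have "0 < A (Suc k) * (1 - \<eta> k)" using Apos[OF k] \<eta>(2)[of k] by simp
      ultimately have "0 < cmod (deriv ?G ?v)" by linarith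
      then show "0 < spherical_deriv f (chart (y (Suc k)) ?v)"
        unfolding sd by (intro divide_pos_pos mult_pos_pos one_plus_sq_pos)
      have vsq: "(cmod ?v)\<^sup>2 \<le> \<theta> ^ Suc k"
      proof -
        have "(cmod ?v)\<^sup>2 \<le> cmod ?v * 1"
          unfolding power2_eq_square using step(2)[OF k w] Rs \<rho>(2) by (intro mult_left_mono) auto
        then show ?thesis using step(2)[OF k w] Rs by linarith
      qed
      \<comment> \<open>Two factors arise: \<open>1 + \<eta> k\<close> from the variation of the
        derivative and \<open>1 + \<theta> ^ Suc k\<close> from the spherical metric at
        \<open>?v\<close>. Each is at most \<open>exp (\<theta> ^ Suc k)\<close>, hence the 2 in the
        exponent.\<close>
      have "spherical_deriv f (chart (y (Suc k)) ?v) \<le> cmod (deriv ?G ?v) * (1 + (cmod ?v)\<^sup>2) / 1"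
        unfolding sd by (intro divide_left_mono mult_nonneg_nonneg) (auto simp: one_plus_sq_pos)
      also have "\<dots> \<le> (A (Suc k) * (1 + \<eta> k)) * (1 + \<theta> ^ Suc k)"
        unfolding div_by_1 by (intro mult_mono up add_left_mono vsq) (use Apos[OF k] \<eta>(1)[of k] in auto)
      also have "\<dots> \<le> (A (Suc k) * exp (\<theta> ^ Suc k)) * exp (\<theta> ^ Suc k)"
      proof -
        have "\<eta> k \<le> \<theta> ^ Suc k"
          unfolding \<eta>_def using e0 \<theta>le(2)[of "Suc k"] mult_right_mono[of e0 1 "\<theta> ^ Suc k"] by (simp del: power_Suc)
        then have "1 + \<eta> k \<le> exp (\<theta> ^ Suc k)"
          using exp_ge_add_one_self[of "\<theta> ^ Suc k"] by linarith
        then show ?thesis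
          using Apos[OF k] exp_ge_add_one_self[of "\<theta> ^ Suc k"] \<eta>(1)[of k] \<theta>le(2)[of "Suc k"]
          by (intro mult_mono mult_left_mono) (auto simp del: power_Suc)
      qed
      also have "\<dots> = A (Suc k) * exp (2 * \<theta> ^ Suc k)"
        by (simp add: exp_add[symmetric] del: power_Suc)
      finally show "spherical_deriv f (chart (y (Suc k)) ?v) \<le>
          spherical_deriv f (y (Suc k)) * exp (2 * exp (- c / 2) ^ Suc k)"
        unfolding A_def \<theta>_def .
    qed (use H H0 in auto)
  qed
qed

end

section \<open>Homoclinic points\<close>

lemma holomorphic_root_ball:
  fixes F :: "complex \<Rightarrow> complex"
  assumes "F holomorphic_on ball z r" "\<And>w. w \<in> ball z r \<Longrightarrow> F w \<noteq> 0" "r > 0" "m > 0"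
  obtains R where "R holomorphic_on ball z r" "\<And>w. w \<in> ball z r \<Longrightarrow> R w ^ m = F w"
proof -
  obtain h where h: "h holomorphic_on ball z r" "\<And>x. x \<in> ball z r \<Longrightarrow> exp (h x) = F x"
    using holomorphic_logarithm_exists[of "ball z r" F z] assms by auto
  show ?thesis
  proof (rule that)
    show "(\<lambda>w. exp (h w / of_nat m)) holomorphic_on ball z r"
      using assms(4) by (intro holomorphic_intros h) auto
    fix w assume w: "w \<in> ball z r"
    have "exp (h w / of_nat m) ^ m = exp (of_nat m * (h w / of_nat m))" by (rule exp_of_nat_mult[symmetric])
    then show "exp (h w / of_nat m) ^ m = F w" using h(2)[OF w] assms(4) by simp
  qed
qed

text \<open>Write \<open>G w = w ^ m * g w\<close> with \<open>g\<close> free of zeros. Then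
  \<open>\<zeta> w = w * R w\<close>, with \<open>R\<close> an \<open>m\<close>-th root of
  \<open>g\<close>, has nonzero derivative at 0 and satisfies \<open>\<zeta> w ^ m = G w\<close>;
  its local inverse is \<open>\<kappa>\<close>.\<close>

lemma local_power_coordinate:
  fixes G :: "complex \<Rightarrow> complex"
  assumes hol: "G holomorphic_on ball 0 e" and e: "e > 0" and G0: "G 0 = 0" and nc: "\<not> G constant_on ball 0 e"
  obtains m \<sigma> \<kappa> where "m > 0" "\<sigma> > 0" "\<kappa> holomorphic_on ball 0 \<sigma>" "\<kappa> 0 = 0"
    "\<And>w. w \<in> ball 0 \<sigma> \<Longrightarrow> \<kappa> w \<in> ball 0 e \<and> G (\<kappa> w) = w ^ m"
proof -
  have 0: "0 \<in> ball (0::complex) e" using e by simp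
  obtain g r m where g: "0 < m" "0 < r" "ball (0::complex) r \<subseteq> ball 0 e" "g holomorphic_on ball 0 r"
    "\<And>w. w \<in> ball 0 r \<Longrightarrow> G w = (w - 0) ^ m * g w" "\<And>w. w \<in> ball 0 r \<Longrightarrow> g w \<noteq> 0"
    by (rule holomorphic_factor_zero_nonconstant[OF hol open_ball connected_ball 0 G0 nc]) (rule that)
  obtain R where R: "R holomorphic_on ball 0 r" "\<And>w. w \<in> ball 0 r \<Longrightarrow> R w ^ m = g w"
    using holomorphic_root_ball[OF g(4,6,2,1)] by blast
  define \<zeta> where "\<zeta> w = w * R w" for w
  have hz: "\<zeta> holomorphic_on ball 0 r" unfolding \<zeta>_def by (intro holomorphic_intros R)
  have R0: "R 0 \<noteq> 0" using R(2)[of 0] g(6)[of 0] g(1,2) by (auto simp: power_0_left)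
  have dR: "(R has_field_derivative deriv R 0) (at 0)"
    by (rule holomorphic_derivI[OF R(1) open_ball]) (use g(2) in simp)
  have "(\<zeta> has_field_derivative (1 * R 0 + deriv R 0 * 0)) (at 0)"
    unfolding \<zeta>_def by (rule DERIV_mult[OF DERIV_ident dR])
  then have "deriv \<zeta> 0 = R 0" by (simp add: DERIV_imp_deriv)
  then have dz: "deriv \<zeta> 0 \<noteq> 0" using R0 by simp
  obtain r' where r': "r' > 0" "ball (0::complex) r' \<subseteq> ball 0 r" "open (\<zeta> ` ball 0 r')" "inj_on \<zeta> (ball 0 r')"
    using has_complex_derivative_locally_invertible[OF hz _ open_ball dz] g(2) by auto
  have hz': "\<zeta> holomorphic_on ball 0 r'" using hz r'(2) by (rule holomorphic_on_subset)
  obtain \<kappa> where \<kappa>: "\<kappa> holomorphic_on (\<zeta> ` ball 0 r')" "\<And>z. z \<in> ball 0 r' \<Longrightarrow> \<kappa> (\<zeta> z) = z"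
    using holomorphic_has_inverse[OF hz' open_ball r'(4)] by metis
  have z0: "\<zeta> 0 = 0" by (simp add: \<zeta>_def)
  have "0 \<in> \<zeta> ` ball 0 r'" using r'(1) z0 by (intro image_eqI[of _ _ 0]) auto
  then obtain \<sigma> where \<sigma>: "\<sigma> > 0" "ball 0 \<sigma> \<subseteq> \<zeta> ` ball 0 r'"
    using r'(3) open_contains_ball by blast
  show ?thesis
  proof (rule that[OF g(1) \<sigma>(1)])
    show "\<kappa> holomorphic_on ball 0 \<sigma>" using \<kappa>(1) \<sigma>(2) by (rule holomorphic_on_subset)
    show "\<kappa> 0 = 0" using \<kappa>(2)[of 0] z0 r'(1) by simp
    fix w assume "w \<in> ball (0::complex) \<sigma>"
    then obtain z where z: "z \<in> ball 0 r'" "w = \<zeta> z" using \<sigma>(2) by auto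
    then have zr: "z \<in> ball 0 r" using r'(2) by auto
    have "G z = w ^ m" using g(5)[OF zr] R(2)[OF zr] by (simp add: z(2) \<zeta>_def power_mult_distrib)
    then show "\<kappa> w \<in> ball 0 e \<and> G (\<kappa> w) = w ^ m" using \<kappa>(2)[OF z(1)] z zr g(3) by auto
  qed
qed

section \<open>Failure of equicontinuity and homoclinic points\<close>

lemma chart_eq_iff: "chart x u = chart x v \<longleftrightarrow> u = v"
  by (metis coord_chart)

text \<open>An affine coordinate on the complement of \<open>q\<close>, obtained by rotating
  \<open>q\<close> to infinity: a map that omits \<open>q\<close> becomes a holomorphic
  function.\<close>

definition to_infty :: "riemann_sphere \<Rightarrow> riemann_sphere \<Rightarrow> complex" where
  "to_infty q s = (case rotation 0 1 (unrotate q s) of Point w \<Rightarrow> w | Infty \<Rightarrow> 0)"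

lemma to_infty_aux: "rotation 0 1 (unrotate q s) = Infty \<longleftrightarrow> s = q"
proof -
  have "rotation 0 1 (unrotate q s) = Infty \<longleftrightarrow> unrotate q s = Point 0"
    by (cases "unrotate q s") (auto simp: rotation_def cp_def)
  then show ?thesis
    using chart_unrotate[of q s 0] unrotate_chart[of q 0] by auto
qed

lemma to_infty_point: "s \<noteq> q \<Longrightarrow> rotation 0 1 (unrotate q s) = Point (to_infty q s)"
  using to_infty_aux[of q s] unfolding to_infty_def by (cases "rotation 0 1 (unrotate q s)") auto

lemma to_infty_inj:
  assumes "s \<noteq> q" "t \<noteq> q" "to_infty q s = to_infty q t"
  shows "s = t"
proof -
  have "rotation 0 1 (unrotate q s) = rotation 0 1 (unrotate q t)"
    using to_infty_point[OF assms(1)] to_infty_point[OF assms(2)] assms(3) by simp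
  then have "dist (rotation 0 1 (unrotate q s)) (rotation 0 1 (unrotate q t)) = 0" by simp
  then show ?thesis by (simp add: dist_rotation dist_unrotate)
qed

lemma to_infty_holomorphic:
  assumes "rational_curve H" "\<And>w. w \<in> S \<Longrightarrow> H w \<noteq> q"
  shows "(\<lambda>w. to_infty q (H w)) holomorphic_on S"
proof -
  have "rational_curve (\<lambda>w. rotation 0 1 (unrotate q (H w)))"
    by (intro rational_curve_rotation rational_curve_unrotate assms) simp
  then obtain g where g: "g holomorphic_on S" "\<forall>w\<in>S. rotation 0 1 (unrotate q (H w)) = Point (g w)"
    using rational_curve_holomorphic[of "\<lambda>w. rotation 0 1 (unrotate q (H w))" S] to_infty_aux assms(2) by blast
  have "to_infty q (H w) = g w" if "w \<in> S" for w
    using g(2) that by (simp add: to_infty_def)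
  then show ?thesis using g(1) by (subst holomorphic_cong[of S S _ g]) auto
qed

text \<open>A family of holomorphic functions on a disc that omit \<open>0\<close> and take the value \<open>1\<close> only at the
  centre is equicontinuous there, up to passing to reciprocals: apply Schottky on the punctured disc
  and the maximum principle.\<close>

lemma equicontinuous_one_at_center:
  fixes \<Phi> :: "nat \<Rightarrow> complex \<Rightarrow> complex"
  assumes hol: "\<And>k. \<Phi> k holomorphic_on ball 0 R" and R: "R > 0"
    and n0: "\<And>k w. w \<in> ball 0 R \<Longrightarrow> \<Phi> k w \<noteq> 0"
    and n1: "\<And>k w. w \<in> ball 0 R \<Longrightarrow> w \<noteq> 0 \<Longrightarrow> \<Phi> k w \<noteq> 1" and one: "\<And>k. \<Phi> k 0 = 1"
  obtains C where "\<And>k w. cmod w \<le> R / 4 \<Longrightarrow> cmod (\<Phi> k w - 1) \<le> C * cmod w \<or> cmod (1 / \<Phi> k w - 1) \<le> C * cmod w"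
proof -
  define w0 where "w0 = complex_of_real (R / 2)"
  have w0: "cmod w0 = R / 2" using R by (simp add: w0_def norm_of_real del: of_real_divide)
  \<comment> \<open>Schottky's theorem needs a bound at one point. Taking the reciprocal where
    necessary makes the value at \<open>w0\<close> at most 1 in modulus and still omits 0 and 1 on
    the punctured disc; this is the origin of the alternative in the conclusion.\<close>
  define \<Psi> where "\<Psi> k = (if cmod (\<Phi> k w0) \<le> 1 then \<Phi> k else (\<lambda>w. 1 / \<Phi> k w))" for k
  have \<Psi>hol: "\<Psi> k holomorphic_on ball 0 R" for k
    unfolding \<Psi>_def using hol n0 by (auto intro!: holomorphic_intros)
  have \<Psi>1: "\<Psi> k 0 = 1" for k by (simp add: \<Psi>_def one)
  let ?S = "ball 0 R - {0::complex}"
  have S: "open ?S" "connected ?S"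
    by (auto intro!: connected_punctured_ball[of "0::complex", simplified])
  obtain B where B: "\<And>h z. h \<in> range \<Psi> \<Longrightarrow> z \<in> sphere 0 (R / 2) \<Longrightarrow> cmod (h z) \<le> B"
  proof (rule GPicard3[OF S, of w0 "range \<Psi>" "range \<Psi>" "sphere 0 (R/2)"])
    show "w0 \<in> ?S" using w0 R by auto
    show "h holomorphic_on ?S" if "h \<in> range \<Psi>" for h
      using that \<Psi>hol by (auto intro: holomorphic_on_subset)
    show "h z \<noteq> 0 \<and> h z \<noteq> 1" if "h \<in> range \<Psi>" "z \<in> ?S" for h z
      using that n0 n1 by (auto simp: \<Psi>_def)
    show "cmod (h w0) \<le> 1" if "h \<in> range \<Psi>" for h
      using that by (auto simp: \<Psi>_def norm_divide divide_le_eq_1)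
    show "sphere 0 (R / 2) \<subseteq> ?S" using R by auto
  qed auto
  have sub: "cball 0 (R/2) \<subseteq> ball (0::complex) R" using R by auto
  have Bd: "cmod (\<Psi> k w) \<le> B" if "w \<in> cball 0 (R / 2)" for k w
  proof (rule maximum_modulus_frontier[of "\<Psi> k" "cball 0 (R / 2)"])
    show "\<Psi> k holomorphic_on interior (cball 0 (R / 2))"
      using \<Psi>hol sub by (meson holomorphic_on_subset interior_subset order_trans)
    show "continuous_on (closure (cball 0 (R / 2))) (\<Psi> k)"
      using \<Psi>hol sub by simp (meson holomorphic_on_imp_continuous_on holomorphic_on_subset)
  qed (use B that in auto)
  have lip: "cmod (\<Psi> k w - 1) \<le> 4 * B / R * cmod w" if "cmod w \<le> R / 4" for k w
  proof -
    have "cmod (\<Psi> k w - \<Psi> k 0) \<le> 4 * B / R * cmod (w - 0)"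
    proof (rule field_differentiable_bound[where S = "cball 0 (R / 4)"])
      fix z assume z: "z \<in> cball (0::complex) (R / 4)"
      then have "z \<in> ball 0 R" using R by simp
      then show "(\<Psi> k has_field_derivative deriv (\<Psi> k) z) (at z within cball 0 (R / 4))"
        by (rule has_field_derivative_at_within[OF holomorphic_derivI[OF \<Psi>hol open_ball]])
      have zs: "cball z (R / 4) \<subseteq> cball 0 (R / 2)"
      proof
        fix v assume "v \<in> cball z (R / 4)"
        then show "v \<in> cball 0 (R / 2)"
          using z norm_triangle_ineq[of z "v - z"] by (simp add: dist_norm norm_minus_commute)
      qed
      have "cmod ((deriv ^^ 1) (\<Psi> k) z) \<le> fact 1 * B / (R / 4) ^ 1"
      proof (rule Cauchy_inequality)
        show "\<Psi> k holomorphic_on ball z (R / 4)"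
          using \<Psi>hol zs sub ball_subset_cball by (meson holomorphic_on_subset order_trans)
        show "continuous_on (cball z (R / 4)) (\<Psi> k)"
          using \<Psi>hol zs sub by (meson holomorphic_on_imp_continuous_on holomorphic_on_subset order_trans)
        show "cmod (\<Psi> k x) \<le> B" if "cmod (z - x) = R / 4" for x
          using zs that by (intro Bd) (auto simp: dist_norm)
      qed (use R in simp)
      then show "cmod (deriv (\<Psi> k) z) \<le> 4 * B / R" by (simp add: field_simps)
    qed (use that R in auto)
    then show ?thesis by (simp add: \<Psi>1)
  qed
  show ?thesis
    by (rule that[of "4 * B / R"]) (use lip in \<open>metis \<Psi>_def\<close>)
qed

context rational_dynamics
begin

lemma chart_infty_only: "s \<noteq> rot x Infty \<Longrightarrow> \<exists>w. s = chart x w"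
  by (metis chart_eq_rot riemann_sphere.exhaust rot_unrotate(1))

text \<open>A polynomial that vanishes on a disc is zero, so the iterate would have the value
  \<open>b\<close> everywhere except possibly at the antipode of \<open>y\<close>. Surjectivity onto
  two further values contradicts this.\<close>

lemma funpow_not_locally_constant:
  assumes "e > 0"
  shows "\<exists>w\<in>ball 0 e. (f ^^ n) (chart y w) \<noteq> b"
proof (rule ccontr)
  assume "\<not> ?thesis"
  then have const: "(f ^^ n) (chart y w) = b" if "w \<in> ball 0 e" for w using that by blast
  have "rational_curve (\<lambda>w. unrotate b ((f ^^ n) (chart y w)))"
    by (intro rational_curve_unrotate rational_curve_funpow rational_curve_chart)
  then obtain u v where uv: "\<And>w. poly u w \<noteq> 0 \<or> poly v w \<noteq> 0"
    "\<And>w. unrotate b ((f ^^ n) (chart y w)) = cp (poly u w) (poly v w)"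
    unfolding rational_curve_def by blast
  have "poly u w = 0" if w: "w \<in> ball 0 e" for w
  proof -
    have "cp (poly u w) (poly v w) = Point 0"
      using uv(2)[of w] const[OF w] unrotate_self_iff[of b b] by simp
    then show ?thesis by (auto simp: cp_def split: if_splits)
  qed
  then have "ball 0 e \<subseteq> {w. poly u w = 0}" by blast
  moreover have "infinite (ball (0::complex) e)" using uncountable_ball[OF assms] countable_finite by blast
  ultimately have "infinite {w. poly u w = 0}" by (rule infinite_super)
  then have "u = 0" using poly_roots_finite by blast
  then have all: "(f ^^ n) (chart y w) = b" for w
  proof -
    have "unrotate b ((f ^^ n) (chart y w)) = Point 0" using uv[of w] \<open>u = 0\<close> by (auto simp: cp_def)
    then show ?thesis by (simp only: unrotate_self_iff)
  qed
  have only: "s = rot y Infty" if "(f ^^ n) s \<noteq> b" for s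
    using chart_infty_only[of s y] all that by metis
  have "\<exists>t t'. t \<noteq> b \<and> t' \<noteq> b \<and> t \<noteq> t'"
  proof (cases b)
    case (Point z)
    then show ?thesis by (intro exI[of _ Infty] exI[of _ "Point (z + 1)"]) simp
  next
    case Infty
    then show ?thesis by (intro exI[of _ "Point 0"] exI[of _ "Point 1"]) simp
  qed
  then obtain t t' where t: "t \<noteq> b" "t' \<noteq> b" "t \<noteq> t'" by blast
  obtain s s' where s: "(f ^^ n) s = t" "(f ^^ n) s' = t'" using funpow_surj by metis
  then have "s = rot y Infty" "s' = rot y Infty" using only t by auto
  then show False using s t by simp
qed

lemma funpow_power_coordinate:
  assumes "(f ^^ n) y = b"
  obtains m \<sigma> \<kappa> where "m > 0" "\<sigma> > 0" "\<kappa> holomorphic_on ball 0 \<sigma>" "\<kappa> 0 = 0"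
    "\<And>w. w \<in> ball 0 \<sigma> \<Longrightarrow> (f ^^ n) (chart y (\<kappa> w)) = chart b (w ^ m)"
proof -
  have rc: "rational_curve (\<lambda>w. (f ^^ n) (chart y w))"
    by (intro rational_curve_funpow rational_curve_chart)
  have "isCont (\<lambda>w. (f ^^ n) (chart y w)) 0" by (rule rational_curve_continuous[OF rc])
  from this[unfolded continuous_at_eps_delta, rule_format, OF zero_less_one]
  obtain e where e: "e > 0" "\<And>w. cmod w < e \<Longrightarrow> dist ((f ^^ n) (chart y w)) b < 1"
    using assms by auto
  have near: "dist b ((f ^^ n) (chart y w)) < 1" if "w \<in> ball 0 e" for w
    using e(2)[of w] that by (simp add: dist_commute)
  define G where "G w = coord b ((f ^^ n) (chart y w))" for w
  have G: "chart b (G w) = (f ^^ n) (chart y w)" if "w \<in> ball 0 e" for w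
    unfolding G_def by (rule chart_coord(1)[OF near[OF that]])
  have hol: "G holomorphic_on ball 0 e"
    unfolding G_def by (rule rational_curve_coord_holomorphic[OF rc near])
  have G0: "G 0 = 0" using coord_chart[of b 0] by (simp add: G_def assms)
  have "\<not> G constant_on ball 0 e"
  proof
    assume "G constant_on ball 0 e"
    then have "G w = 0" if "w \<in> ball 0 e" for w
      using G0 e(1) that unfolding constant_on_def by (metis centre_in_ball)
    then have "(f ^^ n) (chart y w) = b" if "w \<in> ball 0 e" for w
      using G[OF that] that by simp
    then show False using funpow_not_locally_constant[OF e(1), of n y b] by blast
  qed
  from local_power_coordinate[OF hol e(1) G0 this] obtain m \<sigma> \<kappa>
    where *: "m > 0" "\<sigma> > 0" "\<kappa> holomorphic_on ball 0 \<sigma>" "\<kappa> 0 = 0"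
      "\<And>w. w \<in> ball 0 \<sigma> \<Longrightarrow> \<kappa> w \<in> ball 0 e \<and> G (\<kappa> w) = w ^ m" by metis
  show ?thesis
    by (rule that[OF *(1-4)]) (use * G in metis)
qed

lemma funpow_open_at:
  assumes y: "(f ^^ n) y = b" and \<epsilon>: "\<epsilon> > 0"
  obtains \<delta> where "\<delta> > 0" "\<And>s. dist b s < \<delta> \<Longrightarrow> \<exists>z. dist y z < \<epsilon> \<and> (f ^^ n) z = s"
proof -
  obtain m \<sigma> \<kappa> where *: "m > 0" "\<sigma> > 0" "\<kappa> holomorphic_on ball 0 \<sigma>" "\<kappa> 0 = 0"
    "\<And>w. w \<in> ball 0 \<sigma> \<Longrightarrow> (f ^^ n) (chart y (\<kappa> w)) = chart b (w ^ m)"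
    using funpow_power_coordinate[OF y] by metis
  have "continuous_on (ball 0 \<sigma>) \<kappa>" by (rule holomorphic_on_imp_continuous_on[OF *(3)])
  then have "isCont \<kappa> 0" using *(2) by (simp add: continuous_on_eq_continuous_at)
  then obtain \<tau> where \<tau>: "\<tau> > 0" "\<And>w. cmod w < \<tau> \<Longrightarrow> cmod (\<kappa> w) < \<epsilon> / 8"
    unfolding continuous_at_eps_delta using *(4) \<epsilon> by (auto dest!: spec[of _ "\<epsilon> / 8"])
  define t where "t = min 1 (min \<sigma> \<tau>) / 2"
  have t: "t > 0" "t < \<sigma>" "t < \<tau>" "t \<le> 1" using *(2) \<tau>(1) by (auto simp: t_def)
  show ?thesis
  proof (rule that[of "min 1 (t ^ m)"])
    show "0 < min 1 (t ^ m)" using t by simp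
    fix s assume s: "dist b s < min 1 (t ^ m)"
    define v where "v = coord b s"
    have v: "chart b v = s" "cmod v < t ^ m"
      using chart_coord[of b s] s by (auto simp: v_def)
    obtain w where w: "w ^ m = v" using *(1) by (metis exists_complex_root less_numeral_extra(3))
    have "cmod w ^ m < t ^ m" using v(2) w by (simp add: norm_power[symmetric])
    then have wt: "cmod w < t" using t(1) by (simp add: power_less_imp_less_base)
    have "dist y (chart y (\<kappa> w)) \<le> 8 * cmod (\<kappa> w)" by (rule dist_chart_center_le)
    also have "\<dots> < \<epsilon>" using \<tau>(2)[of w] wt t by simp
    finally have "dist y (chart y (\<kappa> w)) < \<epsilon>" .
    moreover have "(f ^^ n) (chart y (\<kappa> w)) = s" using *(5)[of w] wt t v w by simp
    ultimately show "\<exists>z. dist y z < \<epsilon> \<and> (f ^^ n) z = s" by blast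
  qed
qed

text \<open>If no point near \<open>x\<close> other than \<open>x\<close> itself were mapped to
  \<open>x\<close>, then near \<open>x\<close> the iterates of \<open>f ^^ T\<close> would omit
  \<open>x1\<close> and its preimage \<open>x2\<close>, and would take the value \<open>x\<close>
  only at \<open>x\<close>. After moving \<open>x1\<close>, \<open>x2\<close>, \<open>x\<close> to
  infinity, 0 and 1 they would be equicontinuous at \<open>x\<close>. But the points
  \<open>z k\<close> tend to \<open>x\<close> and are all carried to \<open>b\<close>.\<close>

lemma ex_homoclinic:
  assumes fx: "(f ^^ T) x = x" and x1: "x1 \<noteq> x" "(f ^^ T) x1 = x"
    and z: "z \<longlonglongrightarrow> x" "\<And>k. (f ^^ (T * k)) (z k) = b" and b: "b \<noteq> x" and \<epsilon>: "\<epsilon> > 0"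
  shows "\<exists>y k. y \<noteq> x \<and> dist y x < \<epsilon> \<and> (f ^^ (T * k)) y = x"
proof (rule ccontr)
  assume "\<not> ?thesis"
  then have no: "(f ^^ (T * k)) y \<noteq> x" if "y \<noteq> x" "dist y x < \<epsilon>" for y k using that by blast
  have T: "T > 0" using x1 by (cases T) auto
  obtain x2 where x2: "(f ^^ T) x2 = x1" using funpow_surj by blast
  have dis: "x2 \<noteq> x1" "x2 \<noteq> x" using x2 x1 fx by auto
  have Sk: "(f ^^ T) ((f ^^ (T * k)) y) = (f ^^ (T * Suc k)) y" for k y
    by (simp add: funpow_add)
  have no1: "(f ^^ (T * k)) y \<noteq> x1" if "y \<noteq> x" "dist y x < \<epsilon>" for y k
    using no[OF that, of "Suc k"] Sk[of k y] x1(2) by metis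
  have no2: "(f ^^ (T * k)) y \<noteq> x2" if "y \<noteq> x" "dist y x < \<epsilon>" for y k
    using no1[OF that, of "Suc k"] Sk[of k y] x2 by metis
  have fixk: "(f ^^ (T * k)) x = x" for k by (induction k) (simp_all add: funpow_add fx)
  define M where "M s = (to_infty x1 s - to_infty x1 x2) / (to_infty x1 x - to_infty x1 x2)" for s
  have Mnz: "to_infty x1 x - to_infty x1 x2 \<noteq> 0"
    using to_infty_inj[of x x1 x2] x1(1) dis by auto
  have M0: "M s \<noteq> 0" if "s \<noteq> x1" "s \<noteq> x2" for s
    using to_infty_inj[of s x1 x2] that dis Mnz by (auto simp: M_def)
  have M1: "M s \<noteq> 1" if "s \<noteq> x1" "s \<noteq> x" for s
    using to_infty_inj[of s x1 x] that x1(1) Mnz by (auto simp: M_def)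
  have Mq: "M x = 1" using Mnz by (simp add: M_def)
  define R where "R = \<epsilon> / 8"
  have R: "R > 0" using \<epsilon> by (simp add: R_def)
  have inball: "chart x w \<noteq> x" "dist (chart x w) x < \<epsilon>" if "w \<in> ball 0 R" "w \<noteq> 0" for w
  proof -
    show "chart x w \<noteq> x" using chart_eq_iff[of x w 0] that(2) by simp
    show "dist (chart x w) x < \<epsilon>" using dist_chart_center_le(2)[of x w] that(1) by (simp add: R_def)
  qed
  define \<Phi> where "\<Phi> k w = M ((f ^^ (T * k)) (chart x w))" for k w
  have avoid: "(f ^^ (T * k)) (chart x w) \<noteq> x1" "(f ^^ (T * k)) (chart x w) \<noteq> x2" if "w \<in> ball 0 R" for k w
  proof -
    have "(f ^^ (T * k)) (chart x w) \<noteq> x1 \<and> (f ^^ (T * k)) (chart x w) \<noteq> x2"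
    proof (cases "w = 0")
      case True
      then show ?thesis using fixk[of k] x1(1) dis(2) by simp
    next
      case False
      then show ?thesis using inball[OF that False] no1 no2 by blast
    qed
    then show "(f ^^ (T * k)) (chart x w) \<noteq> x1" "(f ^^ (T * k)) (chart x w) \<noteq> x2" by auto
  qed
  obtain C where C: "\<And>k w. cmod w \<le> R / 4 \<Longrightarrow> cmod (\<Phi> k w - 1) \<le> C * cmod w \<or> cmod (1 / \<Phi> k w - 1) \<le> C * cmod w"
  proof (rule equicontinuous_one_at_center[of \<Phi> R])
    show "\<Phi> k holomorphic_on ball 0 R" for k
      unfolding \<Phi>_def M_def
      by (intro holomorphic_intros to_infty_holomorphic rational_curve_funpow rational_curve_chart avoid Mnz)
    show "\<Phi> k w \<noteq> 0" if "w \<in> ball 0 R" for k w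
      unfolding \<Phi>_def by (intro M0 avoid that)
    show "\<Phi> k w \<noteq> 1" if "w \<in> ball 0 R" "w \<noteq> 0" for k w
      unfolding \<Phi>_def by (intro M1 avoid no inball that)
    show "\<Phi> k 0 = 1" for k by (simp add: \<Phi>_def fixk Mq)
  qed (use R in auto)
  have znq: "z k \<noteq> x" for k using z(2)[of k] fixk[of k] b by auto
  have zlim: "(\<lambda>k. dist x (z k)) \<longlonglongrightarrow> 0"
    using z(1) tendsto_dist_iff[of z x] by (simp add: dist_commute)
  obtain K where K: "\<And>k. k \<ge> K \<Longrightarrow> dist x (z k) < min 1 (min \<epsilon> (R / 4))"
    using LIMSEQ_D[OF zlim, of "min 1 (min \<epsilon> (R / 4))"] \<epsilon> R by auto
  have bx: "b \<noteq> x1" "b \<noteq> x2"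
    using no1[OF znq, of K K] no2[OF znq, of K K] z(2)[of K] K[of K] by (auto simp: dist_commute)
  \<comment> \<open>At \<open>z k\<close> the function \<open>\<Phi> k\<close> has the fixed value
    \<open>M b\<close>, different from 1. Whichever alternative of the estimate \<open>C\<close>
    holds, its left side is at least \<delta>.\<close>
  define \<delta> where "\<delta> = min (cmod (M b - 1)) (cmod (1 / M b - 1))"
  have "1 / M b \<noteq> 1" using M1[OF bx(1) b] by (simp add: divide_eq_1_iff)
  then have \<delta>: "\<delta> > 0" using M1[OF bx(1) b] by (simp add: \<delta>_def)
  have low: "\<delta> \<le> C * dist x (z k)" if k: "k \<ge> K" for k
  proof -
    define w where "w = coord x (z k)"
    have w: "chart x w = z k" "cmod w \<le> dist x (z k)"
      using chart_coord[of x "z k"] K[OF k] by (auto simp: w_def)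
    have "cmod w \<le> R / 4" using w K[OF k] by simp
    then have d: "\<delta> \<le> C * cmod w" using C[of w k] by (auto simp: \<delta>_def \<Phi>_def w z(2))
    then have "C * cmod w > 0" using \<delta> by simp
    then have "C > 0" using norm_ge_zero[of w] by (metis mult_nonpos_nonneg not_le)
    then have "C * cmod w \<le> C * dist x (z k)" using w(2) by (intro mult_left_mono) auto
    then show ?thesis using d by simp
  qed
  have "(\<lambda>k. C * dist x (z k)) \<longlonglongrightarrow> C * 0" by (intro tendsto_intros zlim)
  then have "\<delta> \<le> C * 0" by (rule LIMSEQ_le_const) (use low in blast)
  then show False using \<delta> by simp
qed

end

section \<open>Generic points\<close>

lemma pos_upper_density_mono:
  assumes "pos_upper_density R" "R \<subseteq> S"
  shows "pos_upper_density S"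
proof -
  have "card (R \<inter> {..<n}) \<le> card (S \<inter> {..<n})" for n
    using assms(2) by (intro card_mono) auto
  then have "\<theta> * real n \<le> real (card (R \<inter> {..<n})) \<Longrightarrow> \<theta> * real n \<le> real (card (S \<inter> {..<n}))" for \<theta> n
    using of_nat_mono order_trans by metis
  then show ?thesis using assms(1) unfolding pos_upper_density_def by (meson INFM_mono)
qed

context rational_dynamics
begin

abbreviation log_deriv :: "riemann_sphere \<Rightarrow> real" where
  "log_deriv x \<equiv> ln (spherical_deriv f x)"

lemma spherical_deriv_measurable [measurable]: "spherical_deriv f \<in> borel_measurable borel"
  by (intro borel_measurable_continuous_onI continuous_at_imp_continuous_on) (simp add: isCont_spherical_deriv)

lemma eln_measurable [measurable]: "eln \<in> borel_measurable borel"
  unfolding eln_def[abs_def] by measurable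

lemma spherical_deriv_measurable_invariant:
  assumes "invariant_prob f \<nu>"
  shows "spherical_deriv f \<in> borel_measurable \<nu>"
proof -
  have "sets \<nu> = sets (restrict_space borel (julia_set f))" using assms by (simp add: invariant_prob_def)
  then show ?thesis
    by (subst measurable_cong_sets[OF _ refl], assumption) (intro measurable_restrict_space1 spherical_deriv_measurable)
qed

lemma e2ennreal_pos_part: "e2ennreal (max 0 (ereal r)) = ennreal r"
proof -
  have "enn2ereal (ennreal r) = max 0 (ereal r)"
    by (cases "r \<ge> 0") (simp_all add: enn2ereal_ennreal ennreal_neg max_def zero_ennreal.rep_eq)
  then show ?thesis by (metis e2ennreal_enn2ereal)
qed

text \<open>The positive part is at most \<open>ln \<Lambda>\<close>, so an infinite negative part
  would make the exponent minus infinity. Positivity thus makes the negative part integrable, keeps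
  almost every point off the critical set, and reduces the extended integral to the Bochner
  integral.\<close>

lemma lyapunov_exponent_real:
  assumes inv: "invariant_prob f \<mu>" and pos: "lyapunov_exponent f \<mu> > 0"
  shows "AE x in \<mu>. spherical_deriv f x > 0" "integrable \<mu> log_deriv"
    "lyapunov_exponent f \<mu> = ereal (\<integral>x. log_deriv x \<partial>\<mu>)"
proof -
  interpret prob_space \<mu> using inv unfolding invariant_prob_def by (rule conjunct1)
  note sm [measurable] = spherical_deriv_measurable_invariant[OF inv]
  obtain \<Lambda> where \<Lambda>: "\<Lambda> > 1" "\<And>x. 0 \<le> spherical_deriv f x" "\<And>x. spherical_deriv f x \<le> \<Lambda>"
    by (rule spherical_deriv_bounds) (rule that)
  define P where "P = (\<integral>\<^sup>+ x. e2ennreal (max 0 (eln (spherical_deriv f x))) \<partial>\<mu>)"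
  define Q where "Q = (\<integral>\<^sup>+ x. e2ennreal (max 0 (- eln (spherical_deriv f x))) \<partial>\<mu>)"
  have lyap: "lyapunov_exponent f \<mu> = enn2ereal P - enn2ereal Q"
    unfolding lyapunov_exponent_def ereal_integral_def P_def Q_def ..
  have "P \<le> (\<integral>\<^sup>+ x. ennreal (ln \<Lambda>) \<partial>\<mu>)"
    unfolding P_def
  proof (rule nn_integral_mono)
    fix x
    have "eln (spherical_deriv f x) \<le> ereal (ln \<Lambda>)"
    proof (cases "spherical_deriv f x \<le> 0")
      case False
      then have "ln (spherical_deriv f x) \<le> ln \<Lambda>" by (intro ln_mono \<Lambda>(3)) simp
      then show ?thesis using False by (simp add: eln_def)
    qed (simp add: eln_def)
    then have "max 0 (eln (spherical_deriv f x)) \<le> max 0 (ereal (ln \<Lambda>))" by (rule max.mono[OF order_refl])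
    then have "e2ennreal (max 0 (eln (spherical_deriv f x))) \<le> e2ennreal (max 0 (ereal (ln \<Lambda>)))"
      by (rule e2ennreal_mono)
    then show "e2ennreal (max 0 (eln (spherical_deriv f x))) \<le> ennreal (ln \<Lambda>)"
      unfolding e2ennreal_pos_part .
  qed
  also have "\<dots> = ennreal (ln \<Lambda>)" by (simp add: emeasure_space_1)
  finally have Pfin: "P < \<infinity>" by (simp add: le_less_trans)
  have Qfin: "Q < \<infinity>"
  proof (rule ccontr)
    assume "\<not> Q < \<infinity>"
    then have "Q = \<infinity>" by (simp add: not_less top_unique)
    then show False using pos Pfin unfolding lyap by (cases P) auto
  qed
  have Qm: "(\<lambda>x. e2ennreal (max 0 (- eln (spherical_deriv f x)))) \<in> borel_measurable \<mu>" by measurable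
  have "AE x in \<mu>. e2ennreal (max 0 (- eln (spherical_deriv f x))) \<noteq> \<infinity>"
    by (rule nn_integral_noteq_infinite[OF Qm]) (use Qfin in \<open>simp add: Q_def\<close>)
  then show AE: "AE x in \<mu>. spherical_deriv f x > 0"
  proof eventually_elim
    case (elim x)
    then show ?case by (auto simp: eln_def max_def split: if_splits)
  qed
  have Peq: "P = (\<integral>\<^sup>+ x. ennreal (log_deriv x) \<partial>\<mu>)"
    unfolding P_def by (rule nn_integral_cong_AE, use AE in eventually_elim) (simp add: eln_def e2ennreal_pos_part)
  have Qeq: "Q = (\<integral>\<^sup>+ x. ennreal (- log_deriv x) \<partial>\<mu>)"
    unfolding Q_def
  proof (rule nn_integral_cong_AE, use AE in eventually_elim)
    case (elim x)
    have "- eln (spherical_deriv f x) = ereal (- log_deriv x)" using elim by (simp add: eln_def)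
    then show ?case by (simp only: e2ennreal_pos_part)
  qed
  show int: "integrable \<mu> log_deriv"
    unfolding real_integrable_def using Pfin Qfin unfolding Peq Qeq by auto
  have "(\<integral>x. log_deriv x \<partial>\<mu>) = enn2real P - enn2real Q"
    unfolding Peq Qeq by (rule real_lebesgue_integral_def[OF int])
  then show "lyapunov_exponent f \<mu> = ereal (\<integral>x. log_deriv x \<partial>\<mu>)"
    unfolding lyap using Pfin Qfin by (cases P; cases Q) auto
qed

section \<open>Regularity of the potential on the Julia set\<close>

lemma holder_facts:
  assumes "holder_continuous_on (julia_set f) \<phi>"
  obtains \<alpha> C where "0 < \<alpha>" "\<alpha> \<le> 1" "C \<ge> 0"
    "\<And>x y. x \<in> julia_set f \<Longrightarrow> y \<in> julia_set f \<Longrightarrow> \<bar>\<phi> x - \<phi> y\<bar> \<le> C * dist x y powr \<alpha>"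
proof -
  obtain \<alpha> C where *: "0 < \<alpha>" "\<alpha> \<le> 1"
    "\<And>x y. x \<in> julia_set f \<Longrightarrow> y \<in> julia_set f \<Longrightarrow> \<bar>\<phi> x - \<phi> y\<bar> \<le> C * dist x y powr \<alpha>"
    using assms unfolding holder_continuous_on_def by blast
  show ?thesis
  proof (rule that[of \<alpha> "max 0 C"])
    fix x y assume "x \<in> julia_set f" "y \<in> julia_set f"
    then have "\<bar>\<phi> x - \<phi> y\<bar> \<le> C * dist x y powr \<alpha>" by (rule *(3))
    also have "\<dots> \<le> max 0 C * dist x y powr \<alpha>" by (intro mult_right_mono) auto
    finally show "\<bar>\<phi> x - \<phi> y\<bar> \<le> max 0 C * dist x y powr \<alpha>" .
  qed (use * in auto)
qed

lemma holder_continuous: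
  assumes "holder_continuous_on (julia_set f) \<phi>"
  shows "\<phi> \<in> borel_measurable (restrict_space borel (julia_set f))"
proof -
  obtain \<alpha> C where *: "0 < \<alpha>" "C \<ge> 0"
    "\<And>x y. x \<in> julia_set f \<Longrightarrow> y \<in> julia_set f \<Longrightarrow> \<bar>\<phi> x - \<phi> y\<bar> \<le> C * dist x y powr \<alpha>"
    using holder_facts[OF assms] by metis
  have "continuous_on (julia_set f) \<phi>"
    unfolding continuous_on_def
  proof
    fix x assume x: "x \<in> julia_set f"
    have "((\<lambda>y. dist y x) \<longlongrightarrow> dist x x) (at x within julia_set f)" by (intro tendsto_intros)
    then have "((\<lambda>y. dist y x) \<longlongrightarrow> 0) (at x within julia_set f)" by simp
    then have "((\<lambda>y. C * dist y x powr \<alpha>) \<longlongrightarrow> C * 0 powr \<alpha>) (at x within julia_set f)"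
      by (intro tendsto_mult tendsto_const tendsto_powr') (use * in auto)
    then have "((\<lambda>y. C * dist y x powr \<alpha>) \<longlongrightarrow> 0) (at x within julia_set f)" using * by simp
    then have "((\<lambda>y. \<phi> y - \<phi> x) \<longlongrightarrow> 0) (at x within julia_set f)"
      by (rule Lim_null_comparison[rotated]) (use *(3) x in \<open>auto simp: eventually_at_filter\<close>)
    then show "(\<phi> \<longlongrightarrow> \<phi> x) (at x within julia_set f)" by (simp add: LIM_zero_iff)
  qed
  then show ?thesis by (rule borel_measurable_continuous_on_restrict)
qed

lemma holder_bounded:
  assumes "holder_continuous_on (julia_set f) \<phi>"
  obtains B where "B \<ge> 0" "\<And>x. x \<in> julia_set f \<Longrightarrow> \<bar>\<phi> x\<bar> \<le> B"
proof (cases "julia_set f = {}")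
  case True
  then show ?thesis using that[of 0] by simp
next
  case False
  then obtain x0 where x0: "x0 \<in> julia_set f" by blast
  obtain \<alpha> C where *: "0 < \<alpha>" "C \<ge> 0"
    "\<And>x y. x \<in> julia_set f \<Longrightarrow> y \<in> julia_set f \<Longrightarrow> \<bar>\<phi> x - \<phi> y\<bar> \<le> C * dist x y powr \<alpha>"
    using holder_facts[OF assms] by metis
  have "\<bar>\<phi> x\<bar> \<le> \<bar>\<phi> x0\<bar> + C * pi powr \<alpha>" if "x \<in> julia_set f" for x
  proof -
    have "C * dist x x0 powr \<alpha> \<le> C * pi powr \<alpha>"
      using * by (intro mult_left_mono powr_mono2) (auto simp: dist_le_pi)
    then show ?thesis using *(3)[OF that x0] by linarith
  qed
  then show ?thesis using that[of "\<bar>\<phi> x0\<bar> + C * pi powr \<alpha>"] * by auto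
qed

text \<open>The sequence \<open>v\<close> is the logarithmic derivative minus a penalty for its
  excess below \<open>- L\<close>. At a record the last \<open>k\<close> terms of \<open>v\<close>
  sum to at least \<open>c * k\<close>, which gives the expansion. Since logarithmic derivatives are
  at most \<open>V\<close>, the penalties among them total at most \<open>V * k\<close>; the weight
  \<open>2 * V / c\<close> then bounds a single excess by \<open>c / 2 * k\<close>.\<close>

lemma hyperbolic_time_record:
  assumes c: "c > 0" and V: "V > 0" "\<And>y. log_deriv y \<le> V" and pos: "\<And>k. spherical_deriv f ((f ^^ k) x) > 0"
    and L: "L \<ge> 0"
    and rec: "\<forall>i<m. (\<Sum>j<i. v j) - c * real i \<le> (\<Sum>j<m. v j) - c * real m"
    and v: "\<And>j. v j = log_deriv ((f ^^ j) x) - (2 * V / c) * max 0 (- log_deriv ((f ^^ j) x) - L)"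
  shows "hyperbolic_time c L x m"
  unfolding hyperbolic_time_def
proof (intro ballI conjI)
  fix k assume k: "k \<in> {1..m}"
  define l where "l j = log_deriv ((f ^^ j) x)" for j
  define w where "w j = max 0 (- l j - L)" for j
  have vle: "v j \<le> l j" for j
    unfolding v l_def[symmetric] w_def[symmetric] using c V by (simp add: w_def)
  have block: "(\<Sum>j<k. g (m - Suc j)) = (\<Sum>j<m. g j) - (\<Sum>j<m - k. g j)" for g :: "nat \<Rightarrow> real"
  proof -
    have "(\<Sum>j<m. g j) = (\<Sum>j<m - k. g j) + (\<Sum>j\<in>{m - k..<m}. g j)"
      using sum.union_disjoint[of "{..<m-k}" "{m-k..<m}" g] k
      by (subst sum.union_disjoint[symmetric]) (auto simp: ivl_disj_un)
    moreover have "(\<Sum>j\<in>{m - k..<m}. g j) = (\<Sum>j<k. g (m - Suc j))"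
      by (rule sum.reindex_bij_witness[of _ "\<lambda>j. m - Suc j" "\<lambda>j. m - Suc j"]) (use k in auto)
    ultimately show ?thesis by simp
  qed
  have S: "(\<Sum>j<k. v (m - Suc j)) \<ge> c * real k"
  proof -
    have "m - k < m" using k by auto
    then have "(\<Sum>j<m - k. v j) - c * real (m - k) \<le> (\<Sum>j<m. v j) - c * real m" using rec by blast
    then show ?thesis using k unfolding block by (simp add: of_nat_diff algebra_simps)
  qed
  have lsum: "(\<Sum>j<k. l (m - Suc j)) \<ge> c * real k"
    using S sum_mono[of "{..<k}" "\<lambda>j. v (m - Suc j)" "\<lambda>j. l (m - Suc j)"] vle by force
  have "(\<Prod>j<k. spherical_deriv f ((f ^^ (m - Suc j)) x)) = exp (\<Sum>j<k. l (m - Suc j))"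
    unfolding l_def using pos by (simp add: exp_sum)
  then show "exp (c * real k) \<le> (\<Prod>j<k. spherical_deriv f ((f ^^ (m - Suc j)) x))"
    using lsum by simp
  have "(\<Sum>j<k. (2 * V / c) * w (m - Suc j)) = (\<Sum>j<k. l (m - Suc j)) - (\<Sum>j<k. v (m - Suc j))"
    unfolding v l_def w_def by (simp add: sum_subtractf)
  also have "\<dots> \<le> V * real k - c * real k"
    using S sum_bounded_above[of "{..<k}" "\<lambda>j. l (m - Suc j)" V] V(2) by (simp add: l_def mult.commute)
  also have "\<dots> \<le> V * real k" using c by simp
  finally have "(\<Sum>j<k. (2 * V / c) * w (m - Suc j)) \<le> V * real k" .
  moreover have "(2 * V / c) * w (m - k) \<le> (\<Sum>j<k. (2 * V / c) * w (m - Suc j))"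
    using member_le_sum[of "k - 1" "{..<k}" "\<lambda>j. (2 * V / c) * w (m - Suc j)"] k c V by (simp add: w_def)
  ultimately have "(2 * V / c) * w (m - k) \<le> V * real k" by linarith
  then have "w (m - k) \<le> c / 2 * real k" using c V by (simp add: field_simps)
  then have "- L - c / 2 * real k \<le> l (m - k)" unfolding w_def by linarith
  then have "exp (- L - c / 2 * real k) \<le> exp (l (m - k))" by simp
  then show "exp (- L - c / 2 * real k) \<le> spherical_deriv f ((f ^^ (m - k)) x)"
    unfolding l_def using pos by simp
qed

text \<open>Almost every point has all the required properties at once. The mean penalty tends to 0
  as \<open>L\<close> grows, by dominated convergence, so for some \<open>L\<close> the penalised
  logarithmic derivative still has a definite positive mean and its records have positive upper
  density.\<close>

lemma generic_point:
  assumes erg: "ergodic_prob f \<mu>" and lyap: "lyapunov_exponent f \<mu> > 0"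
    and u: "integrable \<mu> u" "(\<integral>x. u x \<partial>\<mu>) = 0"
  obtains c L x where "c > 0" "x \<in> julia_set f" "\<And>k. spherical_deriv f ((f ^^ k) x) > 0"
    "pos_upper_density {n. hyperbolic_time c L x n}"
    "\<And>e. e > 0 \<Longrightarrow> \<exists>K. \<forall>n. birkhoff_sum f u n x \<ge> - e * real n - K"
proof -
  have inv: "invariant_prob f \<mu>" using erg by (simp add: ergodic_prob_def)
  interpret prob_space \<mu> using inv unfolding invariant_prob_def by (rule conjunct1)
  have fm: "f \<in> measurable \<mu> \<mu>" "distr \<mu> \<mu> f = \<mu>" and sets: "sets \<mu> = sets (restrict_space borel (julia_set f))"
    using inv by (auto simp: invariant_prob_def)
  have spJ: "space \<mu> = julia_set f" using sets_eq_imp_space_eq[OF sets] by (simp add: space_restrict_space)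
  note lm = lyapunov_exponent_real[OF inv lyap]
  define chi where "chi = (\<integral>x. log_deriv x \<partial>\<mu>)"
  have chi: "chi > 0" using lyap unfolding lm(3) chi_def by simp
  obtain \<Lambda> where \<Lambda>: "\<Lambda> > 1" "\<And>x. 0 \<le> spherical_deriv f x" "\<And>x. spherical_deriv f x \<le> \<Lambda>"
    by (rule spherical_deriv_bounds) (rule that)
  define V where "V = ln \<Lambda>"
  have V: "V > 0" "log_deriv y \<le> V" for y
    using \<Lambda>(1) \<Lambda>(2,3)[of y] by (cases "spherical_deriv f y = 0"; auto simp: V_def)+
  \<comment> \<open>The penalised mean will exceed \<open>chi / 2\<close>, which is above the rate
    \<open>2 * c\<close> that \<open>pliss_records\<close> asks for.\<close>
  define c where "c = chi / 8"
  have c: "c > 0" using chi by (simp add: c_def)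
  define w where "w L x = max 0 (- log_deriv x - L)" for L x
  have wint: "integrable \<mu> (w L)" for L
    unfolding w_def by (intro integrable_max lm(2)) (simp_all add: lm(2))
  have "(\<lambda>n. \<integral>x. w (real n) x \<partial>\<mu>) \<longlonglongrightarrow> (\<integral>x. 0 \<partial>\<mu>)"
  proof (rule integral_dominated_convergence[where w = "\<lambda>x. \<bar>log_deriv x\<bar>"])
    show "AE x in \<mu>. (\<lambda>n. w (real n) x) \<longlonglongrightarrow> 0"
    proof (rule AE_I2, rule tendsto_eventually)
      fix x
      obtain N :: nat where "real N > - log_deriv x" using reals_Archimedean2 by blast
      then show "\<forall>\<^sub>F n in sequentially. w (real n) x = 0"
        by (intro eventually_sequentiallyI[of N]) (auto simp: w_def max_def)
    qed
    show "AE x in \<mu>. norm (w (real n) x) \<le> \<bar>log_deriv x\<bar>" for n by (auto simp: w_def)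
  qed (use lm(2) wint in \<open>auto simp: borel_measurable_integrable\<close>)
  then have "(\<lambda>n. \<integral>x. w (real n) x \<partial>\<mu>) \<longlonglongrightarrow> 0" by simp
  moreover have "chi / 2 / (2 * V / c) > 0" using chi V c by simp
  ultimately obtain n0 :: nat where n0: "\<And>n. n \<ge> n0 \<Longrightarrow> norm ((\<integral>x. w (real n) x \<partial>\<mu>) - 0) < chi / 2 / (2 * V / c)"
    using LIMSEQ_D by blast
  define L where "L = real n0"
  have L: "L \<ge> 0" "(\<integral>x. w L x \<partial>\<mu>) < chi / 2 / (2 * V / c)" using n0[of n0] by (auto simp: L_def)
  define v where "v x = log_deriv x - (2 * V / c) * w L x" for x
  have vint: "integrable \<mu> v" unfolding v_def using lm(2) wint by simp
  have "(\<integral>x. v x \<partial>\<mu>) = chi - (2 * V / c) * (\<integral>x. w L x \<partial>\<mu>)"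
    unfolding v_def chi_def using lm(2) wint by simp
  moreover have "(2 * V / c) * (\<integral>x. w L x \<partial>\<mu>) < chi / 2"
  proof -
    have "0 < 2 * V / c" using V c by simp
    then show ?thesis using L(2) by (simp only: pos_less_divide_eq mult.commute)
  qed
  ultimately have "2 * c < (\<integral>x. v x \<partial>\<mu>)" using chi by (simp add: c_def)
  then have AEv: "AE x in \<mu>. \<exists>K. \<forall>n. birkhoff_sum f v n x \<ge> 2 * c * real n - K"
    by (rule ergodic_birkhoff_lower[OF erg vint])
  \<comment> \<open>Countably many rates are used, so that one null set can be discarded for all of
    them; every \<open>e > 0\<close> exceeds some \<open>1 / Suc m\<close>.\<close>
  have AEu: "AE x in \<mu>. \<forall>m::nat. \<exists>K. \<forall>n. birkhoff_sum f u n x \<ge> - (1 / real (Suc m)) * real n - K"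
    unfolding AE_all_countable by (intro allI ergodic_birkhoff_lower[OF erg u(1)]) (simp add: u(2))
  have AEs: "AE x in \<mu>. \<forall>k. spherical_deriv f ((f ^^ k) x) > 0"
    unfolding AE_all_countable
  proof
    fix k
    have dk: "distr \<mu> \<mu> (f ^^ k) = \<mu>"
    proof (induction k)
      case 0
      then show ?case by (simp add: id_def distr_id2)
    next
      case (Suc k)
      have "distr \<mu> \<mu> (f ^^ Suc k) = distr (distr \<mu> \<mu> (f ^^ k)) \<mu> f"
        unfolding distr_distr[OF fm(1) funpow_measurable[OF fm(1)]] by simp
      also have "\<dots> = distr \<mu> \<mu> f" by (simp only: Suc)
      also have "\<dots> = \<mu>" by (rule fm(2))
      finally show ?case .
    qed
    have "AE x in distr \<mu> \<mu> (f ^^ k). spherical_deriv f x > 0" unfolding dk by (rule lm(1))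
    then show "AE x in \<mu>. spherical_deriv f ((f ^^ k) x) > 0"
      by (rule AE_distrD[OF funpow_measurable[OF fm(1)]])
  qed
  define good where "good x \<longleftrightarrow> x \<in> space \<mu> \<and> (\<exists>K. \<forall>n. birkhoff_sum f v n x \<ge> 2 * c * real n - K) \<and>
      (\<forall>m::nat. \<exists>K. \<forall>n. birkhoff_sum f u n x \<ge> - (1 / real (Suc m)) * real n - K) \<and>
      (\<forall>k. spherical_deriv f ((f ^^ k) x) > 0)" for x
  have AE: "AE x in \<mu>. good x"
    using AE_space AEv AEu AEs unfolding good_def by eventually_elim blast
  have "\<exists>x. good x"
  proof (rule ccontr)
    assume "\<not> ?thesis"
    then have "AE x in \<mu>. False" using AE by simp
    then show False by simp
  qed
  then obtain x where x: "x \<in> space \<mu>" "\<exists>K. \<forall>n. birkhoff_sum f v n x \<ge> 2 * c * real n - K"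
      "\<And>m::nat. \<exists>K. \<forall>n. birkhoff_sum f u n x \<ge> - (1 / real (Suc m)) * real n - K"
      "\<And>k. spherical_deriv f ((f ^^ k) x) > 0"
    unfolding good_def by (elim exE conjE) (rule that, blast+)
  obtain K where K: "\<And>n. birkhoff_sum f v n x \<ge> 2 * c * real n - K" using x(2) by blast
  define vs where "vs j = v ((f ^^ j) x)" for j
  have vsV: "vs j \<le> V" for j
  proof -
    have "0 \<le> (2 * V / c) * w L ((f ^^ j) x)" using V c by (simp add: w_def)
    then show ?thesis using V(2)[of "(f ^^ j) x"] unfolding vs_def v_def by linarith
  qed
  have "pos_upper_density {m. \<forall>i<m. (\<Sum>j<i. vs j) - c * real i \<le> (\<Sum>j<m. vs j) - c * real m}"
    by (rule pliss_records[OF V(1) vsV c, of K]) (use K in \<open>simp add: birkhoff_sum_def vs_def\<close>)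
  moreover have "{m. \<forall>i<m. (\<Sum>j<i. vs j) - c * real i \<le> (\<Sum>j<m. vs j) - c * real m} \<subseteq> {n. hyperbolic_time c L x n}"
  proof
    fix m assume m: "m \<in> {m. \<forall>i<m. (\<Sum>j<i. vs j) - c * real i \<le> (\<Sum>j<m. vs j) - c * real m}"
    have "hyperbolic_time c L x m"
      by (rule hyperbolic_time_record[OF c V x(4) L(1)]) (use m in \<open>auto simp: vs_def v_def w_def\<close>)
    then show "m \<in> {n. hyperbolic_time c L x n}" by simp
  qed
  ultimately have R: "pos_upper_density {n. hyperbolic_time c L x n}"
    by (rule pos_upper_density_mono)
  show ?thesis
  proof (rule that[OF c _ x(4) R])
    show "x \<in> julia_set f" using x(1) spJ by simp
    fix e :: real assume "e > 0"
    then obtain m :: nat where m: "1 / real (Suc m) < e" using nat_approx_posE by blast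
    obtain K where K: "\<And>n. birkhoff_sum f u n x \<ge> - (1 / real (Suc m)) * real n - K" using x(3) by blast
    have "- e * real n - K \<le> birkhoff_sum f u n x" for n
    proof -
      have "(1 / real (Suc m)) * real n \<le> e * real n" using m by (intro mult_right_mono) auto
      then show ?thesis using K[of n] by linarith
    qed
    then show "\<exists>K. \<forall>n. birkhoff_sum f u n x \<ge> - e * real n - K" by blast
  qed
qed

text \<open>Otherwise each point would have a ball visited with zero upper density; finitely many of
  these cover the sphere, against \<open>pos_upper_density_UN\<close>.\<close>

lemma density_accumulation_point:
  assumes "pos_upper_density R"
  obtains b where "\<And>\<rho>. \<rho> > 0 \<Longrightarrow> pos_upper_density {n\<in>R. dist (x n :: riemann_sphere) b < \<rho>}"
proof (rule ccontr)
  assume "\<not> thesis"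
  then have "\<forall>b. \<exists>\<rho>>0. \<not> pos_upper_density {n\<in>R. dist (x n) b < \<rho>}" using that by blast
  then obtain \<rho> where \<rho>: "\<And>b. \<rho> b > 0" "\<And>b. \<not> pos_upper_density {n\<in>R. dist (x n) b < \<rho> b}" by metis
  have "UNIV \<subseteq> (\<Union>b. ball b (\<rho> b))"
  proof
    fix s :: riemann_sphere
    have "s \<in> ball s (\<rho> s)" using \<rho>(1) by simp
    then show "s \<in> (\<Union>b. ball b (\<rho> b))" by blast
  qed
  then obtain C where C: "finite C" "UNIV \<subseteq> (\<Union>b\<in>C. ball b (\<rho> b))"
    using compactE_image[OF compact_riemann_sphere, of UNIV "\<lambda>b. ball b (\<rho> b)"] by auto
  have "R \<subseteq> (\<Union>b\<in>C. {n\<in>R. dist (x n) b < \<rho> b})"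
  proof
    fix n assume n: "n \<in> R"
    obtain b where "b \<in> C" "x n \<in> ball b (\<rho> b)" using C(2) by blast
    then show "n \<in> (\<Union>b\<in>C. {n\<in>R. dist (x n) b < \<rho> b})" using n by (auto simp: dist_commute)
  qed
  then have "pos_upper_density (\<Union>b\<in>C. {n\<in>R. dist (x n) b < \<rho> b})"
    by (rule pos_upper_density_mono[OF assms])
  then show False using pos_upper_density_UN[OF C(1)] \<rho>(2) by blast
qed

end

section \<open>Inverse branches near an accumulation point\<close>

text \<open>The Cauchy estimate for the first derivative on discs of radius \<open>r / 4\<close>
  centred in the half disc.\<close>

lemma lipschitz_half_ball:
  fixes F :: "complex \<Rightarrow> complex"
  assumes hol: "F holomorphic_on ball 0 r" and r: "r > 0" and bd: "\<And>w. w \<in> ball 0 r \<Longrightarrow> cmod (F w) \<le> B"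
    and u: "u \<in> cball 0 (r / 2)" and v: "v \<in> cball 0 (r / 2)"
  shows "cmod (F u - F v) \<le> 4 * B / r * cmod (u - v)"
proof (rule field_differentiable_bound[where S = "cball 0 (r / 2)"])
  fix z assume z: "z \<in> cball (0::complex) (r / 2)"
  then have "z \<in> ball 0 r" using r by simp
  then show "(F has_field_derivative deriv F z) (at z within cball 0 (r / 2))"
    by (rule has_field_derivative_at_within[OF holomorphic_derivI[OF hol open_ball]])
  have sub: "cball z (r / 4) \<subseteq> ball 0 r"
  proof
    fix v assume "v \<in> cball z (r / 4)"
    then have "cmod v \<le> cmod z + r / 4"
      using norm_triangle_ineq[of z "v - z"] by (simp add: dist_norm norm_minus_commute)
    then show "v \<in> ball 0 r" using z r by simp
  qed
  have "cmod ((deriv ^^ 1) F z) \<le> fact 1 * B / (r / 4) ^ 1"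
  proof (rule Cauchy_inequality)
    show "F holomorphic_on ball z (r / 4)"
      using hol sub ball_subset_cball by (meson holomorphic_on_subset order_trans)
    show "continuous_on (cball z (r / 4)) F"
      using hol sub by (meson holomorphic_on_imp_continuous_on holomorphic_on_subset)
    show "cmod (F x) \<le> B" if "cmod (z - x) = r / 4" for x
      using sub that by (intro bd) (auto simp: dist_norm)
  qed (use r in simp)
  then show "cmod (deriv F z) \<le> 4 * B / r" by (simp add: field_simps)
qed (use u v in auto)

lemma finite_lower_bound:
  fixes S :: "real set"
  assumes "finite S" "\<And>s. s \<in> S \<Longrightarrow> s > 0"
  obtains \<delta> where "\<delta> > 0" "\<And>s. s \<in> S \<Longrightarrow> \<delta> \<le> s"
proof (rule that[of "Min (insert 1 S)"])
  show "Min (insert 1 S) > 0" using assms by (subst Min_gr_iff) auto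
  show "\<And>s. s \<in> S \<Longrightarrow> Min (insert 1 S) \<le> s" using assms by (intro Min_le) auto
qed

context rational_dynamics
begin

lemma inverse_branchesD:
  assumes "inverse_branches c r x n H"
  shows "\<And>w. H 0 w = w"
    "\<And>k. k \<le> n \<Longrightarrow> H k holomorphic_on ball 0 r"
    "\<And>k w. k \<le> n \<Longrightarrow> w \<in> ball 0 r \<Longrightarrow> cmod (H k w) \<le> 2 * r * exp (- c * real k)"
    "\<And>k w. k < n \<Longrightarrow> w \<in> ball 0 r \<Longrightarrow> f (chart ((f ^^ (n - Suc k)) x) (H (Suc k) w)) = chart ((f ^^ (n - k)) x) (H k w)"
    "\<And>k w. k < n \<Longrightarrow> w \<in> ball 0 r \<Longrightarrow> 0 < spherical_deriv f (chart ((f ^^ (n - Suc k)) x) (H (Suc k) w))"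
    "\<And>k w. k < n \<Longrightarrow> w \<in> ball 0 r \<Longrightarrow> spherical_deriv f (chart ((f ^^ (n - Suc k)) x) (H (Suc k) w)) \<le>
        spherical_deriv f ((f ^^ (n - Suc k)) x) * exp (2 * exp (- c / 2) ^ Suc k)"
  using assms unfolding inverse_branches_def by blast+

lemma inverse_branches_orbit:
  assumes H: "inverse_branches c r x n H" and w: "w \<in> ball 0 r"
  shows "j \<le> k \<Longrightarrow> k \<le> n \<Longrightarrow>
    (f ^^ j) (chart ((f ^^ (n - k)) x) (H k w)) = chart ((f ^^ (n - (k - j))) x) (H (k - j) w)"
proof (induction j)
  case (Suc j)
  then have IH: "(f ^^ j) (chart ((f ^^ (n - k)) x) (H k w)) = chart ((f ^^ (n - (k - j))) x) (H (k - j) w)" by simp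
  have e: "k - j = Suc (k - Suc j)" and l: "k - Suc j < n" using Suc.prems by auto
  have "f (chart ((f ^^ (n - (k - j))) x) (H (k - j) w)) = chart ((f ^^ (n - (k - Suc j))) x) (H (k - Suc j) w)"
    unfolding e by (rule inverse_branchesD(4)[OF H l w])
  then show ?case using IH by simp
qed simp

text \<open>Contraction of a return branch gives a repelling periodic point near \<open>b\<close>; a homoclinic point
  provides several preimages of it nearby at the same time, and these are perturbed to preimages of \<open>b\<close>.\<close>

lemma three_preimages:
  assumes c: "c > 0" and r: "r > 0" "r \<le> 1/4"
    and branches: "\<And>n. n \<in> R \<Longrightarrow> \<exists>H. inverse_branches c r x n H"
    and inf: "infinite {n\<in>R. dist ((f ^^ n) x) b < r / 16}"
  obtains a and Y :: "nat \<Rightarrow> riemann_sphere" where "inj_on Y {..<3}"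
    "\<And>j. j < 3 \<Longrightarrow> (f ^^ a) (Y j) = b" "\<And>j. j < 3 \<Longrightarrow> dist (Y j) b < r / 2"
proof -
  have "(\<lambda>n. exp (- c * real n)) \<longlonglongrightarrow> 0" using c by real_asymp
  \<comment> \<open>The value makes the return branch \<open>h\<close> a contraction by 1/4: the
    chart costs a factor 8 and the Cauchy estimate \<open>4 * (2 * r * e) / r\<close>, together
    \<open>64 * e\<close>.\<close>
  from LIMSEQ_D[OF this, of "1/256"] obtain T0 where T0: "\<And>n. n \<ge> T0 \<Longrightarrow> exp (- c * real n) \<le> 1/256"
    by auto (meson less_imp_le)
  let ?R1 = "{n\<in>R. dist ((f ^^ n) x) b < r / 16}"
  have "?R1 \<noteq> {}" using infinite_imp_nonempty[OF inf] .
  then obtain n where n: "n \<in> ?R1" by blast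
  obtain n' where n': "n' \<in> ?R1" "n' > n + T0" using inf unfolding infinite_nat_iff_unbounded by blast
  define T where "T = n' - n"
  have T: "T > 0" "T \<ge> T0" "T \<le> n'" "n' - T = n" using n'(2) by (auto simp: T_def)
  define e where "e = exp (- c * real T)"
  have e: "e \<le> 1/256" "e > 0" using T0[OF T(2)] by (simp_all add: e_def)
  obtain H where H: "inverse_branches c r x n' H" using branches n' by blast
  define X1 where "X1 = (f ^^ n) x"
  define X2 where "X2 = (f ^^ n') x"
  have d1: "dist X1 b < r / 16" and d2: "dist X2 b < r / 16" using n n' by (auto simp: X1_def X2_def)
  define K where "K = cball b (r / 4)"
  define h where "h s = chart X1 (H T (coord X2 s))" for s
  have coordK: "chart X2 (coord X2 s) = s" "coord X2 s \<in> cball 0 (r / 2)" "coord X2 s \<in> ball 0 r" if "s \<in> K" for s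
  proof -
    have "dist X2 s \<le> dist X2 b + dist b s" by (rule dist_triangle)
    then have d: "dist X2 s < r / 2" using d2 that r unfolding K_def mem_cball by linarith
    then have "dist X2 s < 1" using r by linarith
    from chart_coord[OF this] show "chart X2 (coord X2 s) = s" "coord X2 s \<in> cball 0 (r / 2)" "coord X2 s \<in> ball 0 r"
      using d r by auto
  qed
  have HT: "cmod (H T w) \<le> 2 * r * e" if "w \<in> ball 0 r" for w
    using inverse_branchesD(3)[OF H T(3) that] by (simp add: e_def)
  have hnear: "dist (h s) b < r / 8" if "s \<in> K" for s
  proof -
    have "dist (h s) X1 \<le> 8 * cmod (H T (coord X2 s))" unfolding h_def by (rule dist_chart_center_le)
    also have "\<dots> \<le> 8 * (2 * r * e)" by (intro mult_left_mono HT coordK(3)[OF that]) simp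
    also have "\<dots> \<le> 8 * (2 * r * (1/256))" using e r by (intro mult_left_mono) auto
    finally have "dist (h s) X1 \<le> r / 16" by simp
    then show ?thesis using dist_triangle[of "h s" b X1] d1 by linarith
  qed
  have hK: "h s \<in> K" if "s \<in> K" for s
    using hnear[OF that] r by (simp add: K_def dist_commute)
  have orbit: "(f ^^ j) (chart X1 (H T w)) = chart ((f ^^ (n' - (T - j))) x) (H (T - j) w)" if "j \<le> T" "w \<in> ball 0 r" for j w
    using inverse_branches_orbit[OF H that(2) that(1) T(3)] T(4) by (simp add: X1_def)
  have fh: "(f ^^ T) (h s) = s" if "s \<in> K" for s
    using orbit[of T "coord X2 s"] coordK[OF that] inverse_branchesD(1)[OF H] by (simp add: h_def X2_def)
  have lip: "dist (h s) (h t) \<le> 1/4 * dist s t" if "s \<in> K" "t \<in> K" for s t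
  proof -
    let ?u = "coord X2 s" and ?v = "coord X2 t"
    have "dist (h s) (h t) \<le> 8 * cmod (H T ?u - H T ?v)" unfolding h_def by (rule dist_chart_le)
    also have "\<dots> \<le> 8 * (4 * (2 * r * e) / r * cmod (?u - ?v))"
      by (intro mult_left_mono lipschitz_half_ball[OF inverse_branchesD(2)[OF H T(3)] r(1) HT] coordK that) auto
    also have "\<dots> = 64 * e * cmod (?u - ?v)" using r by simp
    also have "\<dots> \<le> 64 * (1/256) * dist s t"
    proof (rule mult_mono)
      have "cmod ?u \<le> 1" "cmod ?v \<le> 1" using coordK(3)[OF that(1)] coordK(3)[OF that(2)] r by auto
      then have "cmod (?u - ?v) \<le> dist (chart X2 ?u) (chart X2 ?v)"
        unfolding dist_chart by (rule cmod_le_dist_Point)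
      then show "cmod (?u - ?v) \<le> dist s t" unfolding coordK(1)[OF that(1)] coordK(1)[OF that(2)] .
    qed (use e in auto)
    finally show ?thesis by simp
  qed
  have "compact K" unfolding K_def using compact_Int_closed[OF compact_riemann_sphere closed_cball] by simp
  then have "\<exists>!q\<in>K. h q = q"
    using r lip hK by (intro Banach_fix[of K "1/4" h] compact_imp_complete) (auto simp: K_def)
  then obtain q0 where q0: "q0 \<in> K" "h q0 = q0" by blast
  have fq: "(f ^^ T) q0 = q0" using fh[OF q0(1)] q0(2) by simp
  have hpow: "(h ^^ k) s \<in> K \<and> dist ((h ^^ k) s) q0 \<le> (1/4) ^ k * dist s q0 \<and> (f ^^ (T * k)) ((h ^^ k) s) = s"
    if "s \<in> K" for k s
  proof (induction k)
    case (Suc k)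
    let ?y = "(h ^^ k) s"
    have "dist (h ?y) (h q0) \<le> 1/4 * dist ?y q0" using Suc q0 by (intro lip) auto
    moreover have "(f ^^ (T * Suc k)) (h ?y) = s"
    proof -
      have "T * Suc k = T * k + T" by simp
      then have "(f ^^ (T * Suc k)) (h ?y) = (f ^^ (T * k)) ((f ^^ T) (h ?y))" by (simp only: funpow_add o_apply)
      then show ?thesis using Suc fh[of ?y] by simp
    qed
    ultimately show ?case using Suc hK[of ?y] q0(2) by simp
  qed (use that in simp)
  have hlim: "(\<lambda>k. (h ^^ k) s) \<longlonglongrightarrow> q0" if "s \<in> K" for s
  proof (rule tendsto_dist_iff[THEN iffD2], rule tendsto_sandwich[OF _ _ tendsto_const])
    have "(\<lambda>k. (1/4 :: real) ^ k * dist s q0) \<longlonglongrightarrow> 0 * dist s q0"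
      by (intro tendsto_mult tendsto_const LIMSEQ_realpow_zero) auto
    then show "(\<lambda>k. (1/4 :: real) ^ k * dist s q0) \<longlonglongrightarrow> 0" by simp
    show "\<forall>\<^sub>F k in sequentially. dist ((h ^^ k) s) q0 \<le> (1/4) ^ k * dist s q0"
      using hpow[OF that] by (intro always_eventually allI) blast
  qed simp
  \<comment> \<open>The point \<open>?z\<close> preceding \<open>q0\<close> on its cycle lies on the
    inverse branch and so is not critical; hence \<open>q0\<close> has a second preimage, and
    surjectivity pulls it back by the remaining \<open>T - 1\<close> steps.\<close>
  obtain q1 where q1: "q1 \<noteq> q0" "(f ^^ T) q1 = q0"
  proof -
    let ?z = "(f ^^ (T - 1)) q0"
    have Tm: "T = Suc (T - 1)" using T by simp
    have "?z = chart ((f ^^ (n' - Suc 0)) x) (H (Suc 0) (coord X2 q0))"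
      using orbit[of "T - 1" "coord X2 q0"] coordK(3)[OF q0(1)] T(1) q0(2) by (simp add: h_def)
    then have "spherical_deriv f ?z > 0"
      using inverse_branchesD(5)[OF H, of 0 "coord X2 q0"] coordK(3)[OF q0(1)] T by simp
    then obtain z' where z': "z' \<noteq> ?z" "f z' = f ?z" using other_preimage[of ?z] by auto
    have fz: "f ?z = q0" using fq Tm by (metis funpow.simps(2) o_apply)
    obtain q1 where q1: "(f ^^ (T - 1)) q1 = z'" using funpow_surj by blast
    have "(f ^^ T) q1 = q0" using q1 z'(2) fz Tm by (metis funpow.simps(2) o_apply)
    moreover have "q1 \<noteq> q0" using q1 z' by auto
    ultimately show ?thesis by (rule that[rotated])
  qed
  obtain s1 where s1: "s1 \<in> K" "s1 \<noteq> q0"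
  proof (cases "b = q0")
    case False
    then show ?thesis using that[of b] r by (simp add: K_def)
  next
    case True
    define w where "w = complex_of_real (r / 32)"
    have w: "cmod w = r / 32" using r by (simp add: w_def norm_of_real del: of_real_divide)
    have "dist b (chart b w) \<le> 8 * cmod w" by (rule dist_chart_center_le)
    then have "chart b w \<in> K" using w r by (simp add: K_def)
    moreover have "chart b w \<noteq> q0" using chart_eq_iff[of b w 0] w r True by auto
    ultimately show ?thesis by (rule that)
  qed
  obtain y k where y: "y \<noteq> q0" "dist y q0 < r / 8" "(f ^^ (T * k)) y = q0"
    using ex_homoclinic[OF fq q1 hlim[OF s1(1)], of s1 "r / 8"] hpow[OF s1(1)] s1(2) r by auto
  have q0b: "dist q0 b < r / 8" using hnear[OF q0(1)] q0(2) by simp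
  have yK: "y \<in> K" using dist_triangle[of y b q0] y(2) q0b by (simp add: K_def dist_commute)
  have yb: "dist y b < r / 4" using dist_triangle[of y b q0] y(2) q0b by linarith
  \<comment> \<open>The point \<open>(h ^^ j) y\<close> reaches \<open>q0\<close> after
    \<open>T * (k + j)\<close> steps and is there again after every further \<open>T\<close> steps,
    so this one time serves \<open>j = 0, 1, 2\<close>.\<close>
  define N where "N = T * (k + 2)"
  have per: "(f ^^ (T * j)) q0 = q0" for j
    by (induction j) (simp_all add: funpow_add fq)
  have fN: "(f ^^ N) ((h ^^ j) y) = q0" if "j < 3" for j
  proof -
    have "k + 2 = (2 - j) + (k + j)" using that by simp
    then have "N = T * (2 - j) + (T * k + T * j)" unfolding N_def by (metis distrib_left)
    then have "(f ^^ N) ((h ^^ j) y) = (f ^^ (T * (2 - j))) ((f ^^ (T * k)) ((f ^^ (T * j)) ((h ^^ j) y)))"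
      by (simp only: funpow_add o_apply)
    then show ?thesis using hpow[OF yK, of j] y(3) per by simp
  qed
  have nofix: "(h ^^ m) y \<noteq> y" if "m > 0" for m
  proof
    assume eq: "(h ^^ m) y = y"
    have "(1/4::real) ^ m < 1" using that by (simp add: power_less_one_iff)
    moreover have "dist y q0 \<le> (1/4) ^ m * dist y q0" using hpow[OF yK, of m] eq by simp
    moreover have "dist y q0 > 0" using y(1) by simp
    ultimately show False by (metis mult_less_cancel_right2 not_less)
  qed
  \<comment> \<open>\<open>f ^^ (T * i)\<close> undoes \<open>h ^^ i\<close>, so a coincidence would
    make \<open>y\<close> periodic under \<open>h\<close>, although \<open>h\<close> moves it
    strictly towards \<open>q0\<close>.\<close>
  have dist_ne: "(h ^^ i) y \<noteq> (h ^^ j) y" if "i < j" for i j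
  proof
    assume eq: "(h ^^ i) y = (h ^^ j) y"
    have "j = i + (j - i)" using that by simp
    then have "(h ^^ j) y = (h ^^ i) ((h ^^ (j - i)) y)" by (metis funpow_add o_apply)
    then have "(f ^^ (T * i)) ((h ^^ i) y) = (f ^^ (T * i)) ((h ^^ i) ((h ^^ (j - i)) y))" using eq by simp
    then have "y = (h ^^ (j - i)) y" using hpow[OF yK, of i] hpow[of "(h ^^ (j - i)) y" i] hpow[OF yK, of "j - i"] by simp
    then show False using nofix[of "j - i"] that by simp
  qed
  have dist_ne': "(h ^^ i) y \<noteq> (h ^^ j) y" if "i \<noteq> j" for i j
    using that dist_ne[of i j] dist_ne[of j i] by (cases "i < j") auto
  define S where "S = insert (r / 4) ((\<lambda>(i, j). dist ((h ^^ i) y) ((h ^^ j) y)) ` {(i, j). i < 3 \<and> j < 3 \<and> i \<noteq> j})"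
  have "finite {(i, j). i < (3::nat) \<and> j < (3::nat) \<and> i \<noteq> j}"
    by (rule finite_subset[of _ "{..<3} \<times> {..<3}"]) auto
  then have finS: "finite S" by (simp add: S_def)
  have posS: "s > 0" if "s \<in> S" for s
    using that r dist_ne' unfolding S_def by auto
  obtain \<delta> where \<delta>: "\<delta> > 0" "\<And>s. s \<in> S \<Longrightarrow> \<delta> \<le> s" using finite_lower_bound[OF finS posS] by blast
  have "\<exists>d>0. \<forall>s. dist q0 s < d \<longrightarrow> (\<exists>z. dist ((h ^^ j) y) z < \<delta> / 2 \<and> (f ^^ N) z = s)" if "j < 3" for j
    using funpow_open_at[OF fN[OF that], of "\<delta> / 2"] \<delta>(1) by (metis half_gt_zero)
  then obtain D where D: "\<And>j. j < 3 \<Longrightarrow> D j > 0"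
    "\<And>j s. j < 3 \<Longrightarrow> dist q0 s < D j \<Longrightarrow> \<exists>z. dist ((h ^^ j) y) z < \<delta> / 2 \<and> (f ^^ N) z = s" by metis
  obtain d where d: "d > 0" "\<And>s. s \<in> D ` {..<3} \<Longrightarrow> d \<le> s"
    using finite_lower_bound[of "D ` {..<3}"] D(1) by auto
  have bK: "b \<in> K" using r by (simp add: K_def)
  \<comment> \<open>The common image \<open>q0\<close> is replaced by the nearby point
    \<open>(h ^^ l) b\<close>, which \<open>T * l\<close> further steps carry to \<open>b\<close>.
    Openness of the iterate moves the three preimages only slightly.\<close>
  obtain l where l: "dist ((h ^^ l) b) q0 < d"
    using hlim[OF bK] d(1) unfolding lim_sequentially by blast
  have "\<exists>z. dist ((h ^^ j) y) z < \<delta> / 2 \<and> (f ^^ N) z = (h ^^ l) b" if "j < 3" for j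
    using D(2)[OF that, of "(h ^^ l) b"] l d(2)[of "D j"] that by (simp add: dist_commute)
  then obtain Y where Y: "\<And>j. j < 3 \<Longrightarrow> dist ((h ^^ j) y) (Y j) < \<delta> / 2" "\<And>j. j < 3 \<Longrightarrow> (f ^^ N) (Y j) = (h ^^ l) b"
    by metis
  show ?thesis
  proof (rule that[of Y "T * l + N"])
    show "inj_on Y {..<3}"
    proof (rule inj_onI, rule ccontr)
      fix i j assume ij: "i \<in> {..<3::nat}" "j \<in> {..<3::nat}" "Y i = Y j" "i \<noteq> j"
      then have "\<delta> \<le> dist ((h ^^ i) y) ((h ^^ j) y)" by (intro \<delta>(2)) (auto simp: S_def)
      also have "\<dots> \<le> dist ((h ^^ i) y) (Y i) + dist (Y i) ((h ^^ j) y)" by (rule dist_triangle)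
      also have "\<dots> < \<delta> / 2 + \<delta> / 2"
        using Y(1)[of i] Y(1)[of j] ij by (intro add_strict_mono) (auto simp: dist_commute)
      finally show False by simp
    qed
    fix j :: nat assume j: "j < 3"
    show "(f ^^ (T * l + N)) (Y j) = b"
      using Y(2)[OF j] hpow[OF bK, of l] by (simp add: funpow_add)
    have "dist ((h ^^ j) y) b < r / 4"
    proof (cases j)
      case 0
      then show ?thesis using yb by simp
    next
      case (Suc i)
      then show ?thesis using hnear[of "(h ^^ i) y"] hpow[OF yK, of i] r by simp
    qed
    moreover have "\<delta> \<le> r / 4" by (rule \<delta>(2)) (simp add: S_def)
    ultimately show "dist (Y j) b < r / 2"
      using dist_triangle[of "Y j" b "(h ^^ j) y"] Y(1)[OF j] \<delta>(1) by (simp add: dist_commute)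
  qed
qed

text \<open>In the coordinate \<kappa> the map \<open>f ^^ a\<close> is \<open>w ^ m\<close>, so
  inverting it along the branch means taking an \<open>m\<close>-th root of \<open>\<Theta>\<close>.
  The hypothesis \<open>miss\<close> makes \<open>\<Theta>\<close> free of zeros on the disc, where
  a holomorphic root exists even if \<open>y\<close> is ramified over \<open>b\<close>.\<close>

lemma extended_branch:
  assumes F: "F holomorphic_on ball 0 r" "\<And>w. w \<in> ball 0 r \<Longrightarrow> cmod (F w) \<le> \<epsilon>"
    and r: "r \<le> 1/4" and near: "\<And>w. w \<in> ball 0 \<delta> \<Longrightarrow> dist x2 (chart y w) < r" and \<delta>: "\<delta> > 0"
    and close: "dist b x1 + 8 * \<epsilon> < 1" "dist b x1 + 8 * \<epsilon> < s ^ m"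
    and \<kappa>: "\<kappa> holomorphic_on ball 0 \<sigma>" "\<And>w. w \<in> ball 0 \<sigma> \<Longrightarrow> (f ^^ a) (chart y (\<kappa> w)) = chart b (w ^ m)"
      "\<And>w. cmod w < s \<Longrightarrow> cmod (\<kappa> w) < \<tau>" "0 < s" "s \<le> \<sigma>" "m > 0"
    and miss: "\<And>w. w \<in> ball 0 \<delta> \<Longrightarrow> chart x1 (F (coord x2 (chart y w))) \<noteq> b"
  obtains E where "E holomorphic_on ball 0 \<delta>" "\<And>w. w \<in> ball 0 \<delta> \<Longrightarrow> cmod (E w) < \<tau>"
    "\<And>w. w \<in> ball 0 \<delta> \<Longrightarrow> (f ^^ a) (chart y (E w)) = chart x1 (F (coord x2 (chart y w)))"
proof -
  define v where "v w = coord x2 (chart y w)" for w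
  have v: "v w \<in> ball 0 r" if "w \<in> ball 0 \<delta>" for w
    using chart_coord(3)[of x2 "chart y w"] near[OF that] r by (simp add: v_def)
  have vhol: "v holomorphic_on ball 0 \<delta>"
    unfolding v_def using near r by (intro rational_curve_coord_holomorphic rational_curve_chart) force
  have Fv: "(\<lambda>w. F (v w)) holomorphic_on ball 0 \<delta>"
  proof -
    have "v ` ball 0 \<delta> \<subseteq> ball 0 r" using v by blast
    from holomorphic_on_compose_gen[OF vhol F(1) this] show ?thesis by (simp only: o_def)
  qed
  have db: "dist b (chart x1 (F (v w))) < min 1 (s ^ m)" if "w \<in> ball 0 \<delta>" for w
  proof -
    have "dist b (chart x1 (F (v w))) \<le> dist b x1 + dist x1 (chart x1 (F (v w)))" by (rule dist_triangle)
    moreover have "dist x1 (chart x1 (F (v w))) \<le> 8 * cmod (F (v w))" by (rule dist_chart_center_le)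
    moreover have "cmod (F (v w)) \<le> \<epsilon>" by (rule F(2)[OF v[OF that]])
    ultimately show ?thesis using close by simp
  qed
  define \<Theta> where "\<Theta> w = coord b (chart x1 (F (v w)))" for w
  have \<Theta>: "chart b (\<Theta> w) = chart x1 (F (v w))" "cmod (\<Theta> w) < s ^ m" "\<Theta> w \<noteq> 0" if "w \<in> ball 0 \<delta>" for w
  proof -
    have d: "dist b (chart x1 (F (v w))) < 1" using db[OF that] by simp
    show 1: "chart b (\<Theta> w) = chart x1 (F (v w))" unfolding \<Theta>_def by (rule chart_coord(1)[OF d])
    have "cmod (\<Theta> w) \<le> dist b (chart x1 (F (v w)))" unfolding \<Theta>_def by (rule chart_coord(3)[OF d])
    then show "cmod (\<Theta> w) < s ^ m" using db[OF that] by simp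
    show "\<Theta> w \<noteq> 0" using 1 miss[OF that] unfolding v_def by (metis chart_0)
  qed
  have "(\<lambda>z. coord b (chart x1 z)) holomorphic_on {z. dist b (chart x1 z) < 1}"
    by (intro rational_curve_coord_holomorphic rational_curve_chart) simp
  from holomorphic_on_compose_gen[OF Fv this] have \<Theta>hol: "\<Theta> holomorphic_on ball 0 \<delta>"
    unfolding \<Theta>_def[abs_def] o_def using db by force
  obtain Rt where Rt: "Rt holomorphic_on ball 0 \<delta>" "\<And>w. w \<in> ball 0 \<delta> \<Longrightarrow> Rt w ^ m = \<Theta> w"
    using holomorphic_root_ball[OF \<Theta>hol \<Theta>(3) \<delta> \<kappa>(6)] by blast
  have Rs: "cmod (Rt w) < s" if "w \<in> ball 0 \<delta>" for w
  proof -
    have "cmod (Rt w) ^ m < s ^ m" using \<Theta>(2)[OF that] Rt(2)[OF that] by (simp add: norm_power[symmetric])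
    then show ?thesis using \<kappa>(4) by (simp add: power_less_imp_less_base)
  qed
  show ?thesis
  proof (rule that)
    show "(\<lambda>w. \<kappa> (Rt w)) holomorphic_on ball 0 \<delta>"
      using holomorphic_on_compose_gen[OF Rt(1) \<kappa>(1)] Rs \<kappa>(5) by (force simp: o_def)
    fix w assume w: "w \<in> ball (0::complex) \<delta>"
    show "cmod (\<kappa> (Rt w)) < \<tau>" by (rule \<kappa>(3)[OF Rs[OF w]])
    have "Rt w \<in> ball 0 \<sigma>" using Rs[OF w] \<kappa>(5) by simp
    then show "(f ^^ a) (chart y (\<kappa> (Rt w))) = chart x1 (F (coord x2 (chart y w)))"
      using \<kappa>(2) Rt(2)[OF w] \<Theta>(1)[OF w] by (simp add: v_def)
  qed
qed

end

section \<open>The horseshoe of a generic orbit\<close>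

context rational_dynamics
begin

text \<open>At \<open>k\<close> steps before time \<open>n\<close> the branch is within a multiple
  of \<open>exp (- c * k)\<close> of the orbit of \<open>x\<close>, so Hoelder and distortion errors
  form geometric series bounded independently of \<open>T\<close> and \<open>n\<close>. The cutoff
  \<epsilon> is inactive along the orbit of \<open>x\<close> itself.\<close>

lemma branch_birkhoff_sum_ge:
  assumes H: "inverse_branches c r x n H" and c: "c > 0" and r: "r > 0" and T: "T \<le> n" and w: "w \<in> ball 0 r"
    and J: "\<And>k. (f ^^ k) x \<in> julia_set f"
      "\<And>k. (f ^^ k) (chart ((f ^^ (n - T)) x) (H T w)) \<in> julia_set f"
    and holder: "\<And>x y. x \<in> julia_set f \<Longrightarrow> y \<in> julia_set f \<Longrightarrow> \<bar>\<phi> x - \<phi> y\<bar> \<le> C * dist x y powr \<alpha>"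
      "\<alpha> > 0" "C \<ge> 0"
    and t: "t \<ge> 0" and \<epsilon>: "\<epsilon> > 0" "\<And>k. k < n \<Longrightarrow> \<epsilon> \<le> spherical_deriv f ((f ^^ k) x)"
  shows "birkhoff_sum f (\<lambda>z. \<phi> z - t * ln (max (spherical_deriv f z) \<epsilon>)) T (chart ((f ^^ (n - T)) x) (H T w)) \<ge>
    birkhoff_sum f (\<lambda>z. \<phi> z - t * log_deriv z) T ((f ^^ (n - T)) x) -
      (C * (16 * r) powr \<alpha> / (1 - exp (- c * \<alpha>)) + 2 * t / (1 - exp (- c / 2)))"
proof -
  define y where "y = chart ((f ^^ (n - T)) x) (H T w)"
  define A where "A = C * (16 * r) powr \<alpha>"
  define q where "q = exp (- c * \<alpha>)"
  define \<theta> where "\<theta> = exp (- c / 2)"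
  have A: "A \<ge> 0" using holder(3) by (simp add: A_def)
  have q: "0 \<le> q" "q < 1" using c holder(2) by (simp_all add: q_def)
  have \<theta>: "0 \<le> \<theta>" "\<theta> < 1" using c by (simp_all add: \<theta>_def)
  have step: "\<phi> ((f ^^ i) y) - t * ln (max (spherical_deriv f ((f ^^ i) y)) \<epsilon>) \<ge>
      \<phi> ((f ^^ i) ((f ^^ (n - T)) x)) - t * log_deriv ((f ^^ i) ((f ^^ (n - T)) x)) -
      (A * q ^ (T - Suc i) + 2 * t * \<theta> ^ (T - Suc i))" if i: "i < T" for i
  proof -
    define k where "k = T - Suc i"
    have k: "T - i = Suc k" "Suc k \<le> n" "k < n" using i T by (auto simp: k_def)
    define z where "z = (f ^^ (n - Suc k)) x"
    have z: "(f ^^ i) ((f ^^ (n - T)) x) = z"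
    proof -
      have "n - Suc k = i + (n - T)" using i T by (auto simp: k_def)
      then show ?thesis by (simp add: z_def funpow_add)
    qed
    have yi: "(f ^^ i) y = chart z (H (Suc k) w)"
      using inverse_branches_orbit[OF H w, of i T] i T by (simp add: y_def z_def k(1))
    have "dist ((f ^^ i) y) z \<le> 8 * cmod (H (Suc k) w)" unfolding yi by (rule dist_chart_center_le)
    also have "\<dots> \<le> 8 * (2 * r * exp (- c * real (Suc k)))"
      by (intro mult_left_mono inverse_branchesD(3)[OF H k(2) w]) simp
    also have "\<dots> \<le> 16 * r * exp (- c * real k)" using c r by simp
    finally have "dist ((f ^^ i) y) z powr \<alpha> \<le> (16 * r * exp (- c * real k)) powr \<alpha>"
      using holder(2) by (intro powr_mono2) auto
    also have "\<dots> = (16 * r) powr \<alpha> * q ^ k"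
      using r by (simp add: powr_mult q_def exp_powr_real algebra_simps flip: exp_of_nat_mult)
    finally have "C * dist ((f ^^ i) y) z powr \<alpha> \<le> A * q ^ k"
      using mult_left_mono[OF _ holder(3)] by (simp add: A_def mult.assoc)
    moreover have "\<bar>\<phi> ((f ^^ i) y) - \<phi> z\<bar> \<le> C * dist ((f ^^ i) y) z powr \<alpha>"
      using J by (intro holder(1)) (simp_all add: y_def z_def)
    ultimately have 1: "\<phi> ((f ^^ i) y) \<ge> \<phi> z - A * q ^ k" by linarith
    have \<epsilon>z: "\<epsilon> \<le> spherical_deriv f z" unfolding z_def using k by (intro \<epsilon>(2)) simp
    have "spherical_deriv f ((f ^^ i) y) \<le> spherical_deriv f z * exp (2 * \<theta> ^ Suc k)"
      using inverse_branchesD(6)[OF H k(3) w] by (simp add: yi z_def \<theta>_def)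
    moreover have "\<epsilon> \<le> spherical_deriv f z * exp (2 * \<theta> ^ Suc k)"
    proof -
      have "spherical_deriv f z * 1 \<le> spherical_deriv f z * exp (2 * \<theta> ^ Suc k)"
        using \<epsilon>(1) \<epsilon>z \<theta> by (intro mult_left_mono) auto
      then show ?thesis using \<epsilon>z by simp
    qed
    ultimately have "ln (max (spherical_deriv f ((f ^^ i) y)) \<epsilon>) \<le> ln (spherical_deriv f z * exp (2 * \<theta> ^ Suc k))"
      using \<epsilon>(1) by (intro ln_mono) auto
    also have "\<dots> = log_deriv z + 2 * \<theta> ^ Suc k" using \<epsilon>(1) \<epsilon>z by (simp add: ln_mult)
    also have "\<theta> ^ Suc k \<le> \<theta> ^ k" using \<theta> by (intro power_decreasing) auto
    finally have "ln (max (spherical_deriv f ((f ^^ i) y)) \<epsilon>) \<le> log_deriv z + 2 * \<theta> ^ k" by simp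
    from mult_left_mono[OF this t] have 2: "t * ln (max (spherical_deriv f ((f ^^ i) y)) \<epsilon>) \<le> t * log_deriv z + 2 * t * \<theta> ^ k"
      by (simp add: algebra_simps)
    show ?thesis unfolding z k_def[symmetric] using 1 2 by linarith
  qed
  have "(\<Sum>i<T. A * q ^ (T - Suc i) + 2 * t * \<theta> ^ (T - Suc i)) = A * (\<Sum>i<T. q ^ i) + 2 * t * (\<Sum>i<T. \<theta> ^ i)"
    by (simp add: sum.distrib sum_distrib_left[symmetric] sum.nat_diff_reindex)
  also have "\<dots> \<le> A * (1 / (1 - q)) + 2 * t * (1 / (1 - \<theta>))"
    using A t q \<theta> by (intro add_mono mult_left_mono geometric_partial_sum_le) auto
  finally have err: "(\<Sum>i<T. A * q ^ (T - Suc i) + 2 * t * \<theta> ^ (T - Suc i)) \<le> A / (1 - q) + 2 * t / (1 - \<theta>)" by simp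
  have "(\<Sum>i<T. \<phi> ((f ^^ i) ((f ^^ (n - T)) x)) - t * log_deriv ((f ^^ i) ((f ^^ (n - T)) x)) -
      (A * q ^ (T - Suc i) + 2 * t * \<theta> ^ (T - Suc i))) \<le>
    (\<Sum>i<T. \<phi> ((f ^^ i) y) - t * ln (max (spherical_deriv f ((f ^^ i) y)) \<epsilon>))"
    by (intro sum_mono step) simp
  then show ?thesis
    using err unfolding birkhoff_sum_def y_def[symmetric] A_def[symmetric] q_def[symmetric] \<theta>_def[symmetric] sum_subtractf[of _ "\<lambda>i. A * q ^ (T - Suc i) + 2 * t * \<theta> ^ (T - Suc i)"]
    by linarith
qed

text \<open>The bound \<open>\<delta> / 64\<close> on \<kappa> is chosen for the contraction: the
  Cauchy estimate gives \<open>4 / 64\<close> and the chart a factor 8, together 1/2.\<close>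

lemma return_branch:
  assumes H: "inverse_branches c r x n H" and r: "r > 0" "r \<le> 1/4" and i: "i \<le> n" and \<delta>: "0 < \<delta>" "\<delta> \<le> 1"
    and near: "\<And>w. w \<in> ball 0 \<delta> \<Longrightarrow> dist ((f ^^ n) x) (chart y w) < r"
    and close: "dist b ((f ^^ i) x) + 16 * r * exp (- c * real (n - i)) < min 1 (s ^ m)"
    and \<kappa>: "\<kappa> holomorphic_on ball 0 s" "\<And>w. w \<in> ball 0 s \<Longrightarrow> (f ^^ a) (chart y (\<kappa> w)) = chart b (w ^ m)"
      "\<And>w. w \<in> ball 0 s \<Longrightarrow> cmod (\<kappa> w) < \<delta> / 64" "s > 0" "m > 0"
    and miss: "\<And>w. w \<in> ball 0 \<delta> \<Longrightarrow> chart ((f ^^ i) x) (H (n - i) (coord ((f ^^ n) x) (chart y w))) \<noteq> b"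
  shows "\<exists>g. \<forall>u\<in>chart y ` cball 0 (\<delta> / 2). g u \<in> chart y ` cball 0 (\<delta> / 2) \<and>
    (f ^^ a) (g u) = chart ((f ^^ i) x) (H (n - i) (coord ((f ^^ n) x) u)) \<and>
    (\<forall>v\<in>chart y ` cball 0 (\<delta> / 2). dist (g u) (g v) \<le> 1 / 2 * dist u v)"
proof -
  have k: "n - i \<le> n" by simp
  have cl: "dist b ((f ^^ i) x) + 8 * (2 * r * exp (- c * real (n - i))) < 1"
    "dist b ((f ^^ i) x) + 8 * (2 * r * exp (- c * real (n - i))) < s ^ m" using close by auto
  have \<kappa>3: "cmod (\<kappa> w) < \<delta> / 64" if "cmod w < s" for w using \<kappa>(3)[of w] that by simp
  obtain E where E: "E holomorphic_on ball 0 \<delta>" "\<And>w. w \<in> ball 0 \<delta> \<Longrightarrow> cmod (E w) < \<delta> / 64"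
    "\<And>w. w \<in> ball 0 \<delta> \<Longrightarrow> (f ^^ a) (chart y (E w)) = chart ((f ^^ i) x) (H (n - i) (coord ((f ^^ n) x) (chart y w)))"
    using extended_branch[OF inverse_branchesD(2)[OF H k] inverse_branchesD(3)[OF H k] r(2) near \<delta>(1) cl
      \<kappa>(1,2) \<kappa>3 \<kappa>(4) order_refl \<kappa>(5) miss] by blast
  define g where "g u = chart y (E (coord y u))" for u
  have sub: "w \<in> ball 0 \<delta>" if "w \<in> cball (0::complex) (\<delta> / 2)" for w using that \<delta>(1) by simp
  show ?thesis
  proof (rule exI[of _ g], intro ballI conjI)
    fix u assume "u \<in> chart y ` cball 0 (\<delta> / 2)"
    then obtain w where w: "w \<in> cball 0 (\<delta> / 2)" "u = chart y w" by blast
    have "E w \<in> cball 0 (\<delta> / 2)" using E(2)[OF sub[OF w(1)]] \<delta>(1) by simp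
    then show "g u \<in> chart y ` cball 0 (\<delta> / 2)" by (simp add: g_def w(2))
    show "(f ^^ a) (g u) = chart ((f ^^ i) x) (H (n - i) (coord ((f ^^ n) x) u))"
      using E(3)[OF sub[OF w(1)]] by (simp add: g_def w(2))
    fix v assume "v \<in> chart y ` cball 0 (\<delta> / 2)"
    then obtain w' where w': "w' \<in> cball 0 (\<delta> / 2)" "v = chart y w'" by blast
    have "dist (g u) (g v) \<le> 8 * cmod (E w - E w')" by (simp add: g_def w(2) w'(2) dist_chart_le)
    also have "\<dots> \<le> 8 * (4 * (\<delta> / 64) / \<delta> * cmod (w - w'))"
      by (intro mult_left_mono lipschitz_half_ball[OF E(1) \<delta>(1)] w w' less_imp_le E(2)) auto
    also have "\<dots> = 1 / 2 * cmod (w - w')" using \<delta>(1) by simp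
    also have "cmod (w - w') \<le> dist (Point w) (Point w')"
      using w(1) w'(1) \<delta> by (intro cmod_le_dist_Point) auto
    also have "\<dots> = dist u v" by (simp add: w(2) w'(2) dist_chart)
    finally show "dist (g u) (g v) \<le> 1 / 2 * dist u v" by simp
  qed
qed

text \<open>If the branch for target \<open>j\<close> meets \<open>b\<close>, then
  \<open>(f ^^ (n - i)) b\<close> lies within \<open>9 * \<delta>\<close> of \<open>Y j\<close>. As
  the targets are \<open>18 * \<delta>\<close> apart, this excludes at most one of them; so does
  closeness to \<open>z\<close>, and one of three remains.\<close>

lemma ex_good_target:
  assumes H: "inverse_branches c r x n H" and i: "i \<le> n" and r: "r \<le> 1"
    and sep: "\<And>j l. j < 3 \<Longrightarrow> l < (3::nat) \<Longrightarrow> j \<noteq> l \<Longrightarrow> dist (Y j) (Y l) \<ge> 18 * \<delta>" and \<delta>: "\<delta> > 0"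
    and near: "\<And>j w. j < 3 \<Longrightarrow> w \<in> ball 0 \<delta> \<Longrightarrow> dist ((f ^^ n) x) (chart (Y j) w) < r"
  shows "\<exists>j<3. (\<forall>w\<in>ball 0 \<delta>. chart ((f ^^ i) x) (H (n - i) (coord ((f ^^ n) x) (chart (Y j) w))) \<noteq> b) \<and>
    dist z (Y j) \<ge> 9 * \<delta>"
proof -
  define bad where "bad j \<longleftrightarrow> (\<exists>w\<in>ball 0 \<delta>. chart ((f ^^ i) x) (H (n - i) (coord ((f ^^ n) x) (chart (Y j) w))) = b)" for j
  have bad: "dist ((f ^^ (n - i)) b) (Y j) < 9 * \<delta>" if j: "j < 3" "bad j" for j
  proof -
    obtain w where w: "w \<in> ball 0 \<delta>" "chart ((f ^^ i) x) (H (n - i) (coord ((f ^^ n) x) (chart (Y j) w))) = b"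
      using j(2) unfolding bad_def by blast
    define u where "u = chart (Y j) w"
    have d: "dist ((f ^^ n) x) u < r" using near[OF j(1) w(1)] by (simp add: u_def)
    then have d1: "dist ((f ^^ n) x) u < 1" using r by simp
    have "coord ((f ^^ n) x) u \<in> ball 0 r" using chart_coord(3)[OF d1] d by simp
    from inverse_branches_orbit[OF H this, of "n - i" "n - i"]
    have "(f ^^ (n - i)) (chart ((f ^^ i) x) (H (n - i) (coord ((f ^^ n) x) u))) = chart ((f ^^ n) x) (coord ((f ^^ n) x) u)"
      using i inverse_branchesD(1)[OF H] by simp
    then have "(f ^^ (n - i)) b = u" using w(2) chart_coord(1)[OF d1] by (simp add: u_def)
    moreover have "dist u (Y j) \<le> 8 * cmod w" unfolding u_def by (rule dist_chart_center_le)
    ultimately show ?thesis using w(1) \<delta> by simp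
  qed
  have two: "j = l" if "dist s (Y j) < 9 * \<delta>" "dist s (Y l) < 9 * \<delta>" "j < 3" "l < 3" for j l s
  proof (rule ccontr)
    assume "j \<noteq> l"
    from sep[OF that(3,4) this] show False using that(1,2) dist_triangle3[of "Y j" "Y l" s] by linarith
  qed
  have bad2: "j = l" if "bad j" "bad l" "j < 3" "l < 3" for j l
    using bad that by (intro two[of "(f ^^ (n - i)) b"]) auto
  let ?ok = "\<lambda>j. \<not> bad j \<and> dist z (Y j) \<ge> 9 * \<delta>"
  have "?ok 0 \<or> ?ok 1 \<or> ?ok 2"
    using bad2[of 0 1] bad2[of 0 2] bad2[of 1 2] two[of z 0 1] two[of z 0 2] two[of z 1 2] by force
  then obtain j where j: "j < 3" "?ok j" by (elim disjE) (force intro: that)+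
  then show ?thesis unfolding bad_def by blast
qed

lemma target_coordinates:
  assumes Y: "\<And>j. j < (3::nat) \<Longrightarrow> (f ^^ a) (Y j) = b" and \<delta>: "\<delta> > 0"
  obtains \<kappa> s m \<eta> where "\<eta> > 0"
    "\<And>j. j < 3 \<Longrightarrow> \<kappa> j holomorphic_on ball 0 (s j)"
    "\<And>j w. j < 3 \<Longrightarrow> w \<in> ball 0 (s j) \<Longrightarrow> (f ^^ a) (chart (Y j) (\<kappa> j w)) = chart b (w ^ m j)"
    "\<And>j w. j < 3 \<Longrightarrow> w \<in> ball 0 (s j) \<Longrightarrow> cmod (\<kappa> j w) < \<delta> / 64"
    "\<And>j. j < 3 \<Longrightarrow> s j > 0" "\<And>j. j < 3 \<Longrightarrow> m j > 0" "\<And>j. j < 3 \<Longrightarrow> \<eta> \<le> min 1 (s j ^ m j)"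
proof -
  have "\<exists>\<kappa> s m. \<kappa> holomorphic_on ball 0 s \<and> (\<forall>w\<in>ball 0 s. (f ^^ a) (chart (Y j) (\<kappa> w)) = chart b (w ^ m)) \<and>
      (\<forall>w\<in>ball 0 s. cmod (\<kappa> w) < \<delta> / 64) \<and> s > 0 \<and> m > 0" if j: "j < 3" for j
  proof -
    obtain m \<sigma> \<kappa> where \<kappa>: "m > 0" "\<sigma> > 0" "\<kappa> holomorphic_on ball 0 \<sigma>" "\<kappa> 0 = 0"
      "\<And>w. w \<in> ball 0 \<sigma> \<Longrightarrow> (f ^^ a) (chart (Y j) (\<kappa> w)) = chart b (w ^ m)"
      by (rule funpow_power_coordinate[OF Y[OF j]]) (rule that)
    have "isCont \<kappa> 0"
      using holomorphic_on_imp_continuous_on[OF \<kappa>(3)] \<kappa>(2) by (simp add: continuous_on_eq_continuous_at)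
    moreover have "\<delta> / 64 > 0" using \<delta> by simp
    ultimately obtain e where e: "e > 0" "\<And>w. cmod w < e \<Longrightarrow> cmod (\<kappa> w) < \<delta> / 64"
      unfolding continuous_at_eps_delta using \<kappa>(4) by (metis dist_0_norm dist_commute)
    have sub: "ball 0 (min e \<sigma>) \<subseteq> ball (0::complex) \<sigma>" by auto
    show ?thesis
      by (rule exI[of _ \<kappa>], rule exI[of _ "min e \<sigma>"], rule exI[of _ m])
        (use \<kappa> e holomorphic_on_subset[OF \<kappa>(3) sub] in auto)
  qed
  then obtain \<kappa> s m where \<kappa>: "\<And>j. j < 3 \<Longrightarrow> \<kappa> j holomorphic_on ball 0 (s j) \<and>
      (\<forall>w\<in>ball 0 (s j). (f ^^ a) (chart (Y j) (\<kappa> j w)) = chart b (w ^ m j)) \<and>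
      (\<forall>w\<in>ball 0 (s j). cmod (\<kappa> j w) < \<delta> / 64) \<and> s j > 0 \<and> m j > 0" by metis
  have "\<And>v. v \<in> (\<lambda>j. min 1 (s j ^ m j)) ` {..<3} \<Longrightarrow> v > 0" using \<kappa> by auto
  then obtain \<eta> where \<eta>: "\<eta> > 0" "\<And>v. v \<in> (\<lambda>j. min 1 (s j ^ m j)) ` {..<3} \<Longrightarrow> \<eta> \<le> v"
    using finite_lower_bound[of "(\<lambda>j. min 1 (s j ^ m j)) ` {..<3}"] by blast
  have "\<eta> \<le> min 1 (s j ^ m j)" if "j < 3" for j by (rule \<eta>(2)) (use that in blast)
  then show ?thesis by (intro that[of \<eta> \<kappa> s m]) (use \<eta>(1) \<kappa> in auto)
qed

lemma target_separation:
  assumes "inj_on Y {..<3::nat}" and e: "e > 0"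
  obtains \<delta> where "\<delta> > 0" "\<delta> \<le> e" "\<And>j l. j < 3 \<Longrightarrow> l < 3 \<Longrightarrow> j \<noteq> l \<Longrightarrow> dist (Y j) (Y l :: riemann_sphere) \<ge> 18 * \<delta>"
proof -
  define S where "S = insert e ((\<lambda>(j, l). dist (Y j) (Y l) / 18) ` {(j, l). j < 3 \<and> l < 3 \<and> j \<noteq> l})"
  have "finite {(j, l). j < (3::nat) \<and> l < (3::nat) \<and> j \<noteq> l}"
    by (rule finite_subset[of _ "{..<3} \<times> {..<3}"]) auto
  then have finS: "finite S" by (simp add: S_def)
  have posS: "s > 0" if "s \<in> S" for s
    using that e assms unfolding S_def inj_on_def by auto
  obtain \<delta> where \<delta>: "\<delta> > 0" "\<And>s. s \<in> S \<Longrightarrow> \<delta> \<le> s" using finite_lower_bound[OF finS posS] by blast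
  show ?thesis
  proof (rule that[OF \<delta>(1)])
    show "\<delta> \<le> e" by (rule \<delta>(2)) (simp add: S_def)
    fix j l :: nat assume "j < 3" "l < 3" "j \<noteq> l"
    then have "\<delta> \<le> dist (Y j) (Y l) / 18" by (intro \<delta>(2)) (auto simp: S_def)
    then show "18 * \<delta> \<le> dist (Y j) (Y l)" by simp
  qed
qed

theorem dominating_measure:
  assumes erg: "ergodic_prob f \<mu>" and lyap: "lyapunov_exponent f \<mu> > 0"
    and \<phi>: "holder_continuous_on (julia_set f) \<phi>" and t: "t \<ge> 0"
  obtains \<epsilon> \<nu> h where "\<epsilon> > 0" "invariant_prob f \<nu>" "measure_entropy \<nu> f \<ge> ereal h"
    "h + (\<integral>z. \<phi> z - t * ln (max (spherical_deriv f z) \<epsilon>) \<partial>\<nu>) > (\<integral>z. \<phi> z \<partial>\<mu>) - t * (\<integral>z. log_deriv z \<partial>\<mu>)"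
proof -
  have inv: "invariant_prob f \<mu>" using erg by (simp add: ergodic_prob_def)
  interpret prob_space \<mu> using inv unfolding invariant_prob_def by (rule conjunct1)
  have sets: "sets \<mu> = sets (restrict_space borel (julia_set f))" and "f \<in> measurable \<mu> \<mu>"
    using inv by (auto simp: invariant_prob_def)
  then have fm: "f \<in> measurable (restrict_space borel (julia_set f)) (restrict_space borel (julia_set f))"
    using measurable_cong_sets[OF sets sets] by simp
  have fJ: "(f ^^ k) z \<in> julia_set f" if "z \<in> julia_set f" for k z
    using measurable_space[OF funpow_measurable[OF fm], of z k] that by (simp add: space_restrict_space)
  note lm = lyapunov_exponent_real[OF inv lyap]
  obtain B where B: "B \<ge> 0" "\<And>z. z \<in> julia_set f \<Longrightarrow> \<bar>\<phi> z\<bar> \<le> B"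
    by (rule holder_bounded[OF \<phi>]) (rule that)
  obtain \<alpha> C where holder: "0 < \<alpha>" "\<alpha> \<le> 1" "C \<ge> 0"
    "\<And>x y. x \<in> julia_set f \<Longrightarrow> y \<in> julia_set f \<Longrightarrow> \<bar>\<phi> x - \<phi> y\<bar> \<le> C * dist x y powr \<alpha>"
    by (rule holder_facts[OF \<phi>]) (rule that)
  obtain \<Lambda> where \<Lambda>: "\<Lambda> > 1" "\<And>x. 0 \<le> spherical_deriv f x" "\<And>x. spherical_deriv f x \<le> \<Lambda>"
    by (rule spherical_deriv_bounds) (rule that)
  have spJ: "space \<mu> = julia_set f" using sets_eq_imp_space_eq[OF sets] by (simp add: space_restrict_space)
  have \<phi>m: "\<phi> \<in> borel_measurable (restrict_space borel (julia_set f))" by (rule holder_continuous[OF \<phi>])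
  have \<phi>m': "\<phi> \<in> borel_measurable \<mu>" using \<phi>m measurable_cong_sets[OF sets refl] by blast
  have \<phi>int: "integrable \<mu> \<phi>"
    by (rule integrable_const_bound[where B = B]) (use B spJ \<phi>m' in auto)
  define P0 where "P0 = (\<integral>z. \<phi> z \<partial>\<mu>) - t * (\<integral>z. log_deriv z \<partial>\<mu>)"
  \<comment> \<open>Normalised to mean 0, so that low predecessors for the sums of \<open>u\<close>
    are the times from which the potential gains at least \<open>P0\<close> per step, up to the
    constant 1.\<close>
  define u where "u z = \<phi> z - t * log_deriv z - P0" for z
  have uint: "integrable \<mu> u" unfolding u_def using \<phi>int lm(2) by simp
  have u0: "(\<integral>z. u z \<partial>\<mu>) = 0"
    unfolding u_def using \<phi>int lm(2) by (simp add: P0_def prob_space)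
  obtain c L x where c: "c > 0" and x: "x \<in> julia_set f" "\<And>k. spherical_deriv f ((f ^^ k) x) > 0"
    and R0: "pos_upper_density {n. hyperbolic_time c L x n}"
    and low: "\<And>e. e > 0 \<Longrightarrow> \<exists>K. \<forall>n. birkhoff_sum f u n x \<ge> - e * real n - K"
    by (rule generic_point[OF erg lyap uint u0]) (rule that)
  obtain r where r: "r > 0" "r \<le> 1/4" and H0: "\<And>n. hyperbolic_time c L x n \<Longrightarrow> \<exists>H. inverse_branches c r x n H"
    by (rule hyperbolic_branches[OF c, where L = L]) (rule that)
  obtain b where b: "\<And>\<rho>. \<rho> > 0 \<Longrightarrow> pos_upper_density {n\<in>{n. hyperbolic_time c L x n}. dist ((f ^^ n) x) b < \<rho>}"
    by (rule density_accumulation_point[OF R0]) (rule that)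
  have inf: "infinite {n\<in>{n. hyperbolic_time c L x n}. dist ((f ^^ n) x) b < r / 16}"
    using b[of "r / 16"] r not_pos_upper_density_finite by (meson divide_pos_pos zero_less_numeral)
  obtain a and Y :: "nat \<Rightarrow> riemann_sphere" where Y: "inj_on Y {..<3}"
    "\<And>j. j < 3 \<Longrightarrow> (f ^^ a) (Y j) = b" "\<And>j. j < 3 \<Longrightarrow> dist (Y j) b < r / 2"
    by (rule three_preimages[OF c r _ inf]) (rule H0, simp, rule that)
  obtain \<delta> where \<delta>: "\<delta> > 0" "\<delta> \<le> r / 32"
    and sep: "\<And>j l. j < 3 \<Longrightarrow> l < 3 \<Longrightarrow> j \<noteq> l \<Longrightarrow> dist (Y j) (Y l) \<ge> 18 * \<delta>"
    using target_separation[OF Y(1), of "r / 32"] r by auto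
  obtain \<kappa> s m \<eta> where \<eta>: "\<eta> > 0" and \<kappa>:
    "\<And>j. j < 3 \<Longrightarrow> \<kappa> j holomorphic_on ball 0 (s j)"
    "\<And>j w. j < 3 \<Longrightarrow> w \<in> ball 0 (s j) \<Longrightarrow> (f ^^ a) (chart (Y j) (\<kappa> j w)) = chart b (w ^ m j)"
    "\<And>j w. j < 3 \<Longrightarrow> w \<in> ball 0 (s j) \<Longrightarrow> cmod (\<kappa> j w) < \<delta> / 64"
    "\<And>j. j < 3 \<Longrightarrow> s j > 0" "\<And>j. j < 3 \<Longrightarrow> m j > 0" and \<eta>': "\<And>j. j < 3 \<Longrightarrow> \<eta> \<le> min 1 (s j ^ m j)"
    by (rule target_coordinates[where a = a and Y = Y and b = b, OF _ \<delta>(1)]) (erule Y(2), rule that)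
  \<comment> \<open>Half of \<eta> is reserved for the distance from \<open>(f ^^ i) x\<close> to
    \<open>b\<close>, the other half for the size of the pulled back disc.\<close>
  define \<rho> where "\<rho> = min (r / 16) (\<eta> / 2)"
  have \<rho>: "\<rho> > 0" "\<rho> \<le> r / 16" "\<rho> \<le> \<eta> / 2" using r \<eta> by (auto simp: \<rho>_def)
  have "(\<lambda>n. 16 * r * exp (- c * real n)) \<longlonglongrightarrow> 0" using c by real_asymp
  moreover have "min (\<eta> / 2) \<delta> > 0" using \<eta> \<delta> by simp
  ultimately have "\<forall>\<^sub>F n in sequentially. 16 * r * exp (- c * real n) < min (\<eta> / 2) \<delta>" by (rule order_tendstoD)
  then obtain Q0 where Q0: "\<And>n. n \<ge> Q0 \<Longrightarrow> 16 * r * exp (- c * real n) < min (\<eta> / 2) \<delta>"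
    unfolding eventually_sequentially by blast
  \<comment> \<open>\<open>Q0\<close> makes the pulled back discs small after \<open>Q\<close>
    steps; \<open>Suc a\<close> keeps any two chosen times more than \<open>a\<close> apart, so that
    the detour fits between them.\<close>
  define Q where "Q = max Q0 (Suc a)"
  obtain R where R: "R \<subseteq> {n\<in>{n. hyperbolic_time c L x n}. dist ((f ^^ n) x) b < \<rho>} \<inter> {a..}" "pos_upper_density R"
    "\<And>i j. i \<in> R \<Longrightarrow> j \<in> R \<Longrightarrow> i < j \<Longrightarrow> i + Q \<le> j"
    by (rule pos_upper_density_sparse_subset[OF pos_upper_density_tail[OF b[OF \<rho>(1)], of a], of Q]) (simp add: Q_def, rule that)
  define C1 where "C1 = C * (16 * r) powr \<alpha> / (1 - exp (- c * \<alpha>)) + 2 * t / (1 - exp (- c / 2))"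
  \<comment> \<open>The loss of one branch: 1 from the choice of a low predecessor,
    \<open>C1\<close> from distortion, and the rest from a crude bound for the \<open>a\<close>
    steps of the detour. It does not depend on \<open>n\<close>, so \<open>M\<close> can be chosen
    before \<open>n\<close>.\<close>
  define C2 where "C2 = 1 + C1 + real a * (B + t * ln \<Lambda> + \<bar>P0\<bar>)"
  have "C1 \<ge> 0" unfolding C1_def using c t holder by (intro add_nonneg_nonneg divide_nonneg_nonneg mult_nonneg_nonneg) auto
  moreover have "real a * (B + t * ln \<Lambda> + \<bar>P0\<bar>) \<ge> 0" using B(1) t \<Lambda>(1) by (intro mult_nonneg_nonneg add_nonneg_nonneg) auto
  ultimately have C2: "C2 \<ge> 0" by (simp add: C2_def)
  obtain M :: nat where M: "real M > exp C2" using reals_Archimedean2 by blast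
  define sm where "sm n = birkhoff_sum f u n x" for n
  \<comment> \<open>The factor 3 is for the pigeonhole over the three targets.\<close>
  obtain n where n: "n \<in> R" "card {i\<in>R. i < n \<and> sm i \<le> sm n + 1} \<ge> 3 * M"
    using many_low_predecessors[OF R(2) zero_less_one, of sm "3 * M"] low unfolding sm_def by blast
  define S where "S = {i\<in>R. i < n \<and> sm i \<le> sm n + 1}"
  have nR: "hyperbolic_time c L x n" "dist ((f ^^ n) x) b < \<rho>" using R(1) n(1) by auto
  obtain H where H: "inverse_branches c r x n H" using H0[OF nR(1)] by blast
  have near: "dist ((f ^^ n) x) (chart (Y j) w) < r" if "j < 3" "w \<in> ball 0 \<delta>" for j w
  proof -
    have "dist ((f ^^ n) x) (chart (Y j) w) \<le> dist ((f ^^ n) x) b + dist b (Y j) + dist (Y j) (chart (Y j) w)"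
      using dist_triangle[of "(f ^^ n) x" "chart (Y j) w" "Y j"] dist_triangle[of "(f ^^ n) x" "Y j" b] by linarith
    moreover have "dist (Y j) (chart (Y j) w) \<le> 8 * cmod w" by (rule dist_chart_center_le)
    moreover have "dist b (Y j) < r / 2" using Y(3)[OF that(1)] by (simp add: dist_commute)
    moreover have "cmod w < r / 32" using that(2) \<delta> by simp
    ultimately show ?thesis using nR(2) \<rho>(2) r by linarith
  qed
  define good where "good i j \<longleftrightarrow>
    (\<forall>w\<in>ball 0 \<delta>. chart ((f ^^ i) x) (H (n - i) (coord ((f ^^ n) x) (chart (Y j) w))) \<noteq> b) \<and>
    dist ((f ^^ (i - a)) x) (Y j) \<ge> 9 * \<delta>" for i j
  have ex_good: "\<exists>j<3. good i j" if "i \<in> S" for i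
    unfolding good_def using that r by (intro ex_good_target[OF H _ _ sep \<delta>(1) near]) (auto simp: S_def)
  have finS: "finite S" by (rule finite_subset[of _ "{..<n}"]) (auto simp: S_def)
  have "\<exists>j<3. card {i\<in>S. good i j} \<ge> M"
  proof (rule ccontr)
    assume "\<not> ?thesis"
    then have less: "card {i\<in>S. good i j} < M" if "j < 3" for j using that not_le by blast
    have "S = (\<Union>j<3. {i\<in>S. good i j})" using ex_good by auto
    then have "card S = card (\<Union>j<3. {i\<in>S. good i j})" by (rule arg_cong)
    also have "\<dots> \<le> (\<Sum>j<3. card {i\<in>S. good i j})" by (rule card_UN_le) simp
    also have "\<dots> < (\<Sum>j<(3::nat). M)" by (intro sum_strict_mono less) (auto simp: lessThan_empty_iff)
    finally show False using n(2) by (simp add: S_def)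
  qed
  then obtain j where j: "j < 3" "card {i\<in>S. good i j} \<ge> M" by blast
  define I where "I = {i\<in>S. good i j}"
  have ret: "i \<in> R" "i < n" "i \<le> n" "a \<le> i" "sm i \<le> sm n + 1" "good i j" "i + Q \<le> n" "dist ((f ^^ i) x) b < \<rho>" if "i \<in> I" for i
    using that R(1) R(3)[of i n] n(1) by (auto simp: I_def S_def)
  have close: "16 * r * exp (- c * real k) < min (\<eta> / 2) \<delta>" if "k \<ge> Q" for k
    using that by (intro Q0) (simp add: Q_def)
  define X where "X = chart (Y j) ` cball 0 (\<delta> / 2)"
  have "\<exists>g. \<forall>u\<in>X. g u \<in> X \<and> (f ^^ a) (g u) = chart ((f ^^ i) x) (H (n - i) (coord ((f ^^ n) x) u)) \<and>
    (\<forall>v\<in>X. dist (g u) (g v) \<le> 1 / 2 * dist u v)" if i: "i \<in> I" for i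
    unfolding X_def
  proof (rule return_branch[OF H r ret(3)[OF i] \<delta>(1) _ near[OF j(1)] _ \<kappa>(1-5)[OF j(1)]])
    show "\<delta> \<le> 1" using \<delta> r by simp
    have "dist b ((f ^^ i) x) < \<eta> / 2" using ret(8)[OF i] \<rho>(3) by (simp add: dist_commute)
    moreover have "16 * r * exp (- c * real (n - i)) < \<eta> / 2" using close[of "n - i"] ret(7)[OF i] by simp
    ultimately show "dist b ((f ^^ i) x) + 16 * r * exp (- c * real (n - i)) < min 1 (s j ^ m j)"
      using \<eta>'[OF j(1)] by linarith
    show "chart ((f ^^ i) x) (H (n - i) (coord ((f ^^ n) x) (chart (Y j) w))) \<noteq> b" if "w \<in> ball 0 \<delta>" for w
      using ret(6)[OF i] that unfolding good_def by blast
  qed auto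
  then obtain g where g: "\<And>i u. i \<in> I \<Longrightarrow> u \<in> X \<Longrightarrow> g i u \<in> X"
    "\<And>i u. i \<in> I \<Longrightarrow> u \<in> X \<Longrightarrow> (f ^^ a) (g i u) = chart ((f ^^ i) x) (H (n - i) (coord ((f ^^ n) x) u))"
    "\<And>i u v. i \<in> I \<Longrightarrow> u \<in> X \<Longrightarrow> v \<in> X \<Longrightarrow> dist (g i u) (g i v) \<le> 1 / 2 * dist u v"
    by metis
  have coordX: "coord ((f ^^ n) x) u \<in> ball 0 r" "chart ((f ^^ n) x) (coord ((f ^^ n) x) u) = u" if u: "u \<in> X" for u
  proof -
    obtain w where "w \<in> cball 0 (\<delta> / 2)" "u = chart (Y j) w" using u unfolding X_def by blast
    then have d: "dist ((f ^^ n) x) u < r" using near[OF j(1), of w] \<delta>(1) by simp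
    then have d1: "dist ((f ^^ n) x) u < 1" using r by simp
    show "coord ((f ^^ n) x) u \<in> ball 0 r" "chart ((f ^^ n) x) (coord ((f ^^ n) x) u) = u"
      using chart_coord(1,3)[OF d1] d by auto
  qed
  define T where "T i = a + (n - i)" for i
  have orbit: "(f ^^ (a + k)) (g i v) = chart ((f ^^ (n - (n - i - k))) x) (H (n - i - k) (coord ((f ^^ n) x) v))"
    if "i \<in> I" "v \<in> X" "k \<le> n - i" for i v k
    using inverse_branches_orbit[OF H coordX(1)[OF that(2)] that(3)] ret(3)[OF that(1)] g(2)[OF that(1,2)]
    by (simp add: funpow_add add.commute[of a])
  interpret free_branches f g X I T "1/2"
  proof
    show "isCont f z" for z by (rule isCont_f)
    show "compact X" unfolding X_def by (rule compact_continuous_image[OF continuous_chart compact_cball])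
    show "X \<noteq> {}" unfolding X_def using \<delta>(1) by simp
    show "finite I" unfolding I_def using finS by simp
    show "g i u \<in> X" if "i \<in> I" "u \<in> X" for i u using that by (rule g(1))
    show "(f ^^ T i) (g i v) = v" if "i \<in> I" "v \<in> X" for i v
      using orbit[OF that order_refl] coordX(2)[OF that(2)] inverse_branchesD(1)[OF H] by (simp add: T_def)
    show "T i > 0" if "i \<in> I" for i using ret(2)[OF that] by (simp add: T_def)
    show "inj_on T I" using ret(2) by (intro inj_onI) (force simp: T_def)
    show "dist (g i u) (g i v) \<le> 1 / 2 * dist u v" if "i \<in> I" "u \<in> X" "v \<in> X" for i u v using that by (rule g(3))
    show "f \<in> measurable (restrict_space borel (julia_set f)) (restrict_space borel (julia_set f))" by (rule fm)
    fix i l v assume il: "i \<in> I" "l \<in> I" "T i < T l" "v \<in> X"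
    show "(f ^^ (T l - T i)) (g l v) \<notin> X"
    proof
      assume inX: "(f ^^ (T l - T i)) (g l v) \<in> X"
      have "l < i" using il(3) ret(2)[OF il(1)] ret(2)[OF il(2)] by (simp add: T_def)
      then have lQ: "l + Q \<le> i" using ret(1) il R(3) by blast
      \<comment> \<open>After the \<open>a\<close> steps of the detour, \<open>k\<close> further
        steps along the branch for \<open>l\<close> lead to time \<open>i - a\<close> of the orbit
        of \<open>x\<close>; \<open>lQ\<close> and \<open>a < Q\<close> guarantee
        \<open>l + a \<le> i\<close>. There the branch is within \<delta> of
        \<open>(f ^^ (i - a)) x\<close>, while \<open>X\<close> is within
        \<open>4 * \<delta>\<close> of \<open>Y j\<close>, too little to bridge
        \<open>9 * \<delta>\<close>.\<close>
      define k where "k = i - l - a"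
      have aQ: "a < Q" by (simp add: Q_def)
      have iQ: "i + Q \<le> n" by (rule ret(7)[OF il(1)])
      have e: "T l - T i = a + k" "k \<le> n - l" "n - (n - l - k) = i - a" "n - l - k = n - i + a"
        using lQ aQ iQ by (auto simp: T_def k_def)
      define s' where "s' = chart ((f ^^ (i - a)) x) (H (n - i + a) (coord ((f ^^ n) x) v))"
      have eq: "(f ^^ (T l - T i)) (g l v) = s'"
        using orbit[OF il(2,4) e(2)] unfolding e(1,3) unfolding e(4) s'_def .
      have "dist ((f ^^ (i - a)) x) s' \<le> 8 * cmod (H (n - i + a) (coord ((f ^^ n) x) v))"
        unfolding s'_def by (rule dist_chart_center_le)
      also have "\<dots> \<le> 8 * (2 * r * exp (- c * real (n - i + a)))"
        using ret(4)[OF il(1)] ret(3)[OF il(1)] by (intro mult_left_mono inverse_branchesD(3)[OF H] coordX il) auto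
      also have "\<dots> = 16 * r * exp (- c * real (n - i + a))" by simp
      also have "\<dots> < \<delta>"
      proof -
        have "Q \<le> n - i + a" using iQ by simp
        from close[OF this] show ?thesis by (simp only: min_less_iff_conj)
      qed
      finally have 1: "dist ((f ^^ (i - a)) x) s' < \<delta>" .
      obtain w where w: "w \<in> cball 0 (\<delta> / 2)" "s' = chart (Y j) w" using inX unfolding eq X_def by blast
      have "dist s' (Y j) \<le> 8 * cmod w" unfolding w(2) by (rule dist_chart_center_le)
      moreover have "8 * cmod w \<le> 4 * \<delta>" using w(1) by simp
      ultimately have 2: "dist s' (Y j) \<le> 4 * \<delta>" by linarith
      have "dist ((f ^^ (i - a)) x) (Y j) \<ge> 9 * \<delta>" using ret(6)[OF il(1)] by (simp add: good_def)
      then show False using 1 2 \<delta>(1) dist_triangle[of "(f ^^ (i - a)) x" "Y j" s'] by linarith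
    qed
  qed auto
  \<comment> \<open>Below all derivatives along the orbit piece, so the truncation changes nothing
    there; the 1 makes the set nonempty and \<open>ln \<epsilon>\<close> nonpositive.\<close>
  define \<epsilon> where "\<epsilon> = Min (insert 1 ((\<lambda>k. spherical_deriv f ((f ^^ k) x)) ` {..<n}))"
  have \<epsilon>0: "\<epsilon> > 0" unfolding \<epsilon>_def using x(2) by (subst Min_gr_iff) auto
  have \<epsilon>1: "\<epsilon> \<le> 1" unfolding \<epsilon>_def by (intro Min_le) auto
  have \<epsilon>k: "\<epsilon> \<le> spherical_deriv f ((f ^^ k) x)" if "k < n" for k unfolding \<epsilon>_def using that by (intro Min_le) auto
  define \<psi> where "\<psi> z = \<phi> z - t * ln (max (spherical_deriv f z) \<epsilon>)" for z
  have lnb: "ln \<epsilon> \<le> ln (max (spherical_deriv f z) \<epsilon>)" "ln (max (spherical_deriv f z) \<epsilon>) \<le> ln \<Lambda>" for z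
    using \<epsilon>0 \<epsilon>1 \<Lambda>(1) \<Lambda>(3)[of z] by (auto intro!: ln_mono)
  have tln: "t * ln \<epsilon> \<le> t * ln (max (spherical_deriv f z) \<epsilon>)" "t * ln (max (spherical_deriv f z) \<epsilon>) \<le> t * ln \<Lambda>" for z
    using lnb t by (auto intro: mult_left_mono)
  have \<psi>low: "\<psi> z \<ge> - (B + t * ln \<Lambda>)" if "z \<in> julia_set f" for z
    using B(2)[OF that] tln(2)[of z] by (simp add: \<psi>_def)
  have t0: "t * ln \<epsilon> \<le> 0" "t * ln \<Lambda> \<ge> 0" using \<epsilon>0 \<epsilon>1 \<Lambda>(1) t by (auto simp: mult_nonneg_nonpos)
  have "\<exists>\<nu> h. invariant_prob f \<nu> \<and> measure_entropy \<nu> f \<ge> ereal h \<and> h + (\<integral>x. \<psi> x \<partial>\<nu>) > P0"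
  proof (rule large_pressure)
    show "\<psi> \<in> borel_measurable (restrict_space borel (julia_set f))"
      unfolding \<psi>_def using \<phi>m measurable_restrict_space1[OF spherical_deriv_measurable] by measurable
    show "\<bar>\<psi> z\<bar> \<le> B + t * ln \<Lambda> - t * ln \<epsilon>" if "z \<in> julia_set f" for z
      using B(2)[OF that] tln[of z] t0 unfolding \<psi>_def by linarith
    show "C2 \<ge> 0" by (rule C2)
    show "real (card I) > exp C2" using M j(2) unfolding I_def by linarith
    fix i v assume iv: "i \<in> I" "v \<in> X" "v \<in> julia_set f" "g i v \<in> julia_set f"
    define w where "w = coord ((f ^^ n) x) v"
    have ni: "n - (n - i) = i" using ret(3)[OF iv(1)] by simp
    have y: "(f ^^ a) (g i v) = chart ((f ^^ (n - (n - i))) x) (H (n - i) w)"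
      using g(2)[OF iv(1,2)] by (simp add: w_def ni)
    have yJ: "(f ^^ k) (chart ((f ^^ (n - (n - i))) x) (H (n - i) w)) \<in> julia_set f" for k
      unfolding y[symmetric] by (intro fJ iv)
    have "birkhoff_sum f \<psi> (n - i) ((f ^^ a) (g i v)) \<ge>
      birkhoff_sum f (\<lambda>z. \<phi> z - t * log_deriv z) (n - i) ((f ^^ (n - (n - i))) x) - C1"
      unfolding C1_def \<psi>_def[abs_def] y
      by (rule branch_birkhoff_sum_ge[OF H c r(1) _ _ fJ[OF x(1)] yJ holder(4) holder(1) holder(3) t \<epsilon>0 \<epsilon>k])
        (use coordX(1)[OF iv(2)] in \<open>auto simp: w_def\<close>)
    moreover have "birkhoff_sum f (\<lambda>z. \<phi> z - t * log_deriv z) (n - i) ((f ^^ (n - (n - i))) x) = sm n - sm i + real (n - i) * P0"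
    proof -
      have "n = i + (n - i)" using ret(3)[OF iv(1)] by simp
      then have "sm n = sm i + birkhoff_sum f u (n - i) ((f ^^ i) x)" unfolding sm_def by (metis birkhoff_sum_add)
      moreover have "birkhoff_sum f u (n - i) ((f ^^ i) x) = birkhoff_sum f (\<lambda>z. \<phi> z - t * log_deriv z) (n - i) ((f ^^ i) x) - real (n - i) * P0"
        unfolding birkhoff_sum_def u_def by (simp add: sum_subtractf)
      ultimately show ?thesis unfolding ni by simp
    qed
    moreover have "birkhoff_sum f \<psi> a (g i v) \<ge> real a * (- (B + t * ln \<Lambda>))"
    proof -
      have "(\<Sum>k<a. - (B + t * ln \<Lambda>)) \<le> birkhoff_sum f \<psi> a (g i v)"
        unfolding birkhoff_sum_def by (intro sum_mono \<psi>low fJ iv)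
      then show ?thesis by simp
    qed
    moreover have "birkhoff_sum f \<psi> (T i) (g i v) = birkhoff_sum f \<psi> a (g i v) + birkhoff_sum f \<psi> (n - i) ((f ^^ a) (g i v))"
      unfolding T_def by (rule birkhoff_sum_add)
    moreover have "sm i \<le> sm n + 1" by (rule ret(5)[OF iv(1)])
    moreover have "real a * P0 \<le> real a * \<bar>P0\<bar>" by (intro mult_left_mono) auto
    ultimately show "real (T i) * P0 - C2 \<le> birkhoff_sum f \<psi> (T i) (g i v)"
      unfolding C2_def by (simp add: T_def algebra_simps)
  qed
  then show ?thesis using that[OF \<epsilon>0] unfolding \<psi>_def P0_def by blast
qed

section \<open>From the truncated potential to the pressure\<close>

lemma integrable_clipped_log_deriv:
  assumes inv: "invariant_prob f \<nu>" and \<epsilon>: "\<epsilon> > 0"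
  shows "integrable \<nu> (\<lambda>z. ln (max (spherical_deriv f z) \<epsilon>))"
proof -
  interpret prob_space \<nu> using inv unfolding invariant_prob_def by (rule conjunct1)
  note [measurable] = spherical_deriv_measurable_invariant[OF inv]
  obtain \<Lambda> where \<Lambda>: "\<And>x. spherical_deriv f x \<le> \<Lambda>"
    by (rule spherical_deriv_bounds) (rule that)
  let ?g = "\<lambda>z. ln (max (spherical_deriv f z) \<epsilon>)"
  have "norm (?g z) \<le> \<bar>ln \<epsilon>\<bar> + \<bar>ln (max \<Lambda> \<epsilon>)\<bar>" for z
  proof -
    have "ln \<epsilon> \<le> ?g z" "?g z \<le> ln (max \<Lambda> \<epsilon>)"
      using \<epsilon> \<Lambda>[of z] by (auto intro!: ln_mono)
    then show ?thesis unfolding real_norm_def by linarith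
  qed
  then show ?thesis
    by (intro integrable_const_bound[where B = "\<bar>ln \<epsilon>\<bar> + \<bar>ln (max \<Lambda> \<epsilon>)\<bar>"] AE_I2) measurable
qed

text \<open>Truncation raises the logarithm, hence bounds the exponent from above by a finite
  integral, also when the exponent is minus infinity. For \<open>t \<ge> 0\<close> the truncated
  free energy is therefore a lower bound for the true one.\<close>

lemma lyapunov_exponent_le:
  assumes inv: "invariant_prob f \<nu>" and \<epsilon>: "\<epsilon> > 0"
  shows "lyapunov_exponent f \<nu> \<le> ereal (\<integral>z. ln (max (spherical_deriv f z) \<epsilon>) \<partial>\<nu>)"
proof -
  interpret prob_space \<nu> using inv unfolding invariant_prob_def by (rule conjunct1)
  define g where "g z = ln (max (spherical_deriv f z) \<epsilon>)" for z
  have int: "integrable \<nu> g"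
    unfolding g_def by (rule integrable_clipped_log_deriv[OF inv \<epsilon>])
  have le: "eln (spherical_deriv f z) \<le> ereal (g z)" for z
    using \<epsilon> unfolding eln_def g_def by (auto intro!: ln_mono)
  define P where "P = (\<integral>\<^sup>+ x. e2ennreal (max 0 (eln (spherical_deriv f x))) \<partial>\<nu>)"
  define Q where "Q = (\<integral>\<^sup>+ x. e2ennreal (max 0 (- eln (spherical_deriv f x))) \<partial>\<nu>)"
  define P' where "P' = (\<integral>\<^sup>+ x. ennreal (g x) \<partial>\<nu>)"
  define Q' where "Q' = (\<integral>\<^sup>+ x. ennreal (- g x) \<partial>\<nu>)"
  have "P \<le> P'"
    unfolding P_def P'_def
  proof (rule nn_integral_mono)
    fix x
    have "max 0 (eln (spherical_deriv f x)) \<le> max 0 (ereal (g x))" by (intro max.mono order_refl le)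
    from e2ennreal_mono[OF this] show "e2ennreal (max 0 (eln (spherical_deriv f x))) \<le> ennreal (g x)"
      unfolding e2ennreal_pos_part .
  qed
  moreover have "Q' \<le> Q"
    unfolding Q_def Q'_def
  proof (rule nn_integral_mono)
    fix x
    have "- ereal (g x) \<le> - eln (spherical_deriv f x)" using le[of x] by (simp only: ereal_minus_le_minus)
    then have "max 0 (ereal (- g x)) \<le> max 0 (- eln (spherical_deriv f x))" by (intro max.mono order_refl) simp
    from e2ennreal_mono[OF this] show "ennreal (- g x) \<le> e2ennreal (max 0 (- eln (spherical_deriv f x)))"
      unfolding e2ennreal_pos_part .
  qed
  moreover have fin: "P' < \<infinity>" "Q' < \<infinity>"
    using int unfolding real_integrable_def P'_def Q'_def by (auto simp: less_top)
  moreover have "(\<integral>z. g z \<partial>\<nu>) = enn2real P' - enn2real Q'"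
    unfolding P'_def Q'_def by (rule real_lebesgue_integral_def[OF int])
  then have "ereal (\<integral>z. g z \<partial>\<nu>) = enn2ereal P' - enn2ereal Q'"
    using fin by (cases P'; cases Q') auto
  moreover have "lyapunov_exponent f \<nu> = enn2ereal P - enn2ereal Q"
    unfolding lyapunov_exponent_def ereal_integral_def P_def Q_def ..
  ultimately show ?thesis
    unfolding g_def[symmetric] by (simp add: ereal_minus_mono less_eq_ennreal.rep_eq)
qed

lemma pressure_ge:
  assumes inv: "invariant_prob f \<nu>" and \<phi>: "holder_continuous_on (julia_set f) \<phi>" and t: "t \<ge> 0" and \<epsilon>: "\<epsilon> > 0"
    and h: "measure_entropy \<nu> f \<ge> ereal h"
  shows "pressure f \<phi> t \<ge> ereal (h + (\<integral>z. \<phi> z - t * ln (max (spherical_deriv f z) \<epsilon>) \<partial>\<nu>))"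
proof -
  interpret prob_space \<nu> using inv unfolding invariant_prob_def by (rule conjunct1)
  have sets: "sets \<nu> = sets (restrict_space borel (julia_set f))" using inv by (auto simp: invariant_prob_def)
  have spJ: "space \<nu> = julia_set f" using sets_eq_imp_space_eq[OF sets] by (simp add: space_restrict_space)
  define g where "g z = ln (max (spherical_deriv f z) \<epsilon>)" for z
  have int: "integrable \<nu> g"
    unfolding g_def by (rule integrable_clipped_log_deriv[OF inv \<epsilon>])
  obtain B where B: "B \<ge> 0" "\<And>z. z \<in> julia_set f \<Longrightarrow> \<bar>\<phi> z\<bar> \<le> B"
    by (rule holder_bounded[OF \<phi>]) (rule that)
  have "\<phi> \<in> borel_measurable \<nu>" using holder_continuous[OF \<phi>] measurable_cong_sets[OF sets refl] by blast
  then have \<phi>int: "integrable \<nu> \<phi>"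
    by (intro integrable_const_bound[where B = B]) (use B spJ in auto)
  have "ereal t * lyapunov_exponent f \<nu> \<le> ereal t * ereal (\<integral>z. g z \<partial>\<nu>)"
    using lyapunov_exponent_le[OF inv \<epsilon>] t unfolding g_def by (intro ereal_mult_left_mono) auto
  moreover have "ereal (h + (\<integral>z. \<phi> z - t * g z \<partial>\<nu>)) =
      ereal h + ereal (\<integral>z. \<phi> z \<partial>\<nu>) - ereal t * ereal (\<integral>z. g z \<partial>\<nu>)"
    using int \<phi>int by simp
  moreover have "ereal h + ereal (\<integral>z. \<phi> z \<partial>\<nu>) \<le> measure_entropy \<nu> f + ereal (\<integral>z. \<phi> z \<partial>\<nu>)"
    using h by (rule add_right_mono)
  ultimately have "ereal (h + (\<integral>z. \<phi> z - t * g z \<partial>\<nu>)) \<le>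
      measure_entropy \<nu> f + ereal (\<integral>z. \<phi> z \<partial>\<nu>) - ereal t * lyapunov_exponent f \<nu>"
    by (simp only: ereal_minus_mono)
  also have "\<dots> \<le> pressure f \<phi> t"
    unfolding pressure_def by (intro SUP_upper) (simp add: inv)
  finally show ?thesis unfolding g_def .
qed

end

theorem mainTheorem4:
  fixes f :: "riemann_sphere \<Rightarrow> riemann_sphere" and d :: nat
    and \<mu> :: "riemann_sphere measure"
    and \<phi> :: "riemann_sphere \<Rightarrow> real" and t :: real
  assumes "rational_map_of_degree f d" and "d \<ge> 2"
    and "ergodic_prob f \<mu>"
    and "lyapunov_exponent f \<mu> > 0"
    and "holder_continuous_on (julia_set f) \<phi>"
    and "t \<ge> 0"
  shows "pressure f \<phi> t > ereal (\<integral>z. \<phi> z \<partial>\<mu>) - ereal t * lyapunov_exponent f \<mu>"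
proof -
  obtain p q where pq: "coprime p q" "q \<noteq> 0" "f = rational_eval p q" "d = max (degree p) (degree q)"
    using assms(1) unfolding rational_map_of_degree_def by blast
  interpret rational_dynamics p q f d by unfold_locales (use pq assms(2) in auto)
  have inv: "invariant_prob f \<mu>" using assms(3) by (simp add: ergodic_prob_def)
  obtain \<epsilon> \<nu> h where \<nu>: "\<epsilon> > 0" "invariant_prob f \<nu>" "measure_entropy \<nu> f \<ge> ereal h"
    "h + (\<integral>z. \<phi> z - t * ln (max (spherical_deriv f z) \<epsilon>) \<partial>\<nu>) > (\<integral>z. \<phi> z \<partial>\<mu>) - t * (\<integral>z. log_deriv z \<partial>\<mu>)"
    by (rule dominating_measure[OF assms(3-6)]) (rule that)
  have "ereal (\<integral>z. \<phi> z \<partial>\<mu>) - ereal t * lyapunov_exponent f \<mu> = ereal ((\<integral>z. \<phi> z \<partial>\<mu>) - t * (\<integral>z. log_deriv z \<partial>\<mu>))"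
    using lyapunov_exponent_real(3)[OF inv assms(4)] by simp
  also have "\<dots> < ereal (h + (\<integral>z. \<phi> z - t * ln (max (spherical_deriv f z) \<epsilon>) \<partial>\<nu>))"
    using \<nu>(4) by simp
  also have "\<dots> \<le> pressure f \<phi> t" by (rule pressure_ge[OF \<nu>(2) assms(5,6) \<nu>(1,3)])
  finally show ?thesis .
qed

end
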